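(* Let $\mathbb{F}$ be a field, let $\mathcal{S}\subseteq\mathbb{F}$ be a finite subset of size $s$, and let $d\ge 0$ be an integer. The family of degree-$d$ functions from $\mathcal{S}^n$ to $\mathbb{F}$ is locally testable with a non-adaptive, one-sided tester that makes $(sd)^{O(s^3 d)}=O_{s,d}(1)$ queries to the function being tested.
   Context: A function $f:\mathcal{S}^n\to\mathbb{F}$ is degree-$d$ if there is a polynomial $P\in\mathbb{F}[x_1,\dots,x_n]$ of total degree at most $d$ with $P(x)=f(x)$ for all $x\in\mathcal{S}^n$. For a family $\mathcal{F}$ of functions on a finite domain, the distance $\delta_{\mathcal{F}}(f)$ is the minimum over $g\in\mathcal{F}$ of the fraction of (uniformly random) inputs where $f$ and $g$ differ. $\mathcal{F}$ is $q$-locally testable if there is a randomized algorithm making at most $q$ oracle queries to $f$ that accepts with probability $1$ when $f\in\mathcal{F}$ and rejects with probability at least $\delta_{\mathcal{F}}(f)/2$ when $f\notin\mathcal{F}$. One-sided: always accepts members of $\mathcal{F}$; non-adaptive: queries are chosen before any answers are seen and the decision is a deterministic predicate of the answers.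
   Formalization: In the query bound (sd)^{O(s^3 d)}, d is replaced by max(1,d): at d = 0 the literal bound is 0^0 = 1, but one query cannot test constancy. The O-constant is uniform over all fields with elements in an arbitrary fixed type. *)

theory Defs
  imports
    "HOL-Algebra.Indexed_Polynomials"
    "HOL-Probability.Probability_Mass_Function"
begin

section \<open>Low-degree functions on a grid\<close>

text \<open>Points of $S^n$ are extensional functions on \<open>{..<n}\<close>.\<close>

definition grid :: "'a set \<Rightarrow> nat \<Rightarrow> (nat \<Rightarrow> 'a) set"
  where "grid S n = {..<n} \<rightarrow>\<^sub>E S"

text \<open>
  Polynomials over \<open>F\<close> in the variables \<open>I\<close> are the elements of the library's
  \<^const>\<open>ring.indexed_pset\<close>: a monomial is a multiset of variables, and a polynomial maps
  monomials to coefficients. The library only provides a map that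
  assembles such a polynomial from its coefficients in one variable
  (\<^const>\<open>ring.indexed_eval\<close>), so substitution of field elements is defined here. Members of
  \<^const>\<open>ring.indexed_pset\<close> have finitely many nonzero coefficients, hence the \<open>finsum\<close>
  is over a finite set.
\<close>

definition peval :: "('a, 'm) ring_scheme \<Rightarrow> ('c multiset \<Rightarrow> 'a) \<Rightarrow> ('c \<Rightarrow> 'a) \<Rightarrow> 'a"
  where "peval F P x =
    (\<Oplus>\<^bsub>F\<^esub>m\<in>{m. P m \<noteq> \<zero>\<^bsub>F\<^esub>}. P m \<otimes>\<^bsub>F\<^esub> (\<Otimes>\<^bsub>F\<^esub>i\<in>set_mset m. x i [^]\<^bsub>F\<^esub> count m i))"

definition total_degree_le :: "('a, 'm) ring_scheme \<Rightarrow> ('c multiset \<Rightarrow> 'a) \<Rightarrow> nat \<Rightarrow> bool"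
  where "total_degree_le F P d \<longleftrightarrow> (\<forall>m. P m \<noteq> \<zero>\<^bsub>F\<^esub> \<longrightarrow> size m \<le> d)"

definition low_degree_functions ::
  "('a, 'm) ring_scheme \<Rightarrow> 'a set \<Rightarrow> nat \<Rightarrow> nat \<Rightarrow> ((nat \<Rightarrow> 'a) \<Rightarrow> 'a) set"
  where "low_degree_functions F S n d =
    {f \<in> grid S n \<rightarrow>\<^sub>E carrier F.
      \<exists>P \<in> ring.indexed_pset F {..<n} (carrier F).
        total_degree_le F P d \<and> (\<forall>x \<in> grid S n. peval F P x = f x)}"


section \<open>Distance and local testability\<close>

definition rel_dist :: "'x set \<Rightarrow> ('x \<Rightarrow> 'y) \<Rightarrow> ('x \<Rightarrow> 'y) \<Rightarrow> real"
  where "rel_dist D f g = real (card {x \<in> D. f x \<noteq> g x}) / real (card D)"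

definition family_dist :: "'x set \<Rightarrow> ('x \<Rightarrow> 'y) set \<Rightarrow> ('x \<Rightarrow> 'y) \<Rightarrow> real"
  where "family_dist D \<F> f = Min (rel_dist D f ` \<F>)"

text \<open>The minimum is over a finite set even when the family is infinite.\<close>

lemma finite_rel_dist_image:
  assumes "finite D"
  shows "finite (rel_dist D f ` \<F>)"
proof (rule finite_subset)
  show "rel_dist D f ` \<F> \<subseteq> (\<lambda>k. real k / real (card D)) ` {..card D}"
    using assms by (auto simp: rel_dist_def intro!: imageI card_mono)
qed simp

text \<open>
  A non-adaptive tester is a distribution \<open>\<mu>\<close> on query lists together with a predicate
  \<open>accept\<close>. The list is drawn without access to the tested function, and
  once it is drawn the decision is a deterministic predicate of the list of answers.
  The tester may depend on \<open>D\<close>, \<open>Y\<close> and \<open>\<F>\<close>, but not on \<open>f\<close>.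
\<close>

definition nonadaptive_one_sided_testable ::
  "nat \<Rightarrow> 'x set \<Rightarrow> 'y set \<Rightarrow> ('x \<Rightarrow> 'y) set \<Rightarrow> bool"
  where "nonadaptive_one_sided_testable q D Y \<F> \<longleftrightarrow>
    (\<exists>(\<mu> :: 'x list pmf) (accept :: 'x list \<Rightarrow> 'y list \<Rightarrow> bool).
      (\<forall>xs \<in> set_pmf \<mu>. set xs \<subseteq> D \<and> length xs \<le> q) \<and>
      (\<forall>f \<in> D \<rightarrow>\<^sub>E Y.
        (f \<in> \<F> \<longrightarrow> measure_pmf.prob \<mu> {xs. accept xs (map f xs)} = 1) \<and>
        (f \<notin> \<F> \<longrightarrow> measure_pmf.prob \<mu> {xs. \<not> accept xs (map f xs)} \<ge> family_dist D \<F> f / 2)))"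

text \<open>
  Query bound $(sd)^{C s^3 d}$, where \<open>C\<close> is the constant hidden in the \<open>O\<close>-notation.
  Fields are records rather than a type class so that a single \<open>C\<close> can be quantified
  outside the field.
  Degree 0 is charged as degree 1: read literally, the formula would give
  \<open>0 ^ 0 = 1\<close> at \<open>d = 0\<close>, but a one-sided tester for constant functions needs two queries
  as soon as \<open>S\<close> has two elements and \<open>n > 0\<close>.
\<close>

definition query_bound :: "nat \<Rightarrow> nat \<Rightarrow> nat \<Rightarrow> nat"
  where "query_bound C s d = (s * max 1 d) ^ (C * s ^ 3 * max 1 d)"

end

theory Submission
  imports Defs
begin

text \<open>
  A test keeps a point \<open>x\<close> on a few of \<open>K\<close> random blocks of coordinates and replaces it by an
  independent uniform \<open>y\<close> on the others. Moebius inversion over blocks expresses \<open>f x\<close>, for \<open>f\<close>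
  of junta-degree at most \<open>d\<close>, through such points that keep \<open>x\<close> on at most \<open>d\<close> blocks. If the
  test rejects \<open>f\<close> with small probability \<open>\<rho>\<close>, replace \<open>f\<close> by its most popular votes. A matrix
  whose rows and columns are tests shows that a test can reject the new function only where a
  strongly noisy version of a test is likely to reject \<open>f\<close>, and by hypercontractivity this
  has probability \<open>O (\<rho> powr (4/3))\<close>. Iterating, \<open>f\<close> is \<open>4 * \<rho>\<close>-close to a function \<open>g\<close> that
  passes every test, that is, to a function of junta-degree at most \<open>d\<close>.

  To distinguish low degree from low junta-degree, colour the coordinates at random, draw a
  random point and let permutations of \<open>S\<close> act on it, one for each colour; every resulting point
  is uniform. If \<open>g\<close> at this point is always a polynomial of degree \<open>e\<close> in the entries of the
  permutations, then divided differences along transpositions show that \<open>g\<close> has degree \<open>e\<close>;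
  otherwise a Schwartz--Zippel argument makes a random choice detect the failure with
  probability bounded below.
\<close>

section \<open>Averages over product sets\<close>

text \<open>The queries of a vote at \<open>x\<close> share coordinates with \<open>x\<close>, so at
  an exceptional \<open>x\<close> the votes may be misleading however small \<rho> is. One
  correction therefore need not give a function that passes every test, and a bound linear in \<rho>
  for its rejection probability could not be iterated. A better exponent is needed. It comes from
  the small fraction of kept blocks: around a point or a test, a row of the matrix is a very noisy
  copy, and this noise contracts from the 3/2-norm to the 2-norm. For an event of probability \<rho>
  the squared 3/2-norm is \<rho> powr (4/3), which beats \<rho> / 2 below an explicit threshold; the
  corrections then converge geometrically.

  Low junta-degree allows any dependence on a single coordinate, so the degree within coordinates
  needs a second test. Giving all coordinates of one colour the same value would query points that
  are far from uniform, where closeness of \<open>f\<close> and \<open>g\<close> says nothing. With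
  permutations every query is uniform, and closeness survives a union bound over all of
  them.\<close>

definition avg :: "'a set \<Rightarrow> ('a \<Rightarrow> real) \<Rightarrow> real"
  where "avg A f = (\<Sum>x\<in>A. f x) / real (card A)"

lemma avg_singleton [simp]: "avg {x} f = f x"
  by (simp add: avg_def)

lemma avg_cong: "(\<And>x. x \<in> A \<Longrightarrow> f x = g x) \<Longrightarrow> avg A f = avg A g"
  by (simp add: avg_def cong: sum.cong)

lemma avg_add: "avg A (\<lambda>x. f x + g x) = avg A f + avg A g"
  by (simp add: avg_def sum.distrib add_divide_distrib)

lemma avg_cmult: "avg A (\<lambda>x. c * f x) = c * avg A f"
  by (simp add: avg_def sum_distrib_left)

lemma avg_sum: "avg A (\<lambda>x. \<Sum>i\<in>I. f i x) = (\<Sum>i\<in>I. avg A (f i))"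
  by (simp add: avg_def sum_divide_distrib sum.swap[of _ I A])

lemma avg_mono: "(\<And>x. x \<in> A \<Longrightarrow> f x \<le> g x) \<Longrightarrow> avg A f \<le> avg A g"
  by (simp add: avg_def divide_right_mono sum_mono)

lemma avg_nonneg: "(\<And>x. x \<in> A \<Longrightarrow> 0 \<le> f x) \<Longrightarrow> 0 \<le> avg A f"
  by (simp add: avg_def sum_nonneg)

lemma avg_const: "finite A \<Longrightarrow> A \<noteq> {} \<Longrightarrow> avg A (\<lambda>_. c) = c"
  by (simp add: avg_def)

lemma avg_le_const:
  "finite A \<Longrightarrow> A \<noteq> {} \<Longrightarrow> (\<And>x. x \<in> A \<Longrightarrow> f x \<le> c) \<Longrightarrow> avg A f \<le> c"
  using avg_mono[of A f "\<lambda>_. c"] by (simp add: avg_const)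

lemma avg_Times: "avg (A \<times> B) f = avg A (\<lambda>a. avg B (\<lambda>b. f (a, b)))"
  by (simp add: avg_def card_cartesian_product sum.cartesian_product sum_divide_distrib[symmetric] mult.commute)

lemma avg_swap: "avg A (\<lambda>a. avg B (\<lambda>b. f a b)) = avg B (\<lambda>b. avg A (\<lambda>a. f a b))"
  by (simp add: avg_def sum_divide_distrib[symmetric] sum.swap[of _ A B] mult.commute)

lemma avg_of_bool: "finite A \<Longrightarrow> avg A (\<lambda>x. of_bool (P x)) = card {x \<in> A. P x} / card A"
  by (simp add: avg_def Int_def)

lemma avg_mult_avg: "avg A f * avg B g = avg A (\<lambda>a. avg B (\<lambda>b. f a * g b))"
  by (simp add: avg_def sum_product sum_divide_distrib mult.commute)

lemma avg_Cauchy_Schwarz: "(avg A (\<lambda>x. f x * g x))\<^sup>2 \<le> avg A (\<lambda>x. (f x)\<^sup>2) * avg A (\<lambda>x. (g x)\<^sup>2)"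
proof -
  have "(\<Sum>x\<in>A. f x * g x)\<^sup>2 \<le> (\<Sum>x\<in>A. (f x)\<^sup>2) * (\<Sum>x\<in>A. (g x)\<^sup>2)"
    by (rule Cauchy_Schwarz_ineq_sum)
  then show ?thesis
    by (simp add: avg_def power_divide power2_eq_square divide_right_mono)
qed

lemma avg_power2_le:
  assumes "finite A" "A \<noteq> {}"
  shows "(avg A f)\<^sup>2 \<le> avg A (\<lambda>x. (f x)\<^sup>2)"
  using avg_Cauchy_Schwarz[of A f "\<lambda>_. 1"] assms by (simp add: avg_const)

lemma PiE_upd: "v \<in> PiE L (\<lambda>_. A) \<Longrightarrow> a \<in> A \<Longrightarrow> v(l := a) \<in> PiE (insert l L) (\<lambda>_. A)"
  by (auto simp: PiE_def extensional_def)

lemma avg_PiE_insert: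
  assumes "l \<notin> L"
  shows "avg (PiE (insert l L) (\<lambda>_. A)) f = avg A (\<lambda>a. avg (PiE L (\<lambda>_. A)) (\<lambda>w. f (w(l := a))))"
proof -
  have inj: "inj_on (\<lambda>(y, g). g(l := y)) (A \<times> PiE L (\<lambda>_. A))"
    using inj_combinator[OF assms, of "\<lambda>_. A"] by simp
  have eq: "PiE (insert l L) (\<lambda>_. A) = (\<lambda>(y, g). g(l := y)) ` (A \<times> PiE L (\<lambda>_. A))"
    by (simp add: PiE_insert_eq)
  have "avg (PiE (insert l L) (\<lambda>_. A)) f = avg (A \<times> PiE L (\<lambda>_. A)) (\<lambda>(y, g). f (g(l := y)))"
    unfolding avg_def eq card_image[OF inj] sum.reindex[OF inj] by (simp add: comp_def case_prod_unfold)
  then show ?thesis by (simp add: avg_Times)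
qed

text \<open>Random choices are independent over the coordinates. Writing every derived point as
  \<open>pmap\<close> or \<open>pmap2\<close> of a map on letters reduces a claim about
  distributions over \<open>L\<close> to a check on one letter.\<close>

definition pmap :: "'l set \<Rightarrow> ('a \<Rightarrow> 'b) \<Rightarrow> ('l \<Rightarrow> 'a) \<Rightarrow> 'l \<Rightarrow> 'b"
  where "pmap L h w = (\<lambda>l\<in>L. h (w l))"

definition pmap2 :: "'l set \<Rightarrow> ('a \<Rightarrow> 'b \<Rightarrow> 'c) \<Rightarrow> ('l \<Rightarrow> 'a) \<Rightarrow> ('l \<Rightarrow> 'b) \<Rightarrow> 'l \<Rightarrow> 'c"
  where "pmap2 L h w w' = (\<lambda>l\<in>L. h (w l) (w' l))"

lemma pmap_insert: "l \<notin> L \<Longrightarrow> pmap (insert l L) h (w(l := a)) = (pmap L h w)(l := h a)"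
  by (auto simp: pmap_def fun_eq_iff)

lemma pmap2_insert:
  "l \<notin> L \<Longrightarrow> pmap2 (insert l L) h (w(l := a)) (w'(l := b)) = (pmap2 L h w w')(l := h a b)"
  by (auto simp: pmap2_def fun_eq_iff)

text \<open>\<open>h\<close> carries the uniform distribution on \<open>A\<close> to the one on
  \<open>B\<close>. With test functions instead of fibre sizes, the induction over coordinates only
  rewrites iterated averages.\<close>

definition avg_preserving :: "'a set \<Rightarrow> 'b set \<Rightarrow> ('a \<Rightarrow> 'b) \<Rightarrow> bool"
  where "avg_preserving A B h \<longleftrightarrow> (\<forall>u. avg A (\<lambda>a. u (h a)) = avg B u)"

lemma avg_preserving_pmap:
  assumes "finite L" "avg_preserving A B h"
  shows "avg_preserving (PiE L (\<lambda>_. A)) (PiE L (\<lambda>_. B)) (pmap L h)"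
  using assms(1)
proof (induction L)
  case empty
  show ?case by (simp add: avg_preserving_def pmap_def)
next
  case (insert l L)
  show ?case unfolding avg_preserving_def
  proof
    fix u :: "_ \<Rightarrow> real"
    have "avg (PiE (insert l L) (\<lambda>_. A)) (\<lambda>a. u (pmap (insert l L) h a))
      = avg A (\<lambda>a. avg (PiE L (\<lambda>_. A)) (\<lambda>w. u ((pmap L h w)(l := h a))))"
      using insert.hyps by (simp add: avg_PiE_insert pmap_insert)
    also have "\<dots> = avg A (\<lambda>a. avg (PiE L (\<lambda>_. B)) (\<lambda>w. u (w(l := h a))))"
      using insert.IH unfolding avg_preserving_def
      by (intro avg_cong) (drule spec, assumption)
    also have "\<dots> = avg B (\<lambda>a. avg (PiE L (\<lambda>_. B)) (\<lambda>w. u (w(l := a))))"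
      using assms(2)[unfolded avg_preserving_def, rule_format, of "\<lambda>a. avg (PiE L (\<lambda>_. B)) (\<lambda>w. u (w(l := a)))"] .
    finally show "avg (PiE (insert l L) (\<lambda>_. A)) (\<lambda>a. u (pmap (insert l L) h a)) = avg (PiE (insert l L) (\<lambda>_. B)) u"
      using insert.hyps by (simp add: avg_PiE_insert)
  qed
qed

lemma avg_PiE_Times:
  assumes "finite L"
  shows "avg (PiE L (\<lambda>_. A \<times> B)) u =
    avg (PiE L (\<lambda>_. A)) (\<lambda>a. avg (PiE L (\<lambda>_. B)) (\<lambda>b. u (pmap2 L Pair a b)))"
  using assms
proof (induction L arbitrary: u)
  case empty
  show ?case by (simp add: pmap2_def)
next
  case (insert l L)
  have "avg (PiE (insert l L) (\<lambda>_. A \<times> B)) u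
     = avg A (\<lambda>a. avg B (\<lambda>b. avg (PiE L (\<lambda>_. A)) (\<lambda>\<alpha>. avg (PiE L (\<lambda>_. B)) (\<lambda>\<beta>. u ((pmap2 L Pair \<alpha> \<beta>)(l := (a, b)))))))"
    using insert by (simp add: avg_PiE_insert avg_Times)
  also have "\<dots> = avg A (\<lambda>a. avg (PiE L (\<lambda>_. A)) (\<lambda>\<alpha>. avg B (\<lambda>b. avg (PiE L (\<lambda>_. B)) (\<lambda>\<beta>. u ((pmap2 L Pair \<alpha> \<beta>)(l := (a, b)))))))"
    by (intro avg_cong avg_swap)
  finally show ?case using insert.hyps by (simp add: avg_PiE_insert pmap2_insert)
qed

section \<open>Hypercontractivity of strong noise\<close>

text \<open>The normalised norm of exponent 3/2, meant for nonnegative functions. With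
  \<open>u = w ^ 2\<close> the power \<open>u powr (3/2)\<close> becomes \<open>w ^ 3\<close>, which
  turns the one-coordinate inequality into a polynomial one.\<close>

definition norm32 :: "'a set \<Rightarrow> ('a \<Rightarrow> real) \<Rightarrow> real"
  where "norm32 A u = (avg A (\<lambda>x. u x powr (3/2))) powr (2/3)"

lemma norm32_nonneg: "0 \<le> norm32 A u"
  by (simp add: norm32_def)

lemma norm32_power3: "norm32 A u ^ 3 = (avg A (\<lambda>x. u x powr (3/2)))\<^sup>2"
proof -
  have e: "0 \<le> avg A (\<lambda>x. u x powr (3/2))" by (simp add: avg_nonneg)
  show ?thesis
  proof (cases "avg A (\<lambda>x. u x powr (3/2)) = 0")
    case False
    then have "norm32 A u ^ 3 = norm32 A u powr 3"
      using e by (simp add: norm32_def)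
    then show ?thesis using e False by (simp add: norm32_def powr_powr)
  qed (simp add: norm32_def)
qed

lemma norm32_insert:
  assumes "l \<notin> L"
  shows "norm32 A (\<lambda>a. norm32 (PiE L (\<lambda>_. A)) (\<lambda>v. u (v(l := a)))) = norm32 (PiE (insert l L) (\<lambda>_. A)) u"
proof -
  have "(norm32 (PiE L (\<lambda>_. A)) g) powr (3/2) = avg (PiE L (\<lambda>_. A)) (\<lambda>v. g v powr (3/2))" for g
    by (simp add: norm32_def powr_powr avg_nonneg)
  then show ?thesis using assms by (simp add: norm32_def[of A] norm32_def[of "PiE (insert l L) (\<lambda>_. A)"] avg_PiE_insert)
qed

text \<open>Here \<open>w ^ 2\<close> is a value and \<open>a ^ 2\<close> the mean:
  \<open>a * u powr (3/2)\<close> lies above its tangent at the mean by a quadratic margin. Right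
  side minus left side is \<open>(w - a) ^ 2 * (a * (2 * w + a) - 2 * t * (w + a) ^ 2)\<close>, and
  \<open>w \<le> c * a\<close> keeps the second factor nonnegative for small
  \<open>t\<close>.\<close>

lemma pointwise_three_halves:
  fixes w a c t :: real
  assumes "0 \<le> w" "0 < a" "w \<le> c * a" "0 \<le> t" "t * (2 * (1 + c)) \<le> 1"
  shows "2 * a ^ 4 + 3 * a\<^sup>2 * (w\<^sup>2 - a\<^sup>2) + 2 * (t * (w\<^sup>2 - a\<^sup>2)\<^sup>2) \<le> 2 * (a * w ^ 3)"
proof -
  have "t * (w + a)\<^sup>2 \<le> t * ((w + a) * ((1 + c) * a))"
    unfolding power2_eq_square using assms by (intro mult_left_mono) (auto simp: algebra_simps)
  also have "\<dots> = (t * (2 * (1 + c))) * ((w + a) * a / 2)"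
    by (simp add: field_simps)
  also have "\<dots> \<le> 1 * ((w + a) * a / 2)"
    using assms by (intro mult_right_mono) auto
  also have "\<dots> \<le> a * (w + a / 2)"
    using assms by (simp add: field_simps)
  finally have "(w - a)\<^sup>2 * (t * (w + a)\<^sup>2) \<le> (w - a)\<^sup>2 * (a * (w + a / 2))"
    by (intro mult_left_mono) auto
  then have "(w - a)\<^sup>2 * (t * (w + a)\<^sup>2) * 2 \<le> (w - a)\<^sup>2 * (a * (2 * w + a))"
    by (simp add: distrib_left)
  then have "0 \<le> (w - a)\<^sup>2 * (a * (2 * w + a)) - (w - a)\<^sup>2 * (t * (w + a)\<^sup>2) * 2"
    by (simp only: diff_ge_0_iff_ge)
  also have "\<dots> = 2 * (a * w ^ 3) - (2 * a ^ 4 + 3 * a\<^sup>2 * (w\<^sup>2 - a\<^sup>2) + 2 * (t * (w\<^sup>2 - a\<^sup>2)\<^sup>2))"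
    by (simp add: power2_eq_square power3_eq_cube power4_eq_xxxx algebra_simps)
  finally show ?thesis by (simp only: diff_ge_0_iff_ge)
qed

text \<open>The left side is the squared mean plus \<open>t\<close> times the variance, and
  averaging \<open>pointwise_three_halves\<close> removes its linear term. The condition on
  \<open>t\<close> reflects that a nonnegative function is at most \<open>card A\<close> times its
  mean.\<close>

lemma hypercontractive_one_coordinate:
  assumes fin: "finite A" "A \<noteq> {}" and u: "\<And>x. x \<in> A \<Longrightarrow> 0 \<le> u x"
    and t: "0 \<le> t" "t * (2 * (1 + sqrt (card A))) \<le> 1"
  shows "(1 - t) * (avg A u)\<^sup>2 + t * avg A (\<lambda>x. (u x)\<^sup>2) \<le> (norm32 A u)\<^sup>2"
proof -
  define m where "m = avg A u"
  have card: "0 < real (card A)" using fin by (simp add: card_gt_0_iff)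
  have um: "u x \<le> card A * m" if "x \<in> A" for x
  proof -
    have "u x \<le> sum u A" using that fin u by (intro member_le_sum) auto
    then show ?thesis using card by (simp add: m_def avg_def)
  qed
  have m0: "0 \<le> m" using u by (simp add: m_def avg_nonneg)
  show ?thesis
  proof (cases "m = 0")
    case True
    then have "u x = 0" if "x \<in> A" for x using um[OF that] u[OF that] by simp
    then have "avg A (\<lambda>x. (u x)\<^sup>2) = avg A (\<lambda>x. 0)" by (intro avg_cong) auto
    then show ?thesis using True by (simp add: m_def avg_const fin)
  next
    case False
    define a where "a = sqrt m"
    have a: "0 < a" "a\<^sup>2 = m" using m0 False by (auto simp: a_def)
    define e where "e = avg A (\<lambda>x. u x powr (3/2))"
    define Z where "Z = m\<^sup>2 + t * avg A (\<lambda>x. (u x - m)\<^sup>2)"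
    have V: "avg A (\<lambda>x. (u x - m)\<^sup>2) = avg A (\<lambda>x. (u x)\<^sup>2) - m\<^sup>2"
    proof -
      have "avg A (\<lambda>x. (u x - m)\<^sup>2) = avg A (\<lambda>x. (u x)\<^sup>2 + (-2 * m) * u x + m\<^sup>2)"
        by (intro avg_cong) (simp add: power2_eq_square algebra_simps)
      also have "\<dots> = avg A (\<lambda>x. (u x)\<^sup>2) + (-2 * m) * m + m\<^sup>2"
        by (simp only: avg_add avg_cmult avg_const[OF fin] m_def)
      finally show ?thesis by (simp add: power2_eq_square)
    qed
    have pt: "m\<^sup>2 + 3/2 * m * (u x - m) + t * (u x - m)\<^sup>2 \<le> a * u x powr (3/2)" if x: "x \<in> A" for x
    proof -
      have w: "(sqrt (u x))\<^sup>2 = u x" using u[OF x] by simp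
      have "sqrt (u x) \<le> sqrt (card A * m)" using um[OF x] by simp
      then have le: "sqrt (u x) \<le> sqrt (card A) * a" by (simp add: a_def real_sqrt_mult)
      have "u x powr (3/2) = sqrt (u x) ^ 3"
      proof (cases "u x = 0")
        case False
        then have "0 < u x" using u[OF x] by simp
        then have "sqrt (u x) ^ 3 = (u x powr (1/2)) powr 3" by (simp add: powr_half_sqrt)
        also have "\<dots> = u x powr (3/2)" by (simp only: powr_powr) simp
        finally show ?thesis by simp
      qed simp
      moreover have "a ^ 4 = m\<^sup>2" using a(2) by (metis power2_eq_square power4_eq_xxxx mult.assoc)
      ultimately have "2 * m\<^sup>2 + 3 * m * (u x - m) + 2 * (t * (u x - m)\<^sup>2) \<le> 2 * (a * u x powr (3/2))"
        using pointwise_three_halves[OF real_sqrt_ge_zero[OF u[OF x]] a(1) le t] by (simp only: w a(2))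
      then show ?thesis by simp
    qed
    have "Z = avg A (\<lambda>x. m\<^sup>2 + 3/2 * m * (u x - m) + t * (u x - m)\<^sup>2)"
    proof -
      have "avg A (\<lambda>x. m\<^sup>2 + 3/2 * m * (u x - m) + t * (u x - m)\<^sup>2)
        = avg A (\<lambda>x. m\<^sup>2 + (3/2 * m * u x + - (3/2 * m * m)) + t * (u x - m)\<^sup>2)"
        by (intro avg_cong) (simp add: right_diff_distrib)
      also have "\<dots> = m\<^sup>2 + (3/2 * m * m + - (3/2 * m * m)) + t * avg A (\<lambda>x. (u x - m)\<^sup>2)"
        by (simp only: avg_add avg_cmult avg_const[OF fin] m_def)
      finally show ?thesis by (simp add: Z_def)
    qed
    also have "\<dots> \<le> avg A (\<lambda>x. a * u x powr (3/2))" using pt by (intro avg_mono)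
    finally have Zle: "Z \<le> a * e" by (simp add: avg_cmult e_def)
    have Zm: "m\<^sup>2 \<le> Z" using t by (simp add: Z_def avg_nonneg)
    have Z0: "0 < Z" using Zm a by (smt (verit) zero_less_power)
    have e0: "0 \<le> e" by (simp add: e_def avg_nonneg)
    \<comment> \<open>\<open>Z \<le> a * e\<close> still involves the mean through \<open>a\<close>.
      Since \<open>m ^ 2 \<le> Z\<close>, the mean cancels from the fourth powers, which leaves
      \<open>Z ^ 3 \<le> e ^ 4\<close>.\<close>
    have "Z ^ 3 * m\<^sup>2 \<le> Z ^ 4" using Zm Z0 by (simp add: power4_eq_xxxx power3_eq_cube)
    also have "\<dots> \<le> (a * e) ^ 4" using Zle Z0 by (intro power_mono) auto
    also have "\<dots> = m\<^sup>2 * e ^ 4" using a(2) by (simp add: power_mult_distrib flip: a(2))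
    finally have "Z ^ 3 \<le> e ^ 4" using m0 False by simp
    also have "e ^ 4 = ((norm32 A u)\<^sup>2) ^ 3"
      using norm32_power3[of A u] unfolding e_def by (metis power_mult mult.commute power_even_eq numeral_Bit0_eq_double mult_2)
    finally have "Z \<le> (norm32 A u)\<^sup>2"
      using power_mono_iff[of Z "(norm32 A u)\<^sup>2" 3] Z0 by simp
    then show ?thesis unfolding Z_def V m_def[symmetric] by (simp add: algebra_simps)
  qed
qed

text \<open>Averaging over \<open>W\<close> is an operator from functions on \<open>A\<close> to
  functions on \<open>U\<close>; on nonnegative functions it contracts the 3/2-norm into the 2-norm.
  The two spaces differ because a row of the matrix is a random test built around a single
  point.\<close>

definition contractive :: "'x set \<Rightarrow> 'w set \<Rightarrow> 'a set \<Rightarrow> ('x \<Rightarrow> 'w \<Rightarrow> 'a) \<Rightarrow> bool"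
  where "contractive U W A p \<longleftrightarrow> (\<forall>u. (\<forall>a\<in>A. 0 \<le> u a) \<longrightarrow>
    avg U (\<lambda>x. (avg W (\<lambda>w. u (p x w)))\<^sup>2) \<le> (norm32 A u)\<^sup>2)"

lemma contractiveD:
  "contractive U W A p \<Longrightarrow> (\<And>a. a \<in> A \<Longrightarrow> 0 \<le> u a) \<Longrightarrow>
    avg U (\<lambda>x. (avg W (\<lambda>w. u (p x w)))\<^sup>2) \<le> (norm32 A u)\<^sup>2"
  unfolding contractive_def by blast

text \<open>The operator mixes the mean, with weight \<open>1 - r\<close>, and an operator
  \<open>B\<close> that preserves means and does not increase second moments. The cross terms
  collapse, so the one-coordinate inequality applies with \<open>t = r ^ 2\<close>.\<close>

lemma contractive_noise:
  assumes A: "finite A" "A \<noteq> {}" and U: "finite U" "U \<noteq> {}"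
    and r: "r\<^sup>2 * (2 * (1 + sqrt (card A))) \<le> 1"
    and K: "\<And>u x. x \<in> U \<Longrightarrow> avg W (\<lambda>w. u (p x w)) = (1 - r) * avg A u + r * B u x"
    and B1: "\<And>u. avg U (B u) = avg A u" and B2: "\<And>u. avg U (\<lambda>x. (B u x)\<^sup>2) \<le> avg A (\<lambda>x. (u x)\<^sup>2)"
  shows "contractive U W A p"
  unfolding contractive_def
proof (intro allI impI)
  fix u :: "_ \<Rightarrow> real" assume u: "\<forall>a\<in>A. 0 \<le> u a"
  let ?m = "avg A u"
  have "avg U (\<lambda>x. (avg W (\<lambda>w. u (p x w)))\<^sup>2)
    = avg U (\<lambda>x. (1 - r)\<^sup>2 * ?m\<^sup>2 + (2 * (1 - r) * r * ?m) * B u x + r\<^sup>2 * (B u x)\<^sup>2)"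
    by (intro avg_cong) (simp add: K power2_eq_square algebra_simps)
  also have "\<dots> = (1 - r)\<^sup>2 * ?m\<^sup>2 + (2 * (1 - r) * r * ?m) * ?m + r\<^sup>2 * avg U (\<lambda>x. (B u x)\<^sup>2)"
    by (simp only: avg_add avg_cmult avg_const[OF U] B1)
  also have "\<dots> = (1 - r\<^sup>2) * ?m\<^sup>2 + r\<^sup>2 * avg U (\<lambda>x. (B u x)\<^sup>2)"
    by (simp add: power2_eq_square algebra_simps)
  also have "\<dots> \<le> (1 - r\<^sup>2) * ?m\<^sup>2 + r\<^sup>2 * avg A (\<lambda>x. (u x)\<^sup>2)"
    using B2[of u] by (simp add: mult_left_mono)
  also have "\<dots> \<le> (norm32 A u)\<^sup>2"
    using hypercontractive_one_coordinate[OF A _ _ r] u by auto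
  finally show "avg U (\<lambda>x. (avg W (\<lambda>w. u (p x w)))\<^sup>2) \<le> (norm32 A u)\<^sup>2" .
qed

text \<open>Tensorisation: \<open>F a\<close> is the norm of the slice at \<open>a\<close>, the
  contraction on the other coordinates bounds the slices, and the contraction at \<open>l\<close>
  bounds \<open>F\<close>. Expanding the square and applying Cauchy-Schwarz to each cross term takes
  the role of Minkowski's inequality.\<close>

lemma contractive_pmap2:
  assumes "finite L" and c: "contractive U W A p" and p: "\<And>x w. x \<in> U \<Longrightarrow> w \<in> W \<Longrightarrow> p x w \<in> A"
  shows "contractive (PiE L (\<lambda>_. U)) (PiE L (\<lambda>_. W)) (PiE L (\<lambda>_. A)) (pmap2 L p)"
  using assms(1)
proof (induction L)
  case empty
  show ?case
    by (auto simp: contractive_def norm32_def pmap2_def powr_powr)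
next
  case (insert l L)
  let ?U = "PiE L (\<lambda>_. U)" and ?W = "PiE L (\<lambda>_. W)" and ?A = "PiE L (\<lambda>_. A)"
  show ?case unfolding contractive_def
  proof (intro allI impI)
    fix u :: "_ \<Rightarrow> real" assume u: "\<forall>a\<in>PiE (insert l L) (\<lambda>_. A). 0 \<le> u a"
    define F where "F a = norm32 ?A (\<lambda>v. u (v(l := a)))" for a
    define G where "G a x = avg ?W (\<lambda>y. u ((pmap2 L p x y)(l := a)))" for a x
    have G2: "avg ?U (\<lambda>x. (G a x)\<^sup>2) \<le> (F a)\<^sup>2" if "a \<in> A" for a
      unfolding G_def F_def
    proof (rule contractiveD[OF insert.IH])
      fix v assume "v \<in> ?A"
      then have "v(l := a) \<in> PiE (insert l L) (\<lambda>_. A)" using that by (rule PiE_upd)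
      then show "0 \<le> u (v(l := a))" using u by blast
    qed
    have GG: "avg ?U (\<lambda>x. G a x * G b x) \<le> F a * F b" if "a \<in> A" "b \<in> A" for a b
    proof -
      have "(avg ?U (\<lambda>x. G a x * G b x))\<^sup>2 \<le> avg ?U (\<lambda>x. (G a x)\<^sup>2) * avg ?U (\<lambda>x. (G b x)\<^sup>2)"
        by (rule avg_Cauchy_Schwarz)
      also have "\<dots> \<le> (F a)\<^sup>2 * (F b)\<^sup>2"
        using G2[OF that(1)] G2[OF that(2)] by (intro mult_mono) (auto intro: avg_nonneg)
      finally have "(avg ?U (\<lambda>x. G a x * G b x))\<^sup>2 \<le> (F a * F b)\<^sup>2" by (simp add: power_mult_distrib)
      then show ?thesis by (rule power2_le_imp_le) (simp add: F_def norm32_nonneg)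
    qed
    have "avg (PiE (insert l L) (\<lambda>_. U)) (\<lambda>x. (avg (PiE (insert l L) (\<lambda>_. W)) (\<lambda>w. u (pmap2 (insert l L) p x w)))\<^sup>2)
      = avg U (\<lambda>a. avg ?U (\<lambda>x. (avg W (\<lambda>b. G (p a b) x))\<^sup>2))"
      using insert.hyps by (simp add: avg_PiE_insert pmap2_insert G_def)
    also have "\<dots> \<le> avg U (\<lambda>a. (avg W (\<lambda>b. F (p a b)))\<^sup>2)"
    proof (intro avg_mono)
      fix a assume a: "a \<in> U"
      have "avg ?U (\<lambda>x. (avg W (\<lambda>b. G (p a b) x))\<^sup>2)
        = avg ?U (\<lambda>x. avg W (\<lambda>b. avg W (\<lambda>b'. G (p a b) x * G (p a b') x)))"
        by (simp add: power2_eq_square avg_mult_avg)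
      also have "\<dots> = avg W (\<lambda>b. avg W (\<lambda>b'. avg ?U (\<lambda>x. G (p a b) x * G (p a b') x)))"
        by (subst avg_swap) (intro avg_cong avg_swap)
      also have "\<dots> \<le> avg W (\<lambda>b. avg W (\<lambda>b'. F (p a b) * F (p a b')))"
        using a p by (intro avg_mono GG)
      also have "\<dots> = (avg W (\<lambda>b. F (p a b)))\<^sup>2"
        by (simp add: power2_eq_square avg_mult_avg)
      finally show "avg ?U (\<lambda>x. (avg W (\<lambda>b. G (p a b) x))\<^sup>2) \<le> (avg W (\<lambda>b. F (p a b)))\<^sup>2" .
    qed
    also have "\<dots> \<le> (norm32 A F)\<^sup>2"
      by (rule contractiveD[OF c]) (simp add: F_def norm32_nonneg)
    also have "norm32 A F = norm32 (PiE (insert l L) (\<lambda>_. A)) u"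
      unfolding F_def using insert.hyps by (simp add: norm32_insert)
    finally show "avg (PiE (insert l L) (\<lambda>_. U)) (\<lambda>x. (avg (PiE (insert l L) (\<lambda>_. W)) (\<lambda>w. u (pmap2 (insert l L) p x w)))\<^sup>2)
      \<le> (norm32 (PiE (insert l L) (\<lambda>_. A)) u)\<^sup>2" .
  qed
qed

text \<open>For values in [0, 1] one has \<open>u powr (3/2) \<le> u\<close>, so the second moment
  is at most the mean to the power 4/3. Cubing keeps the exponents integral.\<close>

lemma contractive_small_set:
  assumes c: "contractive U W A p" and u: "\<And>a. a \<in> A \<Longrightarrow> 0 \<le> u a \<and> u a \<le> 1"
  shows "(avg U (\<lambda>x. (avg W (\<lambda>w. u (p x w)))\<^sup>2)) ^ 3 \<le> (avg A u) ^ 4"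
proof -
  have "(avg U (\<lambda>x. (avg W (\<lambda>w. u (p x w)))\<^sup>2)) ^ 3 \<le> ((norm32 A u)\<^sup>2) ^ 3"
    using u by (intro power_mono contractiveD[OF c]) (auto intro: avg_nonneg)
  also have "\<dots> = (norm32 A u ^ 3)\<^sup>2" by (simp flip: power_mult)
  also have "\<dots> = (avg A (\<lambda>x. u x powr (3/2))) ^ 4"
    by (simp add: norm32_power3)
  also have "\<dots> \<le> (avg A u) ^ 4"
  proof (intro power_mono avg_mono)
    fix x assume "x \<in> A"
    then show "u x powr (3/2) \<le> u x" using u[of x] powr_mono'[of 1 "3/2" "u x"] by (cases "u x = 0") auto
  qed (auto intro: avg_nonneg)
  finally show ?thesis .
qed

section \<open>Self-correction for block tests\<close>

lemma avg_if_mem: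
  assumes "finite B" "B \<noteq> {}"
  shows "avg B (\<lambda>b. if b \<in> M then x else y) =
    (1 - real (card (M \<inter> B)) / real (card B)) * y + real (card (M \<inter> B)) / real (card B) * x"
proof -
  have "(\<Sum>b\<in>B. if b \<in> M then x else y) = real (card (M \<inter> B)) * x + real (card (B - M)) * y"
    using assms by (simp add: sum.If_cases Int_def Diff_eq conj_commute)
  moreover have "real (card (B - M)) = real (card B) - real (card (M \<inter> B))"
    using assms by (simp add: card_Diff_subset_Int Int_commute card_mono of_nat_diff)
  moreover have "real (card B) \<noteq> 0" using assms by simp
  ultimately show ?thesis by (simp add: avg_def field_simps)
qed

lemma (in abelian_monoid) finsum_swap:
  assumes "finite A" "finite B" "\<And>a b. a \<in> A \<Longrightarrow> b \<in> B \<Longrightarrow> f a b \<in> carrier G"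
  shows "(\<Oplus>a\<in>A. \<Oplus>b\<in>B. f a b) = (\<Oplus>b\<in>B. \<Oplus>a\<in>A. f a b)"
  using assms(1,3)
proof (induction A)
  case empty
  then show ?case by (simp add: finsum_zero)
next
  case (insert x A)
  have "(\<Oplus>b\<in>B. \<Oplus>a\<in>insert x A. f a b) = (\<Oplus>b\<in>B. f x b \<oplus> (\<Oplus>a\<in>A. f a b))"
    using insert by (intro finsum_cong') (auto simp: Pi_iff)
  also have "\<dots> = (\<Oplus>b\<in>B. f x b) \<oplus> (\<Oplus>b\<in>B. \<Oplus>a\<in>A. f a b)"
    using insert by (intro finsum_addf) (auto simp: Pi_iff)
  finally show ?case using insert by (simp add: Pi_iff)
qed

lemma (in cring) finsum_bilinear_swap:
  assumes "finite A" "finite B" "\<And>a b. a \<in> A \<Longrightarrow> b \<in> B \<Longrightarrow> f a b \<in> carrier R"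
    "\<And>a. a \<in> A \<Longrightarrow> c a \<in> carrier R" "\<And>b. b \<in> B \<Longrightarrow> d b \<in> carrier R"
  shows "(\<Oplus>a\<in>A. c a \<otimes> (\<Oplus>b\<in>B. d b \<otimes> f a b)) = (\<Oplus>b\<in>B. d b \<otimes> (\<Oplus>a\<in>A. c a \<otimes> f a b))"
proof -
  have "(\<Oplus>a\<in>A. c a \<otimes> (\<Oplus>b\<in>B. d b \<otimes> f a b)) = (\<Oplus>a\<in>A. \<Oplus>b\<in>B. c a \<otimes> (d b \<otimes> f a b))"
    using assms by (intro finsum_cong') (auto simp: finsum_rdistr Pi_iff)
  also have "\<dots> = (\<Oplus>b\<in>B. \<Oplus>a\<in>A. c a \<otimes> (d b \<otimes> f a b))"
    using assms by (intro finsum_swap) auto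
  also have "\<dots> = (\<Oplus>b\<in>B. \<Oplus>a\<in>A. d b \<otimes> (c a \<otimes> f a b))"
    using assms by (intro finsum_cong' refl Pi_I finsum_closed) (auto simp: m_lcomm intro!: finsum_cong')
  also have "\<dots> = (\<Oplus>b\<in>B. d b \<otimes> (\<Oplus>a\<in>A. c a \<otimes> f a b))"
    using assms by (intro finsum_cong') (auto simp: finsum_rdistr Pi_iff)
  finally show ?thesis .
qed

text \<open>Index \<open>i0\<close> is the base point, and \<open>keep i\<close> holds the blocks on
  which query \<open>i\<close> retains it. In \<open>small\<close> the ratio is the probability that
  a coordinate is retained and \<open>(card S)\<^sup>2 * card K\<close> is the size of the alphabet
  \<open>T\<close> of a test, as \<open>contractive_noise\<close> requires.\<close>

locale block_test = cring F for F (structure) +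
  fixes L :: "'l set" and S :: "'s set" and K :: "'k set" and I :: "'i set" and i0 :: 'i
    and keep :: "'i \<Rightarrow> 'k set" and eps :: "'i \<Rightarrow> 'a"
  assumes fin: "finite L" "finite S" "finite K" "finite I"
    and ne: "S \<noteq> {}" "K \<noteq> {}"
    and i0: "i0 \<notin> I" "K \<subseteq> keep i0" "eps i0 = \<ominus> \<one>"
    and eps: "\<And>i. i \<in> I \<Longrightarrow> eps i \<in> carrier F"
    and small: "\<And>i. i \<in> I \<Longrightarrow> (real (card (keep i \<inter> K)) / real (card K))\<^sup>2
      * (2 * (1 + sqrt (real ((card S)\<^sup>2 * card K)))) \<le> 1"
begin

abbreviation "pts \<equiv> PiE L (\<lambda>_. S)"
abbreviation "V \<equiv> S \<times> K"
abbreviation "T \<equiv> S \<times> V"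
abbreviation "Vn \<equiv> PiE L (\<lambda>_. V)"
abbreviation "Tn \<equiv> PiE L (\<lambda>_. T)"

text \<open>A letter \<open>(x, y, b)\<close> of a test consists of the base value, the fresh value
  and the block of one coordinate.\<close>

definition sel :: "'i \<Rightarrow> 's \<times> 's \<times> 'k \<Rightarrow> 's"
  where "sel i = (\<lambda>(x, y, b). if b \<in> keep i then x else y)"

definition pt :: "'i \<Rightarrow> ('l \<Rightarrow> 's \<times> 's \<times> 'k) \<Rightarrow> 'l \<Rightarrow> 's"
  where "pt i = pmap L (sel i)"

definition fails :: "(('l \<Rightarrow> 's) \<Rightarrow> 'a) \<Rightarrow> ('l \<Rightarrow> 's \<times> 's \<times> 'k) \<Rightarrow> bool"
  where "fails f t \<longleftrightarrow> (\<Oplus>i\<in>insert i0 I. eps i \<otimes> f (pt i t)) \<noteq> \<zero>"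

definition vote :: "(('l \<Rightarrow> 's) \<Rightarrow> 'a) \<Rightarrow> ('l \<Rightarrow> 's) \<Rightarrow> ('l \<Rightarrow> 's \<times> 'k) \<Rightarrow> 'a"
  where "vote f x v = (\<Oplus>i\<in>I. eps i \<otimes> f (pt i (pmap2 L Pair x v)))"

definition rej :: "(('l \<Rightarrow> 's) \<Rightarrow> 'a) \<Rightarrow> real"
  where "rej f = avg Tn (\<lambda>t. of_bool (fails f t))"

lemma fin_sets: "finite pts" "finite V" "finite T" "finite Vn" "finite Tn" "finite (insert i0 I)"
  and ne_sets: "V \<noteq> {}" "T \<noteq> {}" "pts \<noteq> {}" "Vn \<noteq> {}" "Tn \<noteq> {}"
  using fin ne by (auto intro!: finite_PiE simp: PiE_eq_empty_iff)

lemma eps': "i \<in> insert i0 I \<Longrightarrow> eps i \<in> carrier F"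
  using eps i0 by auto

lemma pt_closed: "t \<in> Tn \<Longrightarrow> pt i t \<in> pts"
  by (fastforce simp: pt_def pmap_def sel_def PiE_iff split: prod.splits)

lemma f_pt_closed: "f \<in> pts \<rightarrow> carrier F \<Longrightarrow> t \<in> Tn \<Longrightarrow> f (pt i t) \<in> carrier F"
  by (rule funcset_mem[OF _ pt_closed])

lemma pair_closed: "x \<in> pts \<Longrightarrow> v \<in> Vn \<Longrightarrow> pmap2 L Pair x v \<in> Tn"
  by (auto simp: pmap2_def PiE_iff)

lemma pt_i0_pair: "x \<in> pts \<Longrightarrow> v \<in> Vn \<Longrightarrow> pt i0 (pmap2 L Pair x v) = x"
  using i0(2) by (fastforce simp: pt_def pmap_def pmap2_def sel_def PiE_iff fun_eq_iff extensional_def restrict_def split: prod.splits)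

lemma eq_of_minus_add: "a \<in> carrier F \<Longrightarrow> b \<in> carrier F \<Longrightarrow> \<ominus> \<one> \<otimes> a \<oplus> b = \<zero> \<longleftrightarrow> a = b"
  by (metis l_minus l_neg l_one minus_equality minus_minus one_closed r_neg a_inv_closed)

lemma fails_iff:
  assumes "f \<in> pts \<rightarrow> carrier F" "t \<in> Tn"
  shows "fails f t \<longleftrightarrow> f (pt i0 t) \<noteq> (\<Oplus>i\<in>I. eps i \<otimes> f (pt i t))"
proof -
  have c: "f (pt i t) \<in> carrier F" for i by (rule f_pt_closed[OF assms])
  have "(\<Oplus>i\<in>insert i0 I. eps i \<otimes> f (pt i t)) = \<ominus> \<one> \<otimes> f (pt i0 t) \<oplus> (\<Oplus>i\<in>I. eps i \<otimes> f (pt i t))"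
    using c eps fin i0 by (subst finsum_insert) auto
  moreover have "(\<Oplus>i\<in>I. eps i \<otimes> f (pt i t)) \<in> carrier F"
    using c eps by (intro finsum_closed) auto
  ultimately show ?thesis using c[of i0] by (simp add: fails_def eq_of_minus_add)
qed

lemma vote_closed:
  assumes "f \<in> pts \<rightarrow> carrier F" "x \<in> pts" "v \<in> Vn"
  shows "vote f x v \<in> carrier F"
  unfolding vote_def using m_closed[OF eps f_pt_closed[OF assms(1) pair_closed[OF assms(2,3)]]]
  by (intro finsum_closed Pi_I)

text \<open>For a fixed block the output is one of two uniform letters. Hence each single query of a
  test is a uniform point.\<close>

lemma avg_preserving_sel: "avg_preserving T S (sel j)"
  unfolding avg_preserving_def
proof
  fix u :: "_ \<Rightarrow> real"
  have "avg T (\<lambda>a. u (sel j a)) = avg S (\<lambda>x. avg S (\<lambda>y. avg K (\<lambda>b. u (if b \<in> keep j then x else y))))"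
    by (simp add: avg_Times sel_def)
  also have "\<dots> = avg S (\<lambda>x. avg K (\<lambda>b. avg S (\<lambda>y. u (if b \<in> keep j then x else y))))"
    by (rule avg_cong, rule avg_swap)
  also have "\<dots> = avg K (\<lambda>b. avg S (\<lambda>x. avg S (\<lambda>y. u (if b \<in> keep j then x else y))))"
    by (rule avg_swap)
  also have "\<dots> = avg K (\<lambda>b. avg S u)"
  proof (rule avg_cong)
    fix b
    show "avg S (\<lambda>x. avg S (\<lambda>y. u (if b \<in> keep j then x else y))) = avg S u"
      by (cases "b \<in> keep j") (simp_all add: avg_const fin ne)
  qed
  finally show "avg T (\<lambda>a. u (sel j a)) = avg S u" by (simp add: avg_const fin ne)
qed

lemma avg_pt: "avg Tn (\<lambda>t. u (pt j t)) = avg pts u"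
  using avg_preserving_pmap[OF fin(1) avg_preserving_sel, of j] by (simp add: avg_preserving_def pt_def)

text \<open>
  For two votes at the same point \<open>x\<close>, with blocks \<open>b\<close>, \<open>b'\<close> at a coordinate, the entry
  \<open>(i, j)\<close> of the matrix is \<open>x\<close>, \<open>y\<close>, \<open>y'\<close> or a fresh letter \<open>w\<close> according to membership of
  \<open>b\<close> in \<open>keep i\<close> and of \<open>b'\<close> in \<open>keep j\<close>. Its rows and its columns are again tests.
\<close>

definition row :: "'i \<Rightarrow> 's \<Rightarrow> ('s \<times> 'k) \<times> ('s \<times> 'k) \<times> 's \<Rightarrow> 's \<times> 's \<times> 'k"
  where "row i x = (\<lambda>((y, b), (y', b'), w). (sel i (x, y, b), if b \<in> keep i then y' else w, b'))"

definition rows where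
  "rows i x v v' w = pmap2 L (row i) x (pmap2 L Pair v (pmap2 L Pair v' w))"

lemma rows_closed: "x \<in> pts \<Longrightarrow> v \<in> Vn \<Longrightarrow> v' \<in> Vn \<Longrightarrow> w \<in> pts \<Longrightarrow> rows i x v v' w \<in> Tn"
  by (fastforce simp: rows_def pmap2_def row_def sel_def PiE_iff split: prod.splits)

text \<open>Exchanging the two votes, with the same fresh point \<open>w\<close>, transposes the
  matrix. So its columns are rows of the transposed matrix, hence tests as well.\<close>

lemma pt_rows_swap: "pt j (rows i x v v' w) = pt i (rows j x v' v w)"
  by (auto simp: rows_def pmap2_def row_def pt_def pmap_def sel_def fun_eq_iff restrict_def split: prod.splits)

text \<open>Row \<open>i\<close> has the \<open>i\<close>-th query of the vote \<open>v\<close> as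
  its base point; if the row passes, the value of \<open>f\<close> there may be replaced by the sum
  along the row.\<close>

lemma pt_i0_rows: "v' \<in> Vn \<Longrightarrow> pt i0 (rows i x v v' w) = pt i (pmap2 L Pair x v)"
  using i0(2) by (fastforce simp: rows_def pmap2_def row_def pt_def pmap_def sel_def fun_eq_iff restrict_def PiE_iff split: prod.splits)

lemma vote_rows:
  assumes f: "f \<in> pts \<rightarrow> carrier F" and c: "x \<in> pts" "v \<in> Vn" "v' \<in> Vn" "w \<in> pts"
    and "\<And>i. i \<in> I \<Longrightarrow> \<not> fails f (rows i x v v' w)"
  shows "vote f x v = (\<Oplus>i\<in>I. eps i \<otimes> (\<Oplus>j\<in>I. eps j \<otimes> f (pt j (rows i x v v' w))))"
  unfolding vote_def
proof (intro finsum_cong' refl)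
  have cl: "f (pt j (rows i x v v' w)) \<in> carrier F" for i j
    by (rule f_pt_closed[OF f rows_closed[OF c]])
  show "(\<lambda>i. eps i \<otimes> (\<Oplus>j\<in>I. eps j \<otimes> f (pt j (rows i x v v' w)))) \<in> I \<rightarrow> carrier F"
  proof (rule Pi_I)
    fix i assume "i \<in> I"
    moreover have "(\<Oplus>j\<in>I. eps j \<otimes> f (pt j (rows i x v v' w))) \<in> carrier F"
      by (rule finsum_closed, rule Pi_I, rule m_closed[OF eps cl])
    ultimately show "eps i \<otimes> (\<Oplus>j\<in>I. eps j \<otimes> f (pt j (rows i x v v' w))) \<in> carrier F"
      using eps by simp
  qed
  fix i assume "i \<in> I"
  then have "f (pt i0 (rows i x v v' w)) = (\<Oplus>j\<in>I. eps j \<otimes> f (pt j (rows i x v v' w)))"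
    using assms(6) fails_iff[OF f rows_closed[OF c]] by blast
  then show "eps i \<otimes> f (pt i (pmap2 L Pair x v)) = eps i \<otimes> (\<Oplus>j\<in>I. eps j \<otimes> f (pt j (rows i x v v' w)))"
    by (simp only: pt_i0_rows[OF c(3)])
qed

text \<open>When all rows and all columns pass, both votes equal one double sum over the matrix,
  once evaluated by rows and once by columns.\<close>

lemma votes_agree:
  assumes f: "f \<in> pts \<rightarrow> carrier F" and c: "x \<in> pts" "v \<in> Vn" "v' \<in> Vn" "w \<in> pts"
    and "\<And>i. i \<in> I \<Longrightarrow> \<not> fails f (rows i x v v' w)" "\<And>i. i \<in> I \<Longrightarrow> \<not> fails f (rows i x v' v w)"
  shows "vote f x v = vote f x v'"
proof -
  have cl: "f (pt j (rows i x v v' w)) \<in> carrier F" for i j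
    by (rule f_pt_closed[OF f rows_closed[OF c]])
  have "vote f x v = (\<Oplus>i\<in>I. eps i \<otimes> (\<Oplus>j\<in>I. eps j \<otimes> f (pt j (rows i x v v' w))))"
    by (rule vote_rows[OF f c]) (rule assms(6))
  also have "\<dots> = (\<Oplus>j\<in>I. eps j \<otimes> (\<Oplus>i\<in>I. eps i \<otimes> f (pt j (rows i x v v' w))))"
    by (rule finsum_bilinear_swap) (use cl eps fin in auto)
  also have "\<dots> = (\<Oplus>j\<in>I. eps j \<otimes> (\<Oplus>i\<in>I. eps i \<otimes> f (pt i (rows j x v' v w))))"
    by (simp only: pt_rows_swap)
  also have "\<dots> = vote f x v'"
    by (rule vote_rows[OF f c(1,3,2,4), symmetric]) (rule assms(7))
  finally show ?thesis .
qed

text \<open>The rows of a second matrix, which relates a test \<open>t\<close> to votes at its own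
  queries: whole letters of \<open>t\<close> survive on the kept blocks and are replaced by those of
  a fresh test elsewhere.\<close>

definition noisy :: "'i \<Rightarrow> 's \<times> 's \<times> 'k \<Rightarrow> 'k \<times> ('s \<times> 's \<times> 'k) \<Rightarrow> 's \<times> 's \<times> 'k"
  where "noisy i t = (\<lambda>(b, t'). if b \<in> keep i then t else t')"

abbreviation "Nn \<equiv> PiE L (\<lambda>_. K \<times> T)"

text \<open>The votes at all queries of one test are drawn from common randomness: the vote at query
  \<open>j\<close> takes its fresh point as query \<open>j\<close> of the fresh test and shares the
  blocks.\<close>

definition col_vote :: "'i \<Rightarrow> ('l \<Rightarrow> 'k \<times> ('s \<times> 's \<times> 'k)) \<Rightarrow> 'l \<Rightarrow> 's \<times> 'k"
  where "col_vote j = pmap L (\<lambda>(b, t'). (sel j t', b))"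

lemma noisy_closed: "t \<in> Tn \<Longrightarrow> n \<in> Nn \<Longrightarrow> pmap2 L (noisy i) t n \<in> Tn"
  by (fastforce simp: pmap2_def noisy_def PiE_iff split: prod.splits)

text \<open>Entry \<open>(i, j)\<close> of the second matrix, read along column \<open>j\<close> as
  a query of a vote and along row \<open>i\<close> as a query of a noisy test.\<close>

lemma pt_noisy: "pt i (pmap2 L Pair (pt j t) (col_vote j n)) = pt j (pmap2 L (noisy i) t n)"
  by (auto simp: pmap2_def noisy_def pt_def pmap_def sel_def col_vote_def fun_eq_iff restrict_def split: prod.splits)

text \<open>If the column votes give the values of \<open>g\<close>, the test sum of
  \<open>g\<close> is the double sum over the second matrix. Summed by rows it vanishes, since every
  row is a test that \<open>f\<close> passes.\<close>

lemma passes_of_votes: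
  assumes f: "f \<in> pts \<rightarrow> carrier F" and c: "t \<in> Tn" "n \<in> Nn"
    and g: "\<And>j. j \<in> insert i0 I \<Longrightarrow> vote f (pt j t) (col_vote j n) = g (pt j t)"
    and r: "\<And>i. i \<in> I \<Longrightarrow> \<not> fails f (pmap2 L (noisy i) t n)"
  shows "\<not> fails g t"
proof -
  have cl: "f (pt j (pmap2 L (noisy i) t n)) \<in> carrier F" for i j
    by (rule f_pt_closed[OF f noisy_closed[OF c]])
  have "(\<Oplus>j\<in>insert i0 I. eps j \<otimes> g (pt j t))
      = (\<Oplus>j\<in>insert i0 I. eps j \<otimes> (\<Oplus>i\<in>I. eps i \<otimes> f (pt j (pmap2 L (noisy i) t n))))"
  proof (rule finsum_cong')
    show "(\<lambda>j. eps j \<otimes> (\<Oplus>i\<in>I. eps i \<otimes> f (pt j (pmap2 L (noisy i) t n)))) \<in> insert i0 I \<rightarrow> carrier F"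
    proof (rule Pi_I)
      fix j assume "j \<in> insert i0 I"
      moreover have "(\<Oplus>i\<in>I. eps i \<otimes> f (pt j (pmap2 L (noisy i) t n))) \<in> carrier F"
        by (rule finsum_closed, rule Pi_I, rule m_closed[OF eps cl])
      ultimately show "eps j \<otimes> (\<Oplus>i\<in>I. eps i \<otimes> f (pt j (pmap2 L (noisy i) t n))) \<in> carrier F"
        using eps' by blast
    qed
    show "eps j \<otimes> g (pt j t) = eps j \<otimes> (\<Oplus>i\<in>I. eps i \<otimes> f (pt j (pmap2 L (noisy i) t n)))" if "j \<in> insert i0 I" for j
      unfolding g[OF that, symmetric] vote_def pt_noisy ..
  qed simp
  also have "\<dots> = (\<Oplus>i\<in>I. eps i \<otimes> (\<Oplus>j\<in>insert i0 I. eps j \<otimes> f (pt j (pmap2 L (noisy i) t n))))"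
    by (rule finsum_bilinear_swap) (use cl eps eps' fin in auto)
  also have "\<dots> = (\<Oplus>i\<in>I. \<zero>)"
    by (rule finsum_cong') (use r eps in \<open>auto simp: fails_def\<close>)
  finally show ?thesis by (simp add: fails_def)
qed

text \<open>If block \<open>b\<close> is kept, the row has letter \<open>x\<close> completed by an
  independent uniform pair; otherwise its letter is uniform in \<open>T\<close>. So \<open>B\<close>
  averages over the completions of \<open>x\<close>, and \<open>r\<close> is the fraction of kept
  blocks.\<close>

lemma contractive_row:
  assumes i: "i \<in> I"
  shows "contractive S (V \<times> V \<times> S) T (row i)"
proof (rule contractive_noise[where r = "real (card (keep i \<inter> K)) / real (card K)" and B = "\<lambda>u x. avg V (\<lambda>v. u (x, v))"])
  show "(real (card (keep i \<inter> K)) / real (card K))\<^sup>2 * (2 * (1 + sqrt (real (card T)))) \<le> 1"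
    using small[OF i] by (simp add: card_cartesian_product power2_eq_square mult.assoc)
  show "avg S (\<lambda>x. avg V (\<lambda>v. u (x, v))) = avg T u" for u by (simp add: avg_Times)
  show "avg S (\<lambda>x. (avg V (\<lambda>v. u (x, v)))\<^sup>2) \<le> avg T (\<lambda>x. (u x)\<^sup>2)" for u
    using avg_mono[of S "\<lambda>x. (avg V (\<lambda>v. u (x, v)))\<^sup>2" "\<lambda>x. avg V (\<lambda>v. (u (x, v))\<^sup>2)"]
      avg_power2_le[OF fin_sets(2) ne_sets(1)] by (simp add: avg_Times[of S V])
  fix u :: "_ \<Rightarrow> real" and x assume "x \<in> S"
  have inner: "avg S (\<lambda>y'. avg K (\<lambda>b'. avg S (\<lambda>w. u (sel i (x, y, b), if b \<in> keep i then y' else w, b'))))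
      = (if b \<in> keep i then avg V (\<lambda>v. u (x, v)) else avg V (\<lambda>v. u (y, v)))" for y b
  proof (cases "b \<in> keep i")
    case True
    then show ?thesis by (simp add: sel_def avg_const fin ne avg_Times)
  next
    case False
    then show ?thesis by (simp add: sel_def avg_const fin ne avg_Times avg_swap[of K S])
  qed
  have "avg (V \<times> V \<times> S) (\<lambda>w. u (row i x w)) = avg S (\<lambda>y. avg K (\<lambda>b.
      if b \<in> keep i then avg V (\<lambda>v. u (x, v)) else avg V (\<lambda>v. u (y, v))))"
    unfolding inner[symmetric] by (simp add: avg_Times row_def)
  also have "\<dots> = avg K (\<lambda>b. if b \<in> keep i then avg V (\<lambda>v. u (x, v)) else avg T u)"
    by (subst avg_swap) (rule avg_cong, auto simp: avg_const fin ne avg_Times)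
  also have "\<dots> = (1 - real (card (keep i \<inter> K)) / real (card K)) * avg T u
      + real (card (keep i \<inter> K)) / real (card K) * avg V (\<lambda>v. u (x, v))"
    by (rule avg_if_mem) (use fin ne in auto)
  finally show "avg (V \<times> V \<times> S) (\<lambda>w. u (row i x w)) = (1 - real (card (keep i \<inter> K)) / real (card K)) * avg T u
      + real (card (keep i \<inter> K)) / real (card K) * avg V (\<lambda>v. u (x, v))" .
qed (use fin ne fin_sets ne_sets in auto)

lemma contractive_noisy:
  assumes i: "i \<in> I"
  shows "contractive T (K \<times> T) T (noisy i)"
proof (rule contractive_noise[where r = "real (card (keep i \<inter> K)) / real (card K)" and B = "\<lambda>u. u"])
  show "(real (card (keep i \<inter> K)) / real (card K))\<^sup>2 * (2 * (1 + sqrt (real (card T)))) \<le> 1"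
    using small[OF i] by (simp add: card_cartesian_product power2_eq_square mult.assoc)
  fix u :: "_ \<Rightarrow> real" and t assume "t \<in> T"
  have "avg (K \<times> T) (\<lambda>w. u (noisy i t w)) = avg K (\<lambda>b. if b \<in> keep i then u t else avg T u)"
    by (subst avg_Times) (rule avg_cong, auto simp: noisy_def avg_const[OF fin_sets(3) ne_sets(2)])
  also have "\<dots> = (1 - real (card (keep i \<inter> K)) / real (card K)) * avg T u
      + real (card (keep i \<inter> K)) / real (card K) * u t"
    by (rule avg_if_mem) (use fin ne in auto)
  finally show "avg (K \<times> T) (\<lambda>w. u (noisy i t w)) = (1 - real (card (keep i \<inter> K)) / real (card K)) * avg T u
      + real (card (keep i \<inter> K)) / real (card K) * u t" .
qed (use fin_sets ne_sets in auto)

end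

section \<open>Rejection probabilities and the function of popular votes\<close>

context block_test
begin

definition row_rej :: "(('l \<Rightarrow> 's) \<Rightarrow> 'a) \<Rightarrow> 'i \<Rightarrow> ('l \<Rightarrow> 's) \<Rightarrow> real"
  where "row_rej f i x = avg (PiE L (\<lambda>_. V \<times> V \<times> S)) (\<lambda>w. of_bool (fails f (pmap2 L (row i) x w)))"

definition noisy_rej :: "(('l \<Rightarrow> 's) \<Rightarrow> 'a) \<Rightarrow> 'i \<Rightarrow> ('l \<Rightarrow> 's \<times> 's \<times> 'k) \<Rightarrow> real"
  where "noisy_rej f i t = avg Nn (\<lambda>n. of_bool (fails f (pmap2 L (noisy i) t n)))"

definition disagree :: "(('l \<Rightarrow> 's) \<Rightarrow> 'a) \<Rightarrow> ('l \<Rightarrow> 's) \<Rightarrow> 'a \<Rightarrow> real"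
  where "disagree f x a = avg Vn (\<lambda>v. of_bool (vote f x v \<noteq> a))"

lemma rej_bounds: "0 \<le> rej f" "rej f \<le> 1"
  unfolding rej_def using fin_sets ne_sets by (auto intro: avg_nonneg avg_le_const)

lemma le_root3:
  assumes "0 \<le> (c::real)" "c ^ 3 \<le> x"
  shows "c \<le> root 3 x"
  using assms real_root_le_mono[of 3 "c ^ 3" x] real_root_power_cancel[of 3 c] by simp

lemma avg_row_rej:
  assumes "i \<in> I"
  shows "avg pts (\<lambda>x. (row_rej f i x)\<^sup>2) \<le> root 3 (rej f ^ 4)"
proof (rule le_root3)
  have "contractive pts (PiE L (\<lambda>_. V \<times> V \<times> S)) Tn (pmap2 L (row i))"
    by (rule contractive_pmap2[OF fin(1) contractive_row[OF assms]]) (auto simp: row_def sel_def)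
  from contractive_small_set[OF this, of "\<lambda>t. of_bool (fails f t)"]
  show "(avg pts (\<lambda>x. (row_rej f i x)\<^sup>2)) ^ 3 \<le> rej f ^ 4"
    by (simp add: row_rej_def rej_def)
qed (simp add: avg_nonneg)

lemma avg_noisy_rej:
  assumes "i \<in> I"
  shows "avg Tn (\<lambda>x. (noisy_rej f i x)\<^sup>2) \<le> root 3 (rej f ^ 4)"
proof (rule le_root3)
  have "contractive Tn Nn Tn (pmap2 L (noisy i))"
    by (rule contractive_pmap2[OF fin(1) contractive_noisy[OF assms]]) (auto simp: noisy_def split: if_splits)
  from contractive_small_set[OF this, of "\<lambda>t. of_bool (fails f t)"]
  show "(avg Tn (\<lambda>x. (noisy_rej f i x)\<^sup>2)) ^ 3 \<le> rej f ^ 4"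
    by (simp add: noisy_rej_def rej_def)
qed (simp add: avg_nonneg)

lemma row_rej_eq:
  "row_rej f i x = avg Vn (\<lambda>v. avg Vn (\<lambda>v'. avg pts (\<lambda>w. of_bool (fails f (rows i x v v' w)))))"
  by (simp add: row_rej_def avg_PiE_Times[OF fin(1)] rows_def)

text \<open>Two independent votes can differ only if some row or some column fails. By the symmetry
  of the matrix the rows and the columns contribute equally, hence the factor 2.\<close>

lemma avg_disagree:
  assumes f: "f \<in> pts \<rightarrow> carrier F" and x: "x \<in> pts"
  shows "avg Vn (\<lambda>v. disagree f x (vote f x v)) \<le> 2 * (\<Sum>i\<in>I. row_rej f i x)"
proof -
  let ?E = "\<lambda>g. avg Vn (\<lambda>v. avg Vn (\<lambda>v'. avg pts (g v v')))"
  have "avg Vn (\<lambda>v. disagree f x (vote f x v)) = ?E (\<lambda>v v' w. of_bool (vote f x v' \<noteq> vote f x v))"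
    by (simp add: disagree_def avg_const[OF fin_sets(1) ne_sets(3)])
  also have "\<dots> \<le> ?E (\<lambda>v v' w. (\<Sum>i\<in>I. of_bool (fails f (rows i x v v' w))) + (\<Sum>i\<in>I. of_bool (fails f (rows i x v' v w))))"
  proof (intro avg_mono)
    fix v v' w assume c: "v \<in> Vn" "v' \<in> Vn" "w \<in> pts"
    have nn: "0 \<le> (\<Sum>i\<in>I. of_bool (fails f (rows i x v v' w)) :: real)" for v v' w by (intro sum_nonneg) simp
    have pos: "1 \<le> (\<Sum>i\<in>I. of_bool (fails f (rows i x v v' w)) :: real)" if "i \<in> I" "fails f (rows i x v v' w)" for i v v'
      using member_le_sum[OF that(1), of "\<lambda>i. of_bool (fails f (rows i x v v' w)) :: real"] that fin by simp
    show "of_bool (vote f x v' \<noteq> vote f x v) \<le> (\<Sum>i\<in>I. of_bool (fails f (rows i x v v' w)) :: real)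
      + (\<Sum>i\<in>I. of_bool (fails f (rows i x v' v w)))"
    proof (cases "vote f x v = vote f x v'")
      case True
      then show ?thesis using nn by (simp add: add_nonneg_nonneg)
    next
      case False
      then obtain i where i: "i \<in> I" "fails f (rows i x v v' w) \<or> fails f (rows i x v' v w)"
        using votes_agree[OF f x c] by blast
      then show ?thesis
        using pos[OF i(1), of v v'] pos[OF i(1), of v' v] nn[of v v' w] nn[of v' v w] False by (auto simp: of_bool_def)
    qed
  qed
  also have "\<dots> = (\<Sum>i\<in>I. row_rej f i x) + ?E (\<lambda>v v' w. (\<Sum>i\<in>I. of_bool (fails f (rows i x v' v w))))"
    by (simp only: avg_add avg_sum row_rej_eq)
  also have "?E (\<lambda>v v' w. (\<Sum>i\<in>I. of_bool (fails f (rows i x v' v w)))) = (\<Sum>i\<in>I. row_rej f i x)"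
    by (subst avg_swap) (simp only: avg_sum row_rej_eq)
  finally show ?thesis by simp
qed

text \<open>The votes at different queries are dependent through \<open>n\<close>, but each alone is
  distributed like an ordinary vote. The union bound in \<open>fails_imp\<close> uses only these
  marginals.\<close>

lemma avg_disagree_pt:
  "avg Nn (\<lambda>n. of_bool (vote f x (col_vote j n) \<noteq> a)) = disagree f x a"
proof -
  have "avg (K \<times> T) (\<lambda>(b, t). u (sel j t, b)) = avg V u" for u :: "_ \<Rightarrow> real"
  proof -
    have "avg (K \<times> T) (\<lambda>(b, t). u (sel j t, b)) = avg K (\<lambda>b. avg T (\<lambda>t. u (sel j t, b)))"
      by (subst avg_Times) simp
    also have "\<dots> = avg K (\<lambda>b. avg S (\<lambda>x. u (x, b)))"
      using avg_preserving_sel[unfolded avg_preserving_def, rule_format] by (intro avg_cong) fast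
    also have "\<dots> = avg V u" by (simp add: avg_Times avg_swap[of K S])
    finally show ?thesis .
  qed
  then have "avg_preserving (K \<times> T) V (\<lambda>(b, t). (sel j t, b))"
    by (simp add: avg_preserving_def case_prod_unfold)
  from avg_preserving_pmap[OF fin(1) this] show ?thesis
    unfolding avg_preserving_def disagree_def col_vote_def by (rule spec)
qed

text \<open>By \<open>passes_of_votes\<close>, a failure of \<open>g\<close> at \<open>t\<close>
  forces, for every \<open>n\<close>, a column vote different from \<open>g\<close> or a failing
  row; the bound is the average of this over \<open>n\<close>.\<close>

lemma fails_imp:
  assumes f: "f \<in> pts \<rightarrow> carrier F" and t: "t \<in> Tn" and g: "fails g t"
  shows "1 \<le> (\<Sum>j\<in>insert i0 I. disagree f (pt j t) (g (pt j t))) + (\<Sum>i\<in>I. noisy_rej f i t)"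
proof -
  let ?D = "\<lambda>n j. of_bool (vote f (pt j t) (col_vote j n) \<noteq> g (pt j t)) :: real"
  let ?N = "\<lambda>n i. of_bool (fails f (pmap2 L (noisy i) t n)) :: real"
  have "1 = avg Nn (\<lambda>_. 1)"
    using fin ne by (intro avg_const[symmetric] finite_PiE) (auto simp: PiE_eq_empty_iff)
  also have "\<dots> \<le> avg Nn (\<lambda>n. (\<Sum>j\<in>insert i0 I. ?D n j) + (\<Sum>i\<in>I. ?N n i))"
  proof (rule avg_mono)
    fix n assume n: "n \<in> Nn"
    have nn: "0 \<le> (\<Sum>j\<in>insert i0 I. ?D n j)" "0 \<le> (\<Sum>i\<in>I. ?N n i)" by (intro sum_nonneg; simp)+
    consider j where "j \<in> insert i0 I" "vote f (pt j t) (col_vote j n) \<noteq> g (pt j t)"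
      | i where "i \<in> I" "fails f (pmap2 L (noisy i) t n)"
      using passes_of_votes[OF f t n, of g] g by blast
    then show "1 \<le> (\<Sum>j\<in>insert i0 I. ?D n j) + (\<Sum>i\<in>I. ?N n i)"
    proof cases
      case 1
      then show ?thesis using member_le_sum[OF 1(1), of "?D n"] fin_sets nn(2) by simp
    next
      case 2
      then show ?thesis using member_le_sum[OF 2(1), of "?N n"] fin nn(1) by simp
    qed
  qed
  also have "\<dots> = (\<Sum>j\<in>insert i0 I. disagree f (pt j t) (g (pt j t))) + (\<Sum>i\<in>I. noisy_rej f i t)"
    by (simp only: avg_add avg_sum avg_disagree_pt noisy_rej_def)
  finally show ?thesis .
qed

text \<open>The vote that disagrees least with the others does no worse than a random vote. A value
  \<open>f x\<close> different from it is either never voted for or at most as popular, so at least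
  half of the votes disagree with \<open>f x\<close>.\<close>

lemma exists_vote:
  assumes f: "f \<in> pts \<rightarrow> carrier F" and x: "x \<in> pts"
  shows "\<exists>a\<in>carrier F. disagree f x a \<le> 2 * (\<Sum>i\<in>I. row_rej f i x) \<and> (f x \<noteq> a \<longrightarrow> 1 \<le> 2 * disagree f x (f x))"
proof -
  let ?D = "\<lambda>v. disagree f x (vote f x v)"
  obtain v where v: "v \<in> Vn" "\<And>v'. v' \<in> Vn \<Longrightarrow> ?D v \<le> ?D v'"
  proof -
    have "Min (?D ` Vn) \<in> ?D ` Vn" using fin_sets(4) ne_sets(4) by (intro Min_in) auto
    then obtain v where v: "v \<in> Vn" "Min (?D ` Vn) = ?D v" by (rule imageE)
    show ?thesis by (rule that[OF v(1)]) (use v fin_sets(4) in \<open>auto intro: Min_le simp flip: v(2)\<close>)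
  qed
  have "?D v = avg Vn (\<lambda>_. ?D v)" using fin_sets ne_sets by (simp add: avg_const)
  also have "\<dots> \<le> avg Vn ?D" using v by (intro avg_mono) auto
  also have "\<dots> \<le> 2 * (\<Sum>i\<in>I. row_rej f i x)" by (rule avg_disagree[OF f x])
  finally have 1: "?D v \<le> 2 * (\<Sum>i\<in>I. row_rej f i x)" .
  have 2: "1 \<le> 2 * disagree f x (f x)" if ne: "f x \<noteq> vote f x v"
  proof (cases "\<exists>v'\<in>Vn. vote f x v' = f x")
    case True
    then have "?D v \<le> disagree f x (f x)" using v(2) by metis
    moreover have "1 \<le> ?D v + disagree f x (f x)"
    proof -
      have "1 = avg Vn (\<lambda>_. 1)" using fin_sets ne_sets by (simp add: avg_const)
      also have "\<dots> \<le> avg Vn (\<lambda>v'. of_bool (vote f x v' \<noteq> vote f x v) + of_bool (vote f x v' \<noteq> f x))"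
        using ne by (intro avg_mono) (auto simp: of_bool_def)
      finally show ?thesis by (simp add: avg_add disagree_def)
    qed
    ultimately show ?thesis by simp
  next
    case False
    then have "disagree f x (f x) = avg Vn (\<lambda>_. 1)"
      unfolding disagree_def by (intro avg_cong) auto
    then show ?thesis using fin_sets ne_sets by (simp add: avg_const)
  qed
  show ?thesis using 1 2 vote_closed[OF f x v(1)] by blast
qed

lemma avg_disagree_base:
  assumes f: "f \<in> pts \<rightarrow> carrier F"
  shows "avg pts (\<lambda>x. disagree f x (f x)) = rej f"
proof -
  have "rej f = avg pts (\<lambda>x. avg Vn (\<lambda>v. of_bool (fails f (pmap2 L Pair x v))))"
    unfolding rej_def by (rule avg_PiE_Times[OF fin(1)])
  also have "\<dots> = avg pts (\<lambda>x. disagree f x (f x))"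
    unfolding disagree_def
  proof (intro avg_cong)
    fix x v assume "x \<in> pts" "v \<in> Vn"
    then show "of_bool (fails f (pmap2 L Pair x v)) = (of_bool (vote f x v \<noteq> f x) :: real)"
      using fails_iff[OF f pair_closed] by (auto simp: pt_i0_pair vote_def of_bool_def)
  qed
  finally show ?thesis ..
qed

lemma power2_sum_le:
  fixes a :: "_ \<Rightarrow> real" shows "(\<Sum>i\<in>A. a i)\<^sup>2 \<le> real (card A) * (\<Sum>i\<in>A. (a i)\<^sup>2)"
  using sum_squared_le_sum_of_squares[of a A] by (simp add: mult.commute)

text \<open>The distance bound is Markov's inequality for \<open>disagree f x (f x)\<close>. If
  \<open>g\<close> fails at \<open>t\<close>, then \<open>A t + B t\<close> is at least 1, where
  \<open>A\<close> bounds the disagreement at the queries and \<open>B\<close> is the rejection by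
  noisy copies. Passing to \<open>2 * A\<^sup>2 + 2 * B\<^sup>2\<close> brings in the second moments
  that contractivity controls; since queries are uniform, those in \<open>A\<close> become averages
  over \<open>pts\<close>.\<close>

lemma self_correct:
  assumes f: "f \<in> pts \<rightarrow> carrier F"
  obtains g where "g \<in> pts \<rightarrow> carrier F" "avg pts (\<lambda>x. of_bool (f x \<noteq> g x)) \<le> 2 * rej f"
    "rej g \<le> 16 * real (card I + 1) ^ 4 * root 3 (rej f ^ 4)"
proof -
  have "\<forall>x\<in>pts. \<exists>a. a \<in> carrier F \<and> disagree f x a \<le> 2 * (\<Sum>i\<in>I. row_rej f i x) \<and>
      (f x \<noteq> a \<longrightarrow> 1 \<le> 2 * disagree f x (f x))"
    using exists_vote[OF f] unfolding Bex_def by (rule ballI)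
  from bchoice[OF this] obtain g where "\<forall>x\<in>pts. g x \<in> carrier F \<and>
      disagree f x (g x) \<le> 2 * (\<Sum>i\<in>I. row_rej f i x) \<and> (f x \<noteq> g x \<longrightarrow> 1 \<le> 2 * disagree f x (f x))" ..
  then have g: "\<And>x. x \<in> pts \<Longrightarrow> g x \<in> carrier F"
    "\<And>x. x \<in> pts \<Longrightarrow> disagree f x (g x) \<le> 2 * (\<Sum>i\<in>I. row_rej f i x)"
    "\<And>x. x \<in> pts \<Longrightarrow> f x \<noteq> g x \<Longrightarrow> 1 \<le> 2 * disagree f x (f x)"
    by simp_all
  let ?k = "root 3 (rej f ^ 4)" and ?q = "real (card I + 1)"
  have k0: "0 \<le> ?k" using rej_bounds by simp
  have "avg pts (\<lambda>x. of_bool (f x \<noteq> g x)) \<le> avg pts (\<lambda>x. 2 * disagree f x (f x))"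
  proof (rule avg_mono)
    fix x assume "x \<in> pts"
    then show "of_bool (f x \<noteq> g x) \<le> 2 * disagree f x (f x)"
      using g(3) by (cases "f x = g x") (auto simp: disagree_def intro: avg_nonneg)
  qed
  then have dist: "avg pts (\<lambda>x. of_bool (f x \<noteq> g x)) \<le> 2 * rej f"
    by (simp add: avg_cmult avg_disagree_base[OF f])
  define A where "A t = (\<Sum>j\<in>insert i0 I. 2 * (\<Sum>i\<in>I. row_rej f i (pt j t)))" for t
  define B where "B t = (\<Sum>i\<in>I. noisy_rej f i t)" for t
  have cI: "real (card (insert i0 I)) = ?q" using fin i0 by simp
  have A2: "(A t)\<^sup>2 \<le> ?q * (\<Sum>j\<in>insert i0 I. 4 * (real (card I) * (\<Sum>i\<in>I. (row_rej f i (pt j t))\<^sup>2)))" for t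
  proof -
    have "(A t)\<^sup>2 \<le> ?q * (\<Sum>j\<in>insert i0 I. (2 * (\<Sum>i\<in>I. row_rej f i (pt j t)))\<^sup>2)"
      unfolding A_def cI[symmetric] by (rule power2_sum_le)
    also have "\<dots> \<le> ?q * (\<Sum>j\<in>insert i0 I. 4 * (real (card I) * (\<Sum>i\<in>I. (row_rej f i (pt j t))\<^sup>2)))"
      using power2_sum_le[of "\<lambda>i. row_rej f i (pt _ t)" I]
      by (intro mult_left_mono sum_mono) (auto simp: power_mult_distrib)
    finally show ?thesis .
  qed
  have B2: "(B t)\<^sup>2 \<le> real (card I) * (\<Sum>i\<in>I. (noisy_rej f i t)\<^sup>2)" for t
    unfolding B_def by (rule power2_sum_le)
  have "rej g \<le> avg Tn (\<lambda>t. 2 * (A t)\<^sup>2 + 2 * (B t)\<^sup>2)"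
    unfolding rej_def
  proof (rule avg_mono)
    fix t assume t: "t \<in> Tn"
    have "0 \<le> A t" "0 \<le> B t"
      unfolding A_def B_def by (intro sum_nonneg mult_nonneg_nonneg; simp add: row_rej_def noisy_rej_def avg_nonneg)+
    show "of_bool (fails g t) \<le> 2 * (A t)\<^sup>2 + 2 * (B t)\<^sup>2"
    proof (cases "fails g t")
      case True
      have "(\<Sum>j\<in>insert i0 I. disagree f (pt j t) (g (pt j t))) \<le> A t"
        unfolding A_def using pt_closed[OF t] g(2) by (intro sum_mono) auto
      then have "1 \<le> A t + B t" using fails_imp[OF f t True] by (simp add: B_def)
      then have "1 \<le> (A t + B t)\<^sup>2" by simp
      also have "\<dots> \<le> 2 * (A t)\<^sup>2 + 2 * (B t)\<^sup>2" using sum_squares_bound[of "A t" "B t"] by (simp add: power2_sum)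
      finally show ?thesis using True by simp
    qed simp
  qed
  also have "\<dots> \<le> avg Tn (\<lambda>t. 2 * (?q * (\<Sum>j\<in>insert i0 I. 4 * (real (card I) * (\<Sum>i\<in>I. (row_rej f i (pt j t))\<^sup>2))))
     + 2 * (real (card I) * (\<Sum>i\<in>I. (noisy_rej f i t)\<^sup>2)))"
    using A2 B2 by (intro avg_mono add_mono mult_left_mono) auto
  also have "\<dots> = 2 * (?q * (\<Sum>j\<in>insert i0 I. 4 * (real (card I) * (\<Sum>i\<in>I. avg Tn (\<lambda>t. (row_rej f i (pt j t))\<^sup>2)))))
     + 2 * (real (card I) * (\<Sum>i\<in>I. avg Tn (\<lambda>t. (noisy_rej f i t)\<^sup>2)))"
    by (simp only: avg_add avg_sum avg_cmult)
  also have "\<dots> \<le> 2 * (?q * (\<Sum>j\<in>insert i0 I. 4 * (real (card I) * (\<Sum>i\<in>I. ?k))))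
     + 2 * (real (card I) * (\<Sum>i\<in>I. ?k))"
    using avg_row_rej avg_noisy_rej by (intro add_mono mult_left_mono sum_mono) (auto simp: avg_pt[where u = "\<lambda>x. (row_rej f _ x)\<^sup>2"])
  also have "\<dots> = (8 * ?q\<^sup>2 * (real (card I))\<^sup>2 + 2 * (real (card I))\<^sup>2) * ?k"
    unfolding sum_constant cI by (simp add: power2_eq_square algebra_simps)
  \<comment> \<open>The total is at most \<open>10 * ?q ^ 4\<close>; rounding up to a power of two
    gives the threshold in \<open>block_test_sound\<close> its simple form.\<close>
  also have "\<dots> \<le> (16 * ?q ^ 4) * ?k"
  proof (rule mult_right_mono[OF _ k0])
    have 1: "(real (card I))\<^sup>2 \<le> ?q\<^sup>2" by (intro power_mono) auto
    have "8 * ?q\<^sup>2 * (real (card I))\<^sup>2 + 2 * (real (card I))\<^sup>2 \<le> 8 * ?q\<^sup>2 * ?q\<^sup>2 + 2 * (?q\<^sup>2 * ?q\<^sup>2)"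
    proof (intro add_mono mult_left_mono)
      have "?q\<^sup>2 * 1 \<le> ?q\<^sup>2 * ?q\<^sup>2" by (intro mult_left_mono) auto
      then show "(real (card I))\<^sup>2 \<le> ?q\<^sup>2 * ?q\<^sup>2" using 1 by linarith
    qed (use 1 in auto)
    also have "\<dots> \<le> 16 * ?q ^ 4" by (simp add: power2_eq_square power4_eq_xxxx)
    finally show "8 * ?q\<^sup>2 * (real (card I))\<^sup>2 + 2 * (real (card I))\<^sup>2 \<le> 16 * ?q ^ 4" .
  qed
  finally have "rej g \<le> 16 * ?q ^ 4 * ?k" .
  with dist g(1) show ?thesis by (intro that) auto
qed

lemma rej_eq_card: "rej f = real (card {t \<in> Tn. fails f t}) / real (card Tn)"
  unfolding rej_def by (rule avg_of_bool[OF fin_sets(5)])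

text \<open>The threshold is where \<open>16 * q ^ 4 * \<rho> powr (4/3)\<close> equals
  \<open>\<rho> / 2\<close>, that is, where \<rho> is the inverse of
  \<open>(32 * q ^ 4) ^ 3\<close>. Each correction halves the rejection probability and moves the
  function by at most twice its old value, so the distances sum to at most \<open>4 * rej f\<close>.
  The number of failing tests decreases strictly, so the process ends.\<close>

lemma block_test_sound:
  assumes "f \<in> pts \<rightarrow> carrier F" "rej f * (2 ^ 15 * real (card I + 1) ^ 12) \<le> 1"
  shows "\<exists>g. g \<in> pts \<rightarrow> carrier F \<and> (\<forall>t\<in>Tn. \<not> fails g t) \<and> avg pts (\<lambda>x. of_bool (f x \<noteq> g x)) \<le> 4 * rej f"
  using assms
proof (induction "card {t \<in> Tn. fails f t}" arbitrary: f rule: less_induct)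
  case less
  let ?q = "real (card I + 1)"
  show ?case
  proof (cases "rej f = 0")
    case True
    then have "\<forall>t\<in>Tn. \<not> fails f t" using fin_sets(5) ne_sets(5) by (auto simp: rej_eq_card)
    then show ?thesis using less.prems True by (intro exI[of _ f]) (auto simp: avg_def)
  next
    case False
    then have pos: "0 < rej f" using rej_bounds[of f] by linarith
    obtain h where h: "h \<in> pts \<rightarrow> carrier F" "avg pts (\<lambda>x. of_bool (f x \<noteq> h x)) \<le> 2 * rej f"
      "rej h \<le> 16 * ?q ^ 4 * root 3 (rej f ^ 4)"
      using self_correct[OF less.prems(1)] by blast
    have q: "0 < ?q" by simp
    have "rej f ^ 4 \<le> (rej f / (32 * ?q ^ 4)) ^ 3"
    proof -
      have "rej f ^ 3 * (rej f * (2 ^ 15 * ?q ^ 12)) \<le> rej f ^ 3 * 1"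
        using less.prems(2) pos by (intro mult_left_mono) auto
      moreover have "(32 * ?q ^ 4) ^ 3 = 2 ^ 15 * ?q ^ 12" by (simp add: power_mult_distrib flip: power_mult)
      moreover have "rej f ^ 4 = rej f ^ 3 * rej f" by (simp add: power3_eq_cube power4_eq_xxxx)
      moreover have "0 < 2 ^ 15 * ?q ^ 12" using q by simp
      ultimately show ?thesis by (simp add: power_divide pos_le_divide_eq mult.assoc)
    qed
    then have "root 3 (rej f ^ 4) \<le> root 3 ((rej f / (32 * ?q ^ 4)) ^ 3)"
      by (simp add: real_root_le_iff)
    also have "\<dots> = rej f / (32 * ?q ^ 4)"
      using pos q by (intro real_root_power_cancel) (auto intro!: divide_nonneg_pos)
    finally have "16 * ?q ^ 4 * root 3 (rej f ^ 4) \<le> 16 * ?q ^ 4 * (rej f / (32 * ?q ^ 4))"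
      using q by (intro mult_left_mono) auto
    also have "\<dots> = rej f / 2" using q by (simp add: field_simps)
    finally have half: "rej h \<le> rej f / 2" using h(3) by linarith
    then have "rej h < rej f" using pos by simp
    then have "card {t \<in> Tn. fails h t} < card {t \<in> Tn. fails f t}"
      using fin_sets(5) ne_sets(5) by (simp add: rej_eq_card divide_less_cancel card_gt_0_iff)
    moreover have "rej h * (2 ^ 15 * ?q ^ 12) \<le> 1"
      using mult_right_mono[of "rej h" "rej f" "2 ^ 15 * ?q ^ 12"] \<open>rej h < rej f\<close> less.prems(2) q by (meson less_imp_le order_trans zero_le_mult_iff zero_le_numeral zero_le_power of_nat_0_le_iff)
    ultimately obtain g where g: "g \<in> pts \<rightarrow> carrier F" "\<forall>t\<in>Tn. \<not> fails g t"
      "avg pts (\<lambda>x. of_bool (h x \<noteq> g x)) \<le> 4 * rej h"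
      using less.hyps[of h] h(1) by blast
    have "avg pts (\<lambda>x. of_bool (f x \<noteq> g x)) \<le> avg pts (\<lambda>x. of_bool (f x \<noteq> h x) + of_bool (h x \<noteq> g x))"
      by (intro avg_mono) (auto simp: of_bool_def)
    also have "\<dots> \<le> 4 * rej f" unfolding avg_add using h(2) g(3) half by linarith
    finally show ?thesis using g by blast
  qed
qed

end

section \<open>Cube sums and polynomial functions\<close>

lemma finsum_Pow_insert:
  fixes G (structure)
  assumes "abelian_monoid G" "finite B" "b \<notin> B" "\<And>C. C \<subseteq> insert b B \<Longrightarrow> f C \<in> carrier G"
  shows "(\<Oplus>C\<in>Pow (insert b B). f C) = (\<Oplus>C\<in>Pow B. f (insert b C)) \<oplus> (\<Oplus>C\<in>Pow B. f C)"
proof -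
  interpret abelian_monoid G by fact
  have inj: "inj_on (insert b) (Pow B)" using assms(3) by (auto simp: inj_on_def)
  have "(\<Oplus>C\<in>Pow (insert b B). f C) = (\<Oplus>C\<in>insert b ` Pow B. f C) \<oplus> (\<Oplus>C\<in>Pow B. f C)"
    unfolding Pow_insert Un_commute[of "Pow B"] using assms by (intro finsum_Un_disjoint) (auto simp: subset_insertI2)
  also have "(\<Oplus>C\<in>insert b ` Pow B. f C) = (\<Oplus>C\<in>Pow B. f (insert b C))"
    using assms by (intro finsum_reindex inj) (auto simp: subset_insertI2)
  finally show ?thesis .
qed

definition mix :: "'l set \<Rightarrow> 'l set \<Rightarrow> ('l \<Rightarrow> 's) \<Rightarrow> ('l \<Rightarrow> 's) \<Rightarrow> 'l \<Rightarrow> 's"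
  where "mix L C x y = (\<lambda>l\<in>L. if l \<in> C then x l else y l)"

lemma mix_closed: "x \<in> PiE L (\<lambda>_. S) \<Longrightarrow> y \<in> PiE L (\<lambda>_. S) \<Longrightarrow> mix L C x y \<in> PiE L (\<lambda>_. S)"
  by (auto simp: mix_def PiE_iff)

definition coords :: "'l set \<Rightarrow> (('l \<Rightarrow> 'a) \<Rightarrow> 'a) set"
  where "coords L = (\<lambda>l x. x l) ` L"

context cring
begin

definition sgn_pow :: "nat \<Rightarrow> 'a"
  where "sgn_pow n = (\<ominus> \<one>) [^] n"

text \<open>The Moebius transform on the subset lattice. For \<open>h C = g (mix L C x y)\<close> it
  is the iterated difference of \<open>g\<close> from \<open>y\<close> to \<open>x\<close> in the
  directions of \<open>B\<close>.\<close>

definition cube_sum :: "('i set \<Rightarrow> 'a) \<Rightarrow> 'i set \<Rightarrow> 'a"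
  where "cube_sum h B = (\<Oplus>C\<in>Pow B. sgn_pow (card (B - C)) \<otimes> h C)"

lemma sgn_pow_closed [simp]: "sgn_pow n \<in> carrier R"
  by (simp add: sgn_pow_def)

lemma sgn_pow_Suc: "sgn_pow (Suc n) = \<ominus> sgn_pow n"
  by (simp add: sgn_pow_def l_minus r_minus)

lemma cube_sum_closed [simp]: "(\<And>C. C \<subseteq> B \<Longrightarrow> h C \<in> carrier R) \<Longrightarrow> cube_sum h B \<in> carrier R"
  unfolding cube_sum_def by (intro finsum_closed) auto

lemma cube_sum_cong: "(\<And>C. C \<subseteq> B \<Longrightarrow> h C = h' C) \<Longrightarrow> (\<And>C. C \<subseteq> B \<Longrightarrow> h' C \<in> carrier R) \<Longrightarrow> cube_sum h B = cube_sum h' B"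
  unfolding cube_sum_def by (intro finsum_cong') auto

lemma cube_sum_empty: "h {} \<in> carrier R \<Longrightarrow> cube_sum h {} = h {}"
  by (simp add: cube_sum_def sgn_pow_def)

lemma finsum_uminus:
  assumes "f \<in> A \<rightarrow> carrier R"
  shows "(\<Oplus>x\<in>A. \<ominus> f x) = \<ominus> (\<Oplus>x\<in>A. f x)"
proof -
  have "(\<Oplus>x\<in>A. \<ominus> f x) \<oplus> (\<Oplus>x\<in>A. f x) = (\<Oplus>x\<in>A. \<ominus> f x \<oplus> f x)"
    using assms by (intro finsum_addf[symmetric]) auto
  also have "\<dots> = (\<Oplus>x\<in>A. \<zero>)" using assms by (intro finsum_cong') (auto simp: Pi_iff l_neg)
  finally show ?thesis using assms by (intro minus_equality[symmetric]) (auto intro!: finsum_closed)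
qed

lemma cube_sum_add:
  assumes "\<And>C. C \<subseteq> B \<Longrightarrow> h C \<in> carrier R" "\<And>C. C \<subseteq> B \<Longrightarrow> h' C \<in> carrier R"
  shows "cube_sum (\<lambda>C. h C \<oplus> h' C) B = cube_sum h B \<oplus> cube_sum h' B"
proof -
  have "cube_sum (\<lambda>C. h C \<oplus> h' C) B = (\<Oplus>C\<in>Pow B. sgn_pow (card (B - C)) \<otimes> h C \<oplus> sgn_pow (card (B - C)) \<otimes> h' C)"
    unfolding cube_sum_def using assms by (intro finsum_cong') (auto simp: r_distr)
  also have "\<dots> = cube_sum h B \<oplus> cube_sum h' B"
    unfolding cube_sum_def using assms by (intro finsum_addf) auto
  finally show ?thesis .
qed

lemma cube_sum_cmult:
  assumes "\<And>C. C \<subseteq> B \<Longrightarrow> h C \<in> carrier R" "a \<in> carrier R" "finite B"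
  shows "cube_sum (\<lambda>C. a \<otimes> h C) B = a \<otimes> cube_sum h B"
proof -
  have "a \<otimes> cube_sum h B = (\<Oplus>C\<in>Pow B. a \<otimes> (sgn_pow (card (B - C)) \<otimes> h C))"
    unfolding cube_sum_def using assms by (intro finsum_rdistr) auto
  also have "\<dots> = cube_sum (\<lambda>C. a \<otimes> h C) B"
    unfolding cube_sum_def using assms by (intro finsum_cong') (auto simp: m_lcomm)
  finally show ?thesis ..
qed

lemma cube_sum_insert:
  assumes "finite B" "b \<notin> B" "\<And>C. C \<subseteq> insert b B \<Longrightarrow> h C \<in> carrier R"
  shows "cube_sum h (insert b B) = cube_sum (\<lambda>C. h (insert b C)) B \<ominus> cube_sum h B"
proof -
  have 2: "card (insert b B - C) = Suc (card (B - C))" if "C \<subseteq> B" for C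
  proof -
    have "insert b B - C = insert b (B - C)" using assms(2) that by auto
    then show ?thesis using assms(1,2) by simp
  qed
  have "cube_sum h (insert b B) = (\<Oplus>C\<in>Pow B. sgn_pow (card (insert b B - insert b C)) \<otimes> h (insert b C)) \<oplus>
      (\<Oplus>C\<in>Pow B. sgn_pow (card (insert b B - C)) \<otimes> h C)"
    unfolding cube_sum_def by (rule finsum_Pow_insert[OF abelian_monoid_axioms assms(1,2)]) (use assms(3) in auto)
  also have "(\<Oplus>C\<in>Pow B. sgn_pow (card (insert b B - insert b C)) \<otimes> h (insert b C)) = cube_sum (\<lambda>C. h (insert b C)) B"
    unfolding cube_sum_def using assms(2,3) by (intro finsum_cong') (auto simp: subset_insertI2 Diff_insert0)
  also have "(\<Oplus>C\<in>Pow B. sgn_pow (card (insert b B - C)) \<otimes> h C) = (\<Oplus>C\<in>Pow B. \<ominus> (sgn_pow (card (B - C)) \<otimes> h C))"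
    using assms(3) by (intro finsum_cong') (auto simp: 2 sgn_pow_Suc l_minus subset_insertI2)
  also have "\<dots> = \<ominus> cube_sum h B"
    unfolding cube_sum_def using assms(3) by (intro finsum_uminus) (auto simp: subset_insertI2)
  finally show ?thesis by (simp add: minus_eq)
qed

text \<open>A direction that \<open>h\<close> ignores pairs equal terms of opposite sign.\<close>

lemma cube_sum_eq_zero:
  assumes "finite B" "b \<in> B" "\<And>C. C \<subseteq> B \<Longrightarrow> h C \<in> carrier R" "\<And>C. C \<subseteq> B - {b} \<Longrightarrow> h (insert b C) = h C"
  shows "cube_sum h B = \<zero>"
proof -
  have "cube_sum h (insert b (B - {b})) = cube_sum (\<lambda>C. h (insert b C)) (B - {b}) \<ominus> cube_sum h (B - {b})"
    using assms by (intro cube_sum_insert) (auto simp: insert_absorb)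
  also have "cube_sum (\<lambda>C. h (insert b C)) (B - {b}) = cube_sum h (B - {b})"
    using assms(3,4) by (intro cube_sum_cong) (auto simp: subset_Diff_insert)
  finally have "cube_sum h (insert b (B - {b})) = cube_sum h (B - {b}) \<ominus> cube_sum h (B - {b})" .
  moreover have "cube_sum h (B - {b}) \<in> carrier R" using assms(3) by (intro cube_sum_closed) auto
  ultimately show ?thesis using assms(2) by (simp add: insert_absorb r_neg minus_eq)
qed

lemma cube_sum_Moebius:
  assumes "finite K" "\<And>C. C \<subseteq> K \<Longrightarrow> h C \<in> carrier R"
  shows "(\<Oplus>B\<in>Pow K. cube_sum h B) = h K"
  using assms
proof (induction K arbitrary: h)
  case empty
  then show ?case by (simp add: cube_sum_empty)
next
  case (insert b K)
  note [simp] = subset_insertI2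
  have c: "cube_sum h B \<in> carrier R" if "B \<subseteq> insert b K" for B
    using insert.prems that by (intro cube_sum_closed) auto
  have "(\<Oplus>B\<in>Pow (insert b K). cube_sum h B) = (\<Oplus>B\<in>Pow K. cube_sum h (insert b B)) \<oplus> (\<Oplus>B\<in>Pow K. cube_sum h B)"
    by (rule finsum_Pow_insert[OF abelian_monoid_axioms insert.hyps c])
  also have "\<dots> = (\<Oplus>B\<in>Pow K. cube_sum h (insert b B) \<oplus> cube_sum h B)"
    using c by (intro finsum_addf[symmetric]) auto
  also have "\<dots> = (\<Oplus>B\<in>Pow K. cube_sum (\<lambda>C. h (insert b C)) B)"
  proof (intro finsum_cong' refl)
    show "(\<lambda>B. cube_sum (\<lambda>C. h (insert b C)) B) \<in> Pow K \<rightarrow> carrier R"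
      using insert.prems by (auto intro!: cube_sum_closed)
    fix B assume "B \<in> Pow K"
    then have B: "B \<subseteq> K" "finite B" "b \<notin> B" using insert.hyps by (auto intro: finite_subset)
    have "cube_sum h (insert b B) = cube_sum (\<lambda>C. h (insert b C)) B \<ominus> cube_sum h B"
      using B insert.prems by (intro cube_sum_insert) auto
    moreover have "cube_sum (\<lambda>C. h (insert b C)) B \<in> carrier R" using B insert.prems by (intro cube_sum_closed) auto
    moreover have "cube_sum h B \<in> carrier R" using B c by auto
    ultimately show "cube_sum h (insert b B) \<oplus> cube_sum h B = cube_sum (\<lambda>C. h (insert b C)) B"
      by (simp add: minus_eq a_assoc l_neg)
  qed
  also have "\<dots> = h (insert b K)"
    using insert.prems by (intro insert.IH) auto
  finally show ?case .
qed

lemma cube_sum_minus: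
  assumes "\<And>C. C \<subseteq> B \<Longrightarrow> h C \<in> carrier R" "\<And>C. C \<subseteq> B \<Longrightarrow> h' C \<in> carrier R" "finite B"
  shows "cube_sum (\<lambda>C. h C \<ominus> h' C) B = cube_sum h B \<ominus> cube_sum h' B"
proof -
  have "cube_sum (\<lambda>C. h C \<ominus> h' C) B = cube_sum (\<lambda>C. h C \<oplus> (\<ominus> \<one>) \<otimes> h' C) B"
    using assms by (intro cube_sum_cong) (auto simp: minus_eq l_minus)
  also have "\<dots> = cube_sum h B \<oplus> (\<ominus> \<one>) \<otimes> cube_sum h' B"
    using assms by (simp add: cube_sum_add cube_sum_cmult)
  finally show ?thesis using assms by (simp add: minus_eq l_minus)
qed

lemma cube_sum_image:
  assumes "inj_on e B" "\<And>C. C \<subseteq> e ` B \<Longrightarrow> h C \<in> carrier R"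
  shows "cube_sum h (e ` B) = cube_sum (\<lambda>C. h (e ` C)) B"
proof -
  have "cube_sum h (e ` B) = (\<Oplus>C\<in>(image e) ` Pow B. sgn_pow (card (e ` B - C)) \<otimes> h C)"
    by (simp add: cube_sum_def image_Pow_surj)
  also have "\<dots> = (\<Oplus>C\<in>Pow B. sgn_pow (card (e ` B - e ` C)) \<otimes> h (e ` C))"
    using assms by (intro finsum_reindex inj_on_image_Pow) (auto simp: image_mono)
  also have "\<dots> = cube_sum (\<lambda>C. h (e ` C)) B"
    unfolding cube_sum_def
  proof (intro finsum_cong' refl)
    fix C assume "C \<in> Pow B"
    then have "e ` B - e ` C = e ` (B - C)" "inj_on e (B - C)"
      using assms(1) by (auto simp: inj_on_image_set_diff inj_on_diff)
    then show "sgn_pow (card (e ` B - e ` C)) \<otimes> h (e ` C) = sgn_pow (card (B - C)) \<otimes> h (e ` C)"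
      by (simp add: card_image)
  qed (use assms in \<open>auto simp: image_mono\<close>)
  finally show ?thesis .
qed

text \<open>Functions that on \<open>D\<close> agree with a polynomial of degree at most
  \<open>d\<close> in the generators \<open>C\<close>. Arbitrary generators let one notion serve
  coordinates, entries of permutations and mixtures of both; \<open>polyf_ext\<close> makes values
  outside \<open>D\<close> irrelevant.\<close>

inductive polyf :: "('p \<Rightarrow> 'a) set \<Rightarrow> 'p set \<Rightarrow> nat \<Rightarrow> ('p \<Rightarrow> 'a) \<Rightarrow> bool" for C D where
  polyf_const: "a \<in> carrier R \<Longrightarrow> polyf C D d (\<lambda>_. a)"
| polyf_add: "polyf C D d f \<Longrightarrow> polyf C D d g \<Longrightarrow> polyf C D d (\<lambda>p. f p \<oplus> g p)"
| polyf_mult: "h \<in> C \<Longrightarrow> polyf C D d f \<Longrightarrow> polyf C D (Suc d) (\<lambda>p. h p \<otimes> f p)"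
| polyf_ext: "polyf C D d f \<Longrightarrow> (\<And>p. p \<in> D \<Longrightarrow> g p = f p) \<Longrightarrow> polyf C D d g"

lemma polyf_closed:
  assumes "polyf C D d f" "C \<subseteq> D \<rightarrow> carrier R" "p \<in> D"
  shows "f p \<in> carrier R"
  using assms by (induction rule: polyf.induct) auto

lemma polyf_mono: "polyf C D d f \<Longrightarrow> d \<le> e \<Longrightarrow> polyf C D e f"
proof (induction arbitrary: e rule: polyf.induct)
  case (polyf_mult h d f)
  then obtain e' where "e = Suc e'" "d \<le> e'" by (metis Suc_le_D Suc_le_mono)
  then show ?case using polyf_mult by (auto intro: polyf.polyf_mult)
qed (auto intro: polyf.intros)

lemma polyf_cmult:
  assumes "polyf C D d f" "C \<subseteq> D \<rightarrow> carrier R" "a \<in> carrier R"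
  shows "polyf C D d (\<lambda>p. a \<otimes> f p)"
  using assms(1)
proof (induction rule: polyf.induct)
  case (polyf_const b d)
  then show ?case using assms(3) by (auto intro: polyf.polyf_const)
next
  case (polyf_add d f g)
  show ?case
    by (rule polyf_ext[OF polyf.polyf_add[OF polyf_add.IH]])
      (use polyf_closed[OF polyf_add.hyps(1) assms(2)] polyf_closed[OF polyf_add.hyps(2) assms(2)] assms(3) in \<open>simp add: r_distr\<close>)
next
  case (polyf_mult h d f)
  show ?case
  proof (rule polyf_ext[OF polyf.polyf_mult[OF polyf_mult.hyps(1) polyf_mult.IH]])
    fix p assume "p \<in> D"
    then have "h p \<in> carrier R" "f p \<in> carrier R" using polyf_mult.hyps assms(2) polyf_closed by auto
    then show "a \<otimes> (h p \<otimes> f p) = h p \<otimes> (a \<otimes> f p)" using assms(3) by (simp add: m_lcomm)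
  qed
next
  case (polyf_ext d f g)
  show ?case by (rule polyf.polyf_ext[OF polyf_ext.IH]) (simp add: polyf_ext.hyps)
qed

lemma polyf_minus:
  assumes "polyf C D d f" "polyf C D d g" "C \<subseteq> D \<rightarrow> carrier R"
  shows "polyf C D d (\<lambda>p. f p \<ominus> g p)"
proof (rule polyf_ext[OF polyf_add[OF assms(1) polyf_cmult[OF assms(2,3), of "\<ominus> \<one>"]]])
  show "f p \<ominus> g p = f p \<oplus> \<ominus> \<one> \<otimes> g p" if "p \<in> D" for p
    using polyf_closed[OF assms(1,3) that] polyf_closed[OF assms(2,3) that] by (simp add: minus_eq l_minus)
qed simp

lemma polyf_finsum:
  assumes "finite A" "\<And>i. i \<in> A \<Longrightarrow> polyf C D d (f i)" "C \<subseteq> D \<rightarrow> carrier R"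
  shows "polyf C D d (\<lambda>p. \<Oplus>i\<in>A. f i p)"
  using assms(1,2)
proof (induction A)
  case empty
  then show ?case by (simp add: polyf_const finsum_empty)
next
  case (insert i A)
  then have "polyf C D d (\<lambda>p. f i p \<oplus> (\<Oplus>i\<in>A. f i p))" by (intro polyf_add) auto
  then show ?case
    by (rule polyf_ext) (use insert polyf_closed[OF _ assms(3)] in \<open>auto intro!: finsum_insert\<close>)
qed

text \<open>Used to rename variables and to freeze some of them: neither raises the degree.\<close>

lemma polyf_subst:
  assumes "polyf C D d f" "\<And>p. p \<in> D' \<Longrightarrow> s p \<in> D"
    and C: "\<And>h. h \<in> C \<Longrightarrow> (\<exists>h'\<in>C'. \<forall>p\<in>D'. h (s p) = h' p) \<or> (\<exists>a\<in>carrier R. \<forall>p\<in>D'. h (s p) = a)"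
    and C': "C' \<subseteq> D' \<rightarrow> carrier R"
  shows "polyf C' D' d (\<lambda>p. f (s p))"
  using assms(1)
proof (induction rule: polyf.induct)
  case (polyf_mult h d f)
  from C[OF polyf_mult.hyps(1)] show ?case
  proof
    assume "\<exists>h'\<in>C'. \<forall>p\<in>D'. h (s p) = h' p"
    then obtain h' where "h' \<in> C'" "\<forall>p\<in>D'. h (s p) = h' p" by blast
    then show ?thesis by (intro polyf.polyf_ext[OF polyf.polyf_mult[OF _ polyf_mult.IH]]) auto
  next
    assume "\<exists>a\<in>carrier R. \<forall>p\<in>D'. h (s p) = a"
    then obtain a where "a \<in> carrier R" "\<forall>p\<in>D'. h (s p) = a" by blast
    then show ?thesis
      by (intro polyf.polyf_ext[OF polyf_cmult[OF polyf_mono[OF polyf_mult.IH, of "Suc d"] C', of a]]) simp_all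
  qed
next
  case (polyf_ext d f g)
  show ?case by (rule polyf.polyf_ext[OF polyf_ext.IH]) (simp add: polyf_ext.hyps assms(2))
qed (auto intro: polyf.intros)

text \<open>A polynomial expression makes sense on any domain. This supplies a value for a quotient
  at the point where its denominator vanishes.\<close>

lemma polyf_extend:
  assumes "polyf C D d f"
  shows "\<exists>f'. polyf C D' d f' \<and> (\<forall>p\<in>D. f' p = f p)"
  using assms
proof (induction rule: polyf.induct)
  case (polyf_const a d)
  then show ?case by (intro exI[of _ "\<lambda>_. a"]) (auto intro: polyf.polyf_const)
next
  case (polyf_add d f g)
  then obtain f' g' where "polyf C D' d f'" "polyf C D' d g'" "\<forall>p\<in>D. f' p = f p" "\<forall>p\<in>D. g' p = g p" by blast
  then show ?case by (intro exI[of _ "\<lambda>p. f' p \<oplus> g' p"]) (auto intro: polyf.polyf_add)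
next
  case (polyf_mult h d f)
  then obtain f' where "polyf C D' d f'" "\<forall>p\<in>D. f' p = f p" by blast
  then show ?case using polyf_mult.hyps by (intro exI[of _ "\<lambda>p. h p \<otimes> f' p"]) (auto intro: polyf.polyf_mult)
next
  case (polyf_ext d f g)
  then show ?case by metis
qed

lemma polyf_0_const:
  assumes "polyf C D d f" "d = 0"
  shows "\<exists>a\<in>carrier R. \<forall>p\<in>D. f p = a"
  using assms
proof (induction rule: polyf.induct)
  case (polyf_add d f g)
  then obtain a b where "a \<in> carrier R" "b \<in> carrier R" "\<forall>p\<in>D. f p = a" "\<forall>p\<in>D. g p = b" by blast
  then show ?case by (intro bexI[of _ "a \<oplus> b"]) auto
qed auto

lemma coords_closed: "S \<subseteq> carrier R \<Longrightarrow> coords L \<subseteq> PiE L (\<lambda>_. S) \<rightarrow> carrier R"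
  by (auto simp: coords_def PiE_iff)

lemma polyf_mix_closed:
  assumes "polyf (coords L) (PiE L (\<lambda>_. S)) d f" "S \<subseteq> carrier R"
    and "x \<in> PiE L (\<lambda>_. S)" "y \<in> PiE L (\<lambda>_. S)"
  shows "f (mix L C x y) \<in> carrier R"
  by (rule polyf_closed[OF assms(1) coords_closed[OF assms(2)] mix_closed[OF assms(3,4)]])

text \<open>\<open>\<phi>\<close> assigns coordinates to blocks. For a product with coordinate
  \<open>l\<close>, the factor is constant on the cube if \<open>\<phi> l\<close> is no direction of
  it. Otherwise the cube splits along \<open>\<phi> l\<close> into two faces on which the factor is
  constant, and dimension and degree both drop by one.\<close>

lemma cube_sum_polyf:
  assumes "polyf (coords L) (PiE L (\<lambda>_. S)) d f" and S: "S \<subseteq> carrier R"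
    and "x \<in> PiE L (\<lambda>_. S)" "y \<in> PiE L (\<lambda>_. S)" "finite B" "d < card B"
  shows "cube_sum (\<lambda>C. f (mix L {l. \<phi> l \<in> C} x y)) B = \<zero>"
  using assms(1,3-)
proof (induction arbitrary: x y B rule: polyf.induct)
  case (polyf_const a d)
  then obtain b where "b \<in> B" by fastforce
  then show ?case using polyf_const by (intro cube_sum_eq_zero) auto
next
  case (polyf_add d f g)
  then show ?case
    using polyf_mix_closed[OF polyf_add.hyps(1) S] polyf_mix_closed[OF polyf_add.hyps(2) S] by (subst cube_sum_add) auto
next
  case (polyf_ext d f g)
  have "cube_sum (\<lambda>C. g (mix L {l. \<phi> l \<in> C} x y)) B = cube_sum (\<lambda>C. f (mix L {l. \<phi> l \<in> C} x y)) B"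
    using polyf_ext.prems polyf_ext.hyps(2)[OF mix_closed] polyf_mix_closed[OF polyf_ext.hyps(1) S] by (intro cube_sum_cong) auto
  then show ?case using polyf_ext.IH polyf_ext.prems by simp
next
  case (polyf_mult h d f)
  then obtain l where l: "l \<in> L" "h = (\<lambda>x. x l)" by (auto simp: coords_def)
  define m where "m C x y = mix L {l. \<phi> l \<in> C} x y" for C and x y :: "_ \<Rightarrow> 'a"
  have fc: "f (m C x y) \<in> carrier R" if "x \<in> PiE L (\<lambda>_. S)" "y \<in> PiE L (\<lambda>_. S)" for C x y
    unfolding m_def using polyf_mix_closed[OF polyf_mult.hyps(2) S] that by blast
  have xy: "x l \<in> carrier R" "y l \<in> carrier R" using polyf_mult.prems l(1) S by auto
  have hm: "h (m C x y) = (if \<phi> l \<in> C then x l else y l)" for C using l by (simp add: m_def mix_def)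
  have IH: "cube_sum (\<lambda>C. f (m C x y)) B' = \<zero>" if "x \<in> PiE L (\<lambda>_. S)" "y \<in> PiE L (\<lambda>_. S)" "finite B'" "d < card B'" for x y B'
    unfolding m_def using polyf_mult.IH that by blast
  have "cube_sum (\<lambda>C. h (m C x y) \<otimes> f (m C x y)) B = \<zero>"
  proof (cases "\<phi> l \<in> B")
    case False
    have "cube_sum (\<lambda>C. h (m C x y) \<otimes> f (m C x y)) B = cube_sum (\<lambda>C. y l \<otimes> f (m C x y)) B"
      using False fc xy polyf_mult.prems by (intro cube_sum_cong) (auto simp: hm)
    also have "\<dots> = y l \<otimes> cube_sum (\<lambda>C. f (m C x y)) B"
      using fc xy polyf_mult.prems by (intro cube_sum_cmult) auto
    also have "cube_sum (\<lambda>C. f (m C x y)) B = \<zero>" using polyf_mult.prems by (intro IH) auto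
    finally show ?thesis using xy by simp
  next
    case True
    let ?b = "\<phi> l" and ?B = "B - {\<phi> l}"
    \<comment> \<open>Moving \<open>y\<close> to \<open>x\<close> on the whole block
      \<open>?b\<close> makes the face that contains \<open>?b\<close> again a family of mixes, now
      of \<open>x\<close> and \<open>y'\<close>.\<close>
    define y' where "y' = mix L {l. \<phi> l \<in> {?b}} x y"
    have y': "y' \<in> PiE L (\<lambda>_. S)" unfolding y'_def using polyf_mult.prems by (intro mix_closed) auto
    have mins: "m (insert ?b C) x y = m C x y'" for C
      by (auto simp: m_def mix_def y'_def fun_eq_iff restrict_def)
    have B: "finite ?B" "?b \<notin> ?B" "insert ?b ?B = B" "d < card ?B"
      using True polyf_mult.prems by (auto simp: card_Diff_singleton)
    have "cube_sum (\<lambda>C. h (m C x y) \<otimes> f (m C x y)) (insert ?b ?B)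
      = cube_sum (\<lambda>C. h (m (insert ?b C) x y) \<otimes> f (m (insert ?b C) x y)) ?B \<ominus> cube_sum (\<lambda>C. h (m C x y) \<otimes> f (m C x y)) ?B"
      using B fc xy polyf_mult.prems by (intro cube_sum_insert) (auto simp: hm)
    also have "cube_sum (\<lambda>C. h (m (insert ?b C) x y) \<otimes> f (m (insert ?b C) x y)) ?B = cube_sum (\<lambda>C. x l \<otimes> f (m C x y')) ?B"
      using fc xy y' polyf_mult.prems by (intro cube_sum_cong) (auto simp: hm mins[symmetric])
    also have "\<dots> = x l \<otimes> cube_sum (\<lambda>C. f (m C x y')) ?B"
      using fc xy y' polyf_mult.prems by (intro cube_sum_cmult) auto
    also have "cube_sum (\<lambda>C. f (m C x y')) ?B = \<zero>" using polyf_mult.prems y' B by (intro IH) auto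
    also have "cube_sum (\<lambda>C. h (m C x y) \<otimes> f (m C x y)) ?B = cube_sum (\<lambda>C. y l \<otimes> f (m C x y)) ?B"
      using fc xy polyf_mult.prems by (intro cube_sum_cong) (auto simp: hm)
    also have "\<dots> = y l \<otimes> cube_sum (\<lambda>C. f (m C x y)) ?B"
      using fc xy polyf_mult.prems by (intro cube_sum_cmult) auto
    also have "cube_sum (\<lambda>C. f (m C x y)) ?B = \<zero>" using polyf_mult.prems B by (intro IH) auto
    finally show ?thesis using xy B by (simp add: minus_eq)
  qed
  then show ?case by (simp only: m_def)
qed

end

section \<open>Polynomial functions of bijections\<close>

definition bijs :: "'c set \<Rightarrow> 's set \<Rightarrow> ('c \<Rightarrow> 's) set"
  where "bijs A B = {\<pi> \<in> PiE A (\<lambda>_. B). bij_betw \<pi> A B}"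

lemma bijs_mem: "\<pi> \<in> bijs A B \<Longrightarrow> c \<in> A \<Longrightarrow> \<pi> c \<in> B"
  by (auto simp: bijs_def)

lemma bijs_upd:
  assumes "\<pi> \<in> bijs (A - {c}) (B - {b})" "c \<in> A" "b \<in> B"
  shows "\<pi>(c := b) \<in> bijs A B"
proof -
  have p: "\<pi> \<in> PiE (A - {c}) (\<lambda>_. B - {b})" "inj_on \<pi> (A - {c})" "\<pi> ` (A - {c}) = B - {b}"
    using assms(1) by (auto simp: bijs_def bij_betw_def)
  have "inj_on (\<pi>(c := b)) (insert c (A - {c}))"
    using p by (intro inj_on_insert[THEN iffD2] conjI inj_on_fun_updI) auto
  moreover have "(\<pi>(c := b)) ` A = B"
  proof -
    have "(\<pi>(c := b)) ` A = insert b (\<pi> ` (A - {c}))" using assms(2) by auto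
    then show ?thesis using p assms(3) by auto
  qed
  moreover have "\<pi>(c := b) \<in> PiE A (\<lambda>_. B)"
    using p(1) assms(2,3) by (auto simp: PiE_iff extensional_def)
  ultimately show ?thesis using assms(2) by (simp add: bijs_def bij_betw_def insert_absorb)
qed

lemma bijs_swap:
  assumes "\<pi> \<in> bijs A B" "c \<in> A" "c' \<in> A"
  shows "\<pi>(c := \<pi> c', c' := \<pi> c) \<in> bijs A B"
proof -
  have b: "bij_betw \<pi> A B" using assms by (simp add: bijs_def)
  have "bij_betw (\<pi> \<circ> Transposition.transpose c c') A B"
    using assms(2,3) b by (intro bij_betw_trans[of _ A A]) auto
  moreover have "\<pi> \<circ> Transposition.transpose c c' = \<pi>(c := \<pi> c', c' := \<pi> c)"
    by (auto simp: Transposition.transpose_def fun_eq_iff)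
  ultimately show ?thesis using assms by (auto simp: bijs_def PiE_iff extensional_def)
qed

lemma exists_bijs:
  assumes "finite A" "finite B" "card A = card B" "c \<in> A" "b \<in> B"
  shows "\<exists>\<pi>\<in>bijs A B. \<pi> c = b"
proof -
  have "card (A - {c}) = card (B - {b})" using assms by simp
  then obtain h where h: "bij_betw h (A - {c}) (B - {b})"
    using assms(1,2) finite_same_card_bij[of "A - {c}" "B - {b}"] by auto
  then have "restrict h (A - {c}) \<in> bijs (A - {c}) (B - {b})"
    by (auto simp: bijs_def bij_betw_def inj_on_def)
  from bijs_upd[OF this assms(4,5)] show ?thesis by (intro bexI[of _ "(restrict h (A - {c}))(c := b)"]) auto
qed

text \<open>The degree is counted jointly in both components, so the second can carry further
  variables through an argument about the first.\<close>

definition split_coords :: "('x \<Rightarrow> 'a) set \<Rightarrow> ('z \<Rightarrow> 'a) set \<Rightarrow> ('x \<times> 'z \<Rightarrow> 'a) set"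
  where "split_coords U Z = (\<lambda>h p. h (fst p)) ` U \<union> (\<lambda>h p. h (snd p)) ` Z"

lemma split_coords_closed:
  "U \<subseteq> A \<rightarrow> M \<Longrightarrow> Z \<subseteq> B \<rightarrow> M \<Longrightarrow> split_coords U Z \<subseteq> A \<times> B \<rightarrow> M"
  by (fastforce simp: split_coords_def)

lemma split_coords_cases:
  assumes "h \<in> split_coords U Z"
  obtains g where "g \<in> U" "h = (\<lambda>p. g (fst p))" | g where "g \<in> Z" "h = (\<lambda>p. g (snd p))"
  using assms by (auto simp: split_coords_def)

lemma split_coordsI:
  "g \<in> U \<Longrightarrow> (\<lambda>p. g (fst p)) \<in> split_coords U Z" "g' \<in> Z \<Longrightarrow> (\<lambda>p. g' (snd p)) \<in> split_coords U Z"
  by (auto simp: split_coords_def)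

lemma coordsI: "l \<in> L \<Longrightarrow> (\<lambda>x. x l) \<in> coords L"
  by (auto simp: coords_def)

lemma coords_cases:
  assumes "h \<in> coords L" obtains l where "l \<in> L" "h = (\<lambda>x. x l)"
  using assms by (auto simp: coords_def)

context field
begin

text \<open>A Leibniz rule: the quotient for \<open>h * f\<close> is the quotient of
  \<open>h\<close> times \<open>f\<close>, plus the shifted \<open>h\<close> times the quotient of
  \<open>f\<close>. By \<open>diff\<close> the quotient of a generator is a constant, so one degree
  is lost.\<close>

lemma polyf_divided_difference:
  assumes "polyf C D d f" and C: "C \<subseteq> D \<rightarrow> carrier R" and s: "\<And>p. p \<in> D \<Longrightarrow> s p \<in> D"
    and e: "\<And>p. p \<in> D \<Longrightarrow> e p \<in> carrier R - {\<zero>}"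
    and swap: "\<And>h. h \<in> C \<Longrightarrow> \<exists>h'\<in>C. \<forall>p\<in>D. h (s p) = h' p"
    and diff: "\<And>h. h \<in> C \<Longrightarrow> \<exists>a\<in>carrier R. \<forall>p\<in>D. h p \<ominus> h (s p) = a \<otimes> e p"
    and d: "d = Suc k"
  shows "polyf C D k (\<lambda>p. (f p \<ominus> f (s p)) \<otimes> inv e p)"
  using assms(1) d
proof (induction arbitrary: k rule: polyf.induct)
  case (polyf_const a d)
  show ?case
    by (rule polyf_ext[OF polyf.polyf_const[OF zero_closed]])
      (use polyf_const e in \<open>auto simp: r_neg minus_eq field_Units\<close>)
next
  case (polyf_add d f g)
  show ?case
  proof (rule polyf_ext[OF polyf.polyf_add[OF polyf_add.IH(1)[OF polyf_add.prems] polyf_add.IH(2)[OF polyf_add.prems]]])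
    fix p assume p: "p \<in> D"
    have c: "f p \<in> carrier R" "g p \<in> carrier R" "f (s p) \<in> carrier R" "g (s p) \<in> carrier R" "inv e p \<in> carrier R"
      using polyf_closed[OF polyf_add.hyps(1) C] polyf_closed[OF polyf_add.hyps(2) C] p s e by (auto simp: field_Units)
    have "(f p \<oplus> g p) \<ominus> (f (s p) \<oplus> g (s p)) = (f p \<ominus> f (s p)) \<oplus> (g p \<ominus> g (s p))"
      using c by (simp add: minus_eq minus_add a_ac)
    then show "(f p \<oplus> g p \<ominus> (f (s p) \<oplus> g (s p))) \<otimes> inv e p = (f p \<ominus> f (s p)) \<otimes> inv e p \<oplus> (g p \<ominus> g (s p)) \<otimes> inv e p"
      using c by (simp add: l_distr)
  qed
next
  case (polyf_ext d f g)
  show ?case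
    by (rule polyf.polyf_ext[OF polyf_ext.IH[OF polyf_ext.prems]]) (simp add: polyf_ext.hyps s)
next
  case (polyf_mult h d f)
  then have k: "d = k" by simp
  obtain h' where h': "h' \<in> C" "\<forall>p\<in>D. h (s p) = h' p" using swap polyf_mult.hyps by blast
  obtain a where a: "a \<in> carrier R" "\<forall>p\<in>D. h p \<ominus> h (s p) = a \<otimes> e p" using diff polyf_mult.hyps by blast
  have 1: "polyf C D k (\<lambda>p. h (s p) \<otimes> ((f p \<ominus> f (s p)) \<otimes> inv e p))"
  proof (cases k)
    \<comment> \<open>There is no smaller degree for the induction hypothesis; \<open>f\<close> is
      constant and its difference vanishes.\<close>
    case 0
    obtain b where "b \<in> carrier R" "\<forall>p\<in>D. f p = b" using polyf_0_const[OF polyf_mult.hyps(2)] k 0 by blast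
    moreover have "h' p \<in> carrier R" if "p \<in> D" for p using C h' that by blast
    ultimately show ?thesis
      using s e h' by (intro polyf_ext[OF polyf_const[OF zero_closed]]) (auto simp: r_neg minus_eq field_Units)
  next
    case (Suc k')
    have "polyf C D k (\<lambda>p. h' p \<otimes> ((f p \<ominus> f (s p)) \<otimes> inv e p))"
      unfolding Suc using polyf_mult.IH[of k'] k Suc h' by (intro polyf.polyf_mult) auto
    then show ?thesis by (rule polyf_ext) (simp add: h')
  qed
  have 2: "polyf C D k (\<lambda>p. a \<otimes> f p)"
    using polyf_mult.hyps(2) k by (auto intro: polyf_cmult[OF _ C a(1)])
  have hc: "h p \<in> carrier R" if "p \<in> D" for p using polyf_mult.hyps(1) C that by blast
  show ?case
  proof (rule polyf_ext[OF polyf_add[OF 2 1]])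
    fix p assume p: "p \<in> D"
    have c: "f p \<in> carrier R" "f (s p) \<in> carrier R" "h p \<in> carrier R" "h (s p) \<in> carrier R" "inv e p \<in> carrier R" "e p \<in> carrier R"
      using polyf_closed[OF polyf_mult.hyps(2) C] p s e hc by (auto simp: field_Units)
    have inv: "e p \<otimes> inv e p = \<one>" using e[OF p] by (simp add: field_Units)
    have "h p \<otimes> f p \<ominus> h (s p) \<otimes> f (s p) = (h p \<ominus> h (s p)) \<otimes> f p \<oplus> h (s p) \<otimes> (f p \<ominus> f (s p))"
    proof -
      have "(h p \<ominus> h (s p)) \<otimes> f p \<oplus> h (s p) \<otimes> (f p \<ominus> f (s p))
        = h p \<otimes> f p \<oplus> (\<ominus> (h (s p) \<otimes> f p) \<oplus> (h (s p) \<otimes> f p \<oplus> \<ominus> (h (s p) \<otimes> f (s p))))"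
        using c by (simp add: minus_eq l_distr r_distr l_minus r_minus a_assoc)
      also have "\<dots> = h p \<otimes> f p \<ominus> h (s p) \<otimes> f (s p)"
        using c by (simp add: minus_eq r_neg1)
      finally show ?thesis ..
    qed
    also have "h p \<ominus> h (s p) = a \<otimes> e p" using a p by blast
    finally have "(h p \<otimes> f p \<ominus> h (s p) \<otimes> f (s p)) \<otimes> inv e p
        = (a \<otimes> e p \<otimes> f p) \<otimes> inv e p \<oplus> h (s p) \<otimes> (f p \<ominus> f (s p)) \<otimes> inv e p"
      using c a by (simp add: l_distr)
    also have "(a \<otimes> e p \<otimes> f p) \<otimes> inv e p = (a \<otimes> f p) \<otimes> (e p \<otimes> inv e p)"
      using c a by (simp add: m_ac)
    finally show "(h p \<otimes> f p \<ominus> h (s p) \<otimes> f (s p)) \<otimes> inv e p = a \<otimes> f p \<oplus> h (s p) \<otimes> ((f p \<ominus> f (s p)) \<otimes> inv e p)"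
      using c a by (simp add: inv m_assoc)
  qed
qed

text \<open>
  If \<open>q (\<pi> c)\<close> has degree \<open>d\<close> in the entries of the bijection \<open>\<pi>\<close>, then \<open>q\<close> has degree \<open>d\<close>:
  the divided difference of \<open>q (\<pi> c)\<close> along the swap of \<open>c\<close> and \<open>c'\<close> has degree \<open>d - 1\<close>, and
  with \<open>\<pi> c'\<close> frozen to \<open>b\<close> it is the quotient \<open>(q x - q b) / (x - b)\<close> at \<open>x = \<pi> c\<close>.
\<close>

lemma polyf_of_bijs:
  fixes B :: "'a set" and Z :: "'z set" and A :: "'c set"
  assumes "finite A" "finite B" "card A = card B" "c \<in> A" and B: "B \<subseteq> carrier R"
    and CZ: "CZ \<subseteq> Z \<rightarrow> carrier R"
    and "polyf (split_coords (coords A) CZ) (bijs A B \<times> Z) d (\<lambda>(\<pi>, z). q (\<pi> c) z)"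
  shows "polyf (split_coords {\<lambda>x. x} CZ) (B \<times> Z) d (\<lambda>(x, z). q x z)"
  using assms(1-5,7)
proof (induction "card B" arbitrary: A B c d q rule: less_induct)
  case less
  note fin = less.prems(1,2) and card = less.prems(3) and cA = less.prems(4) and Bc = less.prems(5) and q = less.prems(6)
  let ?C = "split_coords (coords A) CZ" and ?D = "bijs A B \<times> Z"
  let ?C' = "split_coords {\<lambda>x. x} CZ :: ('a \<times> 'z \<Rightarrow> 'a) set" and ?D' = "B \<times> Z"
  have coordsA: "coords A' \<subseteq> bijs A' B' \<rightarrow> carrier R" if "B' \<subseteq> carrier R" for A' :: "'c set" and B'
    using that by (auto simp: coords_def bijs_mem dest!: bijs_mem)
  have C: "?C \<subseteq> ?D \<rightarrow> carrier R" by (intro split_coords_closed coordsA Bc CZ)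
  have C': "?C' \<subseteq> B' \<times> Z \<rightarrow> carrier R" if "B' \<subseteq> carrier R" for B' using that by (intro split_coords_closed CZ) auto
  \<comment> \<open>Freezing the entire bijection at one with \<open>\<pi> c = b\<close> leaves only
    the dependence on \<open>z\<close>.\<close>
  have qb: "polyf ?C' ?D' d (\<lambda>(x, z). q b z)" if b: "b \<in> B" for b
  proof -
    obtain \<pi> where \<pi>: "\<pi> \<in> bijs A B" "\<pi> c = b" using exists_bijs[OF fin card cA b] by blast
    have "polyf ?C' ?D' d (\<lambda>p. (\<lambda>(\<pi>, z). q (\<pi> c) z) (\<pi>, snd p))"
    proof (rule polyf_subst[OF q _ _ C'[OF Bc]])
      fix h assume "h \<in> ?C"
      then show "(\<exists>h'\<in>?C'. \<forall>p\<in>?D'. h (\<pi>, snd p) = h' p) \<or> (\<exists>a\<in>carrier R. \<forall>p\<in>?D'. h (\<pi>, snd p) = a)"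
      proof (cases rule: split_coords_cases)
        case (1 g)
        then obtain l where "l \<in> A" "h = (\<lambda>p. fst p l)" by (auto elim!: coords_cases)
        then show ?thesis using bijs_mem[OF \<pi>(1)] Bc by auto
      next
        case (2 g)
        then have "(\<lambda>p. g (snd p)) \<in> ?C'" by (intro split_coordsI)
        then show ?thesis using 2 by (intro disjI1) (rule bexI, auto)
      qed
    qed (use \<pi> in auto)
    then show ?thesis by (rule polyf_ext) (auto simp: \<pi>)
  qed
  obtain b where b: "b \<in> B" using card cA fin by (metis card_eq_0_iff empty_iff equals0I)
  show ?case
  proof (cases "A = {c}")
    case True
    then have "card B = 1" using card by simp
    then have "B = {b}" using b by (metis card_1_singletonE singletonD)
    then show ?thesis using qb[OF b] by (auto intro: polyf_ext)
  next
    case False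
    then obtain c' where c': "c' \<in> A" "c' \<noteq> c" using cA by blast
    show ?thesis
    proof (cases d)
      case 0
      then obtain a where a: "a \<in> carrier R" "\<forall>p\<in>?D. (\<lambda>(\<pi>, z). q (\<pi> c) z) p = a" using polyf_0_const[OF q] by blast
      have "q x z = a" if "x \<in> B" "z \<in> Z" for x z
        using exists_bijs[OF fin card cA that(1)] a(2) that(2) by fastforce
      then show ?thesis by (intro polyf_ext[OF polyf_const[OF a(1)]]) auto
    next
      case (Suc k)
      let ?f = "\<lambda>(\<pi>, z). q (\<pi> c) z"
      define s where "s p = ((fst p)(c := fst p c', c' := fst p c), snd p :: 'z)" for p :: "('c \<Rightarrow> 'a) \<times> 'z"
      define e where "e p = fst p c \<ominus> fst p c'" for p :: "('c \<Rightarrow> 'a) \<times> 'z"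
      have dd: "polyf ?C ?D k (\<lambda>p. (?f p \<ominus> ?f (s p)) \<otimes> inv e p)"
      proof (rule polyf_divided_difference[OF q C _ _ _ _ Suc])
        show "s p \<in> ?D" if "p \<in> ?D" for p
          using that bijs_swap[OF _ cA c'(1)] by (auto simp: s_def)
        show "e p \<in> carrier R - {\<zero>}" if "p \<in> ?D" for p
        proof -
          have "fst p c \<noteq> fst p c'" using that c' cA by (auto simp: bijs_def bij_betw_def inj_on_def)
          moreover have "fst p c \<in> carrier R" "fst p c' \<in> carrier R" using that c' cA Bc bijs_mem by fastforce+
          ultimately show ?thesis by (simp add: e_def)
        qed
        fix h assume h: "h \<in> ?C"
        show "\<exists>h'\<in>?C. \<forall>p\<in>?D. h (s p) = h' p"
          using h
        proof (cases rule: split_coords_cases)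
          case (1 g)
          then obtain l where l: "l \<in> A" "h = (\<lambda>p. fst p l)" by (auto elim!: coords_cases)
          then have "(\<lambda>p. (fst p :: 'c \<Rightarrow> 'a) (Transposition.transpose c c' l)) \<in> ?C"
            using cA c' by (intro split_coordsI coordsI) (auto simp: Transposition.transpose_def)
          then show ?thesis using l by (rule_tac bexI) (auto simp: s_def Transposition.transpose_def)
        next
          case (2 g)
          then show ?thesis using h by (intro bexI[of _ h]) (auto simp: s_def)
        qed
        show "\<exists>a\<in>carrier R. \<forall>p\<in>?D. h p \<ominus> h (s p) = a \<otimes> e p"
        proof -
          consider l where "l \<in> A" "h = (\<lambda>p. fst p l)" | g where "g \<in> CZ" "h = (\<lambda>p. g (snd p))"
            using h by (auto simp: split_coords_def coords_def)
          then show ?thesis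
          proof cases
            case 1
            have cl: "fst p l' \<in> carrier R" if "p \<in> ?D" "l' \<in> A" for p l'
              using that Bc bijs_mem by fastforce
            consider "l = c" | "l = c'" | "l \<noteq> c" "l \<noteq> c'" by blast
            then show ?thesis
            proof cases
              assume l: "l = c"
              show ?thesis using cl[OF _ cA] cl[OF _ c'(1)] c'
                by (intro bexI[of _ \<one>]) (auto simp: 1 l s_def e_def)
            next
              assume l: "l = c'"
              show ?thesis using cl[OF _ cA] cl[OF _ c'(1)]
                by (intro bexI[of _ "\<ominus> \<one>"]) (auto simp: 1 l s_def e_def minus_eq l_minus minus_add a_comm)
            next
              assume l: "l \<noteq> c" "l \<noteq> c'"
              show ?thesis using cl[OF _ cA] cl[OF _ c'(1)] cl[OF _ 1(1)] l
                by (intro bexI[of _ \<zero>]) (auto simp: 1 s_def e_def minus_eq r_neg)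
            qed
          next
            case 2
            have "g z \<in> carrier R" if "z \<in> Z" for z using CZ 2(1) that by blast
            moreover have "fst p c \<in> carrier R" "fst p c' \<in> carrier R" if "p \<in> ?D" for p
              using that c' cA Bc bijs_mem by fastforce+
            ultimately show ?thesis
              by (intro bexI[of _ \<zero>]) (auto simp: 2 s_def e_def minus_eq r_neg)
          qed
        qed
      qed
      define q' where "q' x z = (q x z \<ominus> q b z) \<otimes> inv (x \<ominus> b)" for x z
      let ?A1 = "A - {c'}" and ?B1 = "B - {b}"
      have cA1: "c \<in> ?A1" using cA c' by auto
      \<comment> \<open>With \<open>\<pi> c' = b\<close> fixed, the rest is an arbitrary bijection
        between the smaller sets, and the quotient depends on it only through
        \<open>\<pi> c\<close>.\<close>
      have "polyf (split_coords (coords ?A1) CZ) (bijs ?A1 ?B1 \<times> Z) k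
          (\<lambda>p. (\<lambda>p. (?f p \<ominus> ?f (s p)) \<otimes> inv e p) ((fst p)(c' := b), snd p))"
      proof (rule polyf_subst[OF dd])
        show "((fst p)(c' := b), snd p) \<in> ?D" if "p \<in> bijs ?A1 ?B1 \<times> Z" for p
          using that bijs_upd[OF _ c'(1) b] by auto
        show "split_coords (coords ?A1) CZ \<subseteq> bijs ?A1 ?B1 \<times> Z \<rightarrow> carrier R"
          using Bc by (intro split_coords_closed coordsA CZ) auto
        fix h assume "h \<in> ?C"
        then show "(\<exists>h'\<in>split_coords (coords ?A1) CZ. \<forall>p\<in>bijs ?A1 ?B1 \<times> Z. h ((fst p)(c' := b), snd p) = h' p)
          \<or> (\<exists>a\<in>carrier R. \<forall>p\<in>bijs ?A1 ?B1 \<times> Z. h ((fst p)(c' := b), snd p) = a)"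
        proof (cases rule: split_coords_cases)
          case (1 g)
          then obtain l where l: "l \<in> A" "h = (\<lambda>p. fst p l)" by (auto elim!: coords_cases)
          show ?thesis
          proof (cases "l = c'")
            case True
            then show ?thesis using l b Bc by auto
          next
            case False
            then have "h \<in> split_coords (coords ?A1) CZ" using l by (auto intro: split_coordsI(1)[OF coordsI])
            then show ?thesis using False l by (intro disjI1 bexI[of _ h]) auto
          qed
        next
          case (2 g)
          then show ?thesis by (intro disjI1 bexI[of _ h]) (auto intro: split_coordsI)
        qed
      qed
      then have "polyf (split_coords (coords ?A1) CZ) (bijs ?A1 ?B1 \<times> Z) k (\<lambda>(\<pi>, z). q' (\<pi> c) z)"
        by (rule polyf_ext) (use c' in \<open>auto simp: q'_def s_def e_def\<close>)
      moreover have "card ?B1 < card B" "card ?A1 = card ?B1"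
        using card_Diff1_less[OF fin(2) b] b c' fin card by simp_all
      ultimately have "polyf ?C' (?B1 \<times> Z) k (\<lambda>(x, z). q' x z)"
        using less.hyps[of ?B1 ?A1 c k q'] fin cA1 Bc by auto
      \<comment> \<open>The quotient is known only for \<open>x \<noteq> b\<close>. Any extension
        suffices, because in \<open>(x - b) * g + q b\<close> it is multiplied by zero at
        \<open>x = b\<close>.\<close>
      from polyf_extend[OF this, of ?D'] obtain g where g: "polyf ?C' ?D' k g" "\<forall>p\<in>?B1 \<times> Z. g p = (\<lambda>(x, z). q' x z) p" by blast
      have "(\<lambda>p. fst p) \<in> ?C'" by (auto simp: split_coords_def)
      then have g1: "polyf ?C' ?D' d (\<lambda>p. fst p \<otimes> g p)" unfolding Suc by (rule polyf_mult[OF _ g(1)])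
      have g2: "polyf ?C' ?D' d (\<lambda>p. b \<otimes> g p)"
        by (rule polyf_cmult[OF polyf_mono[OF g(1)] C'[OF Bc]]) (use Bc b Suc in auto)
      show ?thesis
      proof (rule polyf_ext[OF polyf_add[OF polyf_minus[OF g1 g2 C'[OF Bc]] qb[OF b]]])
        fix p assume p: "p \<in> ?D'"
        obtain x z where xz: "p = (x, z)" by (cases p)
        have xc: "x \<in> carrier R" "b \<in> carrier R" "g (x, z) \<in> carrier R"
          using p xz b Bc polyf_closed[OF g(1) C'[OF Bc]] by auto
        have qc: "q y z \<in> carrier R" if "y \<in> B" for y
          using exists_bijs[OF fin card cA that] polyf_closed[OF q C] p xz by fastforce
        have lin: "x \<otimes> g (x, z) \<ominus> b \<otimes> g (x, z) = (x \<ominus> b) \<otimes> g (x, z)"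
          using xc by (simp add: minus_eq l_distr l_minus)
        show "(\<lambda>(x, z). q x z) p = (fst p \<otimes> g p \<ominus> b \<otimes> g p) \<oplus> (\<lambda>(x, z). q b z) p"
        proof (cases "x = b")
          case True
          then show ?thesis using qc[OF b] xc by (simp add: xz lin r_neg minus_eq)
        next
          case False
          then have "x \<ominus> b \<noteq> \<zero>" "x \<ominus> b \<in> carrier R" using xc by auto
          then have u: "x \<ominus> b \<in> Units R" by (simp add: field_Units)
          have "g (x, z) = (q x z \<ominus> q b z) \<otimes> inv (x \<ominus> b)"
            using g(2) p xz False by (auto simp: q'_def)
          then have "(x \<ominus> b) \<otimes> g (x, z) = (q x z \<ominus> q b z) \<otimes> ((x \<ominus> b) \<otimes> inv (x \<ominus> b))"
            using qc[OF b] qc[of x] p xz xc u m_lcomm[of "x \<ominus> b" "q x z \<ominus> q b z" "inv (x \<ominus> b)"] by simp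
          also have "\<dots> = q x z \<ominus> q b z" using u qc[OF b] qc[of x] p xz by simp
          finally have "x \<otimes> g (x, z) \<ominus> b \<otimes> g (x, z) = q x z \<ominus> q b z" by (simp only: lin)
          moreover have "q x z = q x z \<ominus> q b z \<oplus> q b z"
            using qc[OF b] qc[of x] p xz by (simp add: minus_eq a_assoc l_neg)
          ultimately show ?thesis by (simp add: xz)
        qed
      qed
    qed
  qed
qed

end

section \<open>Junta-degree and random colourings\<close>

lemma mix_insert:
  "l \<notin> L \<Longrightarrow> mix (insert l L) C (x(l := a)) (y(l := b)) = (mix L C x y)(l := if l \<in> C then a else b)"
  by (auto simp: mix_def fun_eq_iff)

lemma mix_insert_set: "l \<in> L \<Longrightarrow> l \<notin> C \<Longrightarrow> mix L (insert l C) x y = mix L C x (y(l := x l))"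
  by (auto simp: mix_def fun_eq_iff)

lemma pmap_mix: "pmap L h (mix L C x y) = mix L C (pmap L h x) (pmap L h y)"
  by (auto simp: mix_def pmap_def fun_eq_iff)

definition word_coords :: "'j set \<Rightarrow> 'c set \<Rightarrow> (('j \<Rightarrow> 'c \<Rightarrow> 'a) \<Rightarrow> 'a) set"
  where "word_coords J A = (\<lambda>(j, c) w. w j c) ` (J \<times> A)"

lemma word_coordsI: "j \<in> J \<Longrightarrow> c \<in> A \<Longrightarrow> (\<lambda>w. w j c) \<in> word_coords J A"
  by (force simp: word_coords_def)

lemma word_coords_cases:
  assumes "h \<in> word_coords J A" obtains j c where "j \<in> J" "c \<in> A" "h = (\<lambda>w. w j c)"
  using assms by (auto simp: word_coords_def)

abbreviation words :: "'j set \<Rightarrow> 'a set \<Rightarrow> ('j \<Rightarrow> 'a \<Rightarrow> 'a) set"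
  where "words J S \<equiv> PiE J (\<lambda>_. bijs S S)"

text \<open>The letter at a coordinate of colour \<open>j\<close> passes through the permutation
  \<open>w j\<close>. Colour 0 leaves it alone, so coordinates can be frozen while \<open>w\<close>
  varies.\<close>

definition word_point :: "'l set \<Rightarrow> (nat \<Rightarrow> 'a \<Rightarrow> 'a) \<Rightarrow> ('l \<Rightarrow> 'a \<times> nat) \<Rightarrow> 'l \<Rightarrow> 'a"
  where "word_point L w = pmap L (\<lambda>(u, j). if j = 0 then u else w j u)"

context cring
begin

text \<open>Since the empty cube is allowed, junta-degree at most \<open>d\<close> is \<open>cube_free (Suc d)\<close>.\<close>

definition cube_free :: "nat \<Rightarrow> 'l set \<Rightarrow> 's set \<Rightarrow> (('l \<Rightarrow> 's) \<Rightarrow> 'a) \<Rightarrow> bool"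
  where "cube_free d L S g \<longleftrightarrow> (\<forall>x\<in>PiE L (\<lambda>_. S). \<forall>y\<in>PiE L (\<lambda>_. S). \<forall>B\<subseteq>L. card B = d \<longrightarrow>
    cube_sum (\<lambda>C. g (mix L C x y)) B = \<zero>)"

lemma cube_freeD:
  "cube_free d L S g \<Longrightarrow> x \<in> PiE L (\<lambda>_. S) \<Longrightarrow> y \<in> PiE L (\<lambda>_. S) \<Longrightarrow> B \<subseteq> L \<Longrightarrow> card B = d \<Longrightarrow>
    cube_sum (\<lambda>C. g (mix L C x y)) B = \<zero>"
  unfolding cube_free_def by blast

text \<open>A larger cube is a difference of two parallel faces; the face that contains
  \<open>b\<close> is the smaller cube for \<open>y(b := x b)\<close>.\<close>

lemma cube_free_Suc:
  assumes L: "finite L" and g: "g \<in> PiE L (\<lambda>_. S) \<rightarrow> carrier R" and c: "cube_free d L S g"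
  shows "cube_free (Suc d) L S g"
  unfolding cube_free_def
proof (intro ballI allI impI)
  fix x y B assume xy: "x \<in> PiE L (\<lambda>_. S)" "y \<in> PiE L (\<lambda>_. S)" and B: "B \<subseteq> L" "card B = Suc d"
  then obtain b B' where b: "B = insert b B'" "b \<notin> B'" "card B' = d" by (auto simp: card_Suc_eq)
  have gc: "g (mix L C x y) \<in> carrier R" if "x \<in> PiE L (\<lambda>_. S)" "y \<in> PiE L (\<lambda>_. S)" for C x y
    using g mix_closed[OF that] by auto
  have y': "y(b := x b) \<in> PiE L (\<lambda>_. S)" using xy B b by (auto simp: PiE_iff extensional_def)
  have fin: "finite B'" using finite_subset[OF B(1) L] b(1) by simp
  have "cube_sum (\<lambda>C. g (mix L C x y)) B = cube_sum (\<lambda>C. g (mix L (insert b C) x y)) B' \<ominus> cube_sum (\<lambda>C. g (mix L C x y)) B'"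
    unfolding b(1) using fin b(2) gc xy by (intro cube_sum_insert) auto
  also have "cube_sum (\<lambda>C. g (mix L (insert b C) x y)) B' = cube_sum (\<lambda>C. g (mix L C x (y(b := x b)))) B'"
  proof (rule cube_sum_cong)
    fix C assume "C \<subseteq> B'"
    then have "mix L (insert b C) x y = mix L C x (y(b := x b))" using b B by (intro mix_insert_set) auto
    then show "g (mix L (insert b C) x y) = g (mix L C x (y(b := x b)))" by simp
  qed (use gc xy y' in auto)
  also have "\<dots> = \<zero>" using c xy y' B b by (intro cube_freeD) auto
  also have "cube_sum (\<lambda>C. g (mix L C x y)) B' = \<zero>" using c xy B b by (intro cube_freeD) auto
  finally show "cube_sum (\<lambda>C. g (mix L C x y)) B = \<zero>" by (simp add: minus_eq)
qed

lemma cube_free_mono: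
  assumes "finite L" "g \<in> PiE L (\<lambda>_. S) \<rightarrow> carrier R" "cube_free d L S g" "d \<le> e"
  shows "cube_free e L S g"
  using assms(4) by (induction rule: dec_induct) (rule assms(3), rule cube_free_Suc[OF assms(1,2)])

lemma cube_free_pmap:
  assumes c: "cube_free d L S g" and h: "\<And>a. a \<in> A \<Longrightarrow> h a \<in> S"
  shows "cube_free d L A (\<lambda>x. g (pmap L h x))"
  unfolding cube_free_def pmap_mix
  using h by (intro ballI allI impI cube_freeD[OF c]) (auto simp: pmap_def PiE_iff)

text \<open>Being nonzero is replaced by lying outside an additive subgroup \<open>P\<close> of
  functions of \<open>w\<close>. If every slice at \<open>l\<close> leaves \<open>P\<close>, the
  bound is averaged over the slices. Otherwise some slice stays in \<open>P\<close>; subtracting it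
  from another slice lowers the junta-degree by one, at the cost of one factor
  \<open>card S\<close>.\<close>

lemma junta_Schwartz_Zippel:
  fixes g :: "('l \<Rightarrow> 's) \<Rightarrow> 'w \<Rightarrow> 'a"
  assumes L: "finite L" and S: "finite S" "S \<noteq> {}"
    and g: "\<And>x w. x \<in> PiE L (\<lambda>_. S) \<Longrightarrow> w \<in> W \<Longrightarrow> g x w \<in> carrier R"
    and c: "\<And>w. w \<in> W \<Longrightarrow> cube_free (Suc d) L S (\<lambda>x. g x w)"
    and add: "\<And>u v. P u \<Longrightarrow> P v \<Longrightarrow> P (\<lambda>w. u w \<oplus> v w)" and minus: "\<And>u v. P u \<Longrightarrow> P v \<Longrightarrow> P (\<lambda>w. u w \<ominus> v w)"
    and zero: "P (\<lambda>_. \<zero>)" and ext: "\<And>u v. P u \<Longrightarrow> (\<And>w. w \<in> W \<Longrightarrow> v w = u w) \<Longrightarrow> P v"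
    and x0: "x0 \<in> PiE L (\<lambda>_. S)" "\<not> P (g x0)"
  shows "1 \<le> real (card S) ^ d * avg (PiE L (\<lambda>_. S)) (\<lambda>x. of_bool (\<not> P (g x)))"
  using L g c x0
proof (induction L arbitrary: d g x0)
  case empty
  have "1 \<le> real (card S) ^ d" using S by (intro one_le_power) (auto simp: card_gt_0_iff Suc_le_eq)
  then show ?case using empty by simp
next
  case (insert l L)
  let ?G = "PiE L (\<lambda>_. S)"
  define F where "F a = avg ?G (\<lambda>x. of_bool (\<not> P (g (x(l := a)))))" for a
  have F0: "0 \<le> F a" for a by (simp add: F_def avg_nonneg)
  have avgF: "avg (PiE (insert l L) (\<lambda>_. S)) (\<lambda>x. of_bool (\<not> P (g x))) = avg S F"
    using insert.hyps by (simp add: avg_PiE_insert F_def[abs_def])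
  have cS: "1 \<le> real (card S)" using S by (auto simp: card_gt_0_iff Suc_le_eq)
  have gc: "g (x(l := a)) w \<in> carrier R" if "x \<in> ?G" "a \<in> S" "w \<in> W" for x a w
    using insert.prems(1) PiE_upd[OF that(1,2)] that(3) by blast
  have slice: "cube_free (Suc d) L S (\<lambda>x. g (x(l := a)) w)" if "a \<in> S" "w \<in> W" for a w
    unfolding cube_free_def
  proof (intro ballI allI impI)
    fix x y B assume xy: "x \<in> ?G" "y \<in> ?G" and B: "B \<subseteq> L" "card B = Suc d"
    have "cube_sum (\<lambda>C. g (mix (insert l L) C (x(l := a)) (y(l := a))) w) B = \<zero>"
      using B xy that by (intro cube_freeD[OF insert.prems(2)] PiE_upd) auto
    then show "cube_sum (\<lambda>C. g ((mix L C x y)(l := a)) w) B = \<zero>"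
      using insert.hyps(2) by (simp add: mix_insert)
  qed
  show ?case
  proof (cases "\<forall>a\<in>S. \<exists>x\<in>?G. \<not> P (g (x(l := a)))")
    case True
    have "1 \<le> real (card S) ^ d * F a" if "a \<in> S" for a
    proof -
      obtain x where "x \<in> ?G" "\<not> P (g (x(l := a)))" using True \<open>a \<in> S\<close> by blast
      then show ?thesis
        using insert.IH[of "\<lambda>x. g (x(l := a))" d x] slice[OF that] gc[OF _ that] by (simp add: F_def)
    qed
    then have "avg S (\<lambda>_. 1) \<le> avg S (\<lambda>a. real (card S) ^ d * F a)" by (intro avg_mono)
    then show ?thesis using S by (simp add: avg_const avg_cmult avgF)
  next
    case False
    then obtain a0 where a0: "a0 \<in> S" "\<And>x. x \<in> ?G \<Longrightarrow> P (g (x(l := a0)))" by blast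
    define a1 where "a1 = x0 l"
    define x1 where "x1 = restrict x0 L"
    have x1: "x1 \<in> ?G" "a1 \<in> S" "x1(l := a1) = x0"
      using insert.prems(3) insert.hyps(2) by (auto simp: x1_def a1_def PiE_iff fun_eq_iff extensional_def)
    \<comment> \<open>Since the slice at \<open>a0\<close> lies in \<open>P\<close>,
      \<open>D x\<close> is in \<open>P\<close> exactly when the slice at \<open>a1\<close>
      is.\<close>
    define D where "D x w = g (x(l := a1)) w \<ominus> g (x(l := a0)) w" for x w
    have Dc: "D x w \<in> carrier R" if "x \<in> ?G" "w \<in> W" for x w
      using gc that x1(2) a0(1) by (simp add: D_def)
    have PD: "P (D x) \<longleftrightarrow> P (g (x(l := a1)))" if "x \<in> ?G" for x
    proof
      assume "P (D x)"
      from add[OF this a0(2)[OF that]] show "P (g (x(l := a1)))"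
        by (rule ext) (use gc that x1(2) a0(1) in \<open>simp add: D_def minus_eq a_assoc l_neg\<close>)
    next
      assume "P (g (x(l := a1)))"
      from minus[OF this a0(2)[OF that]] show "P (D x)" by (rule ext) (simp add: D_def)
    qed
    have Dfree: "cube_free d L S (\<lambda>x. D x w)" if w: "w \<in> W" for w
      unfolding cube_free_def
    proof (intro ballI allI impI)
      fix x y B assume xy: "x \<in> ?G" "y \<in> ?G" and B: "B \<subseteq> L" "card B = d"
      have fB: "finite B" "l \<notin> B" using finite_subset[OF B(1) insert.hyps(1)] B(1) insert.hyps(2) by auto
      have mc: "mix L C x y \<in> ?G" for C using xy by (rule mix_closed)
      let ?h = "\<lambda>C. g (mix (insert l L) C (x(l := a1)) (y(l := a0))) w"
      have h: "?h C = g ((mix L C x y)(l := if l \<in> C then a1 else a0)) w" for C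
        using insert.hyps(2) by (simp add: mix_insert)
      have hc: "?h C \<in> carrier R" for C unfolding h using gc[OF mc] x1(2) a0(1) w by simp
      have "\<zero> = cube_sum ?h (insert l B)"
        using B xy x1(2) a0(1) w fB by (intro cube_freeD[OF insert.prems(2), symmetric] PiE_upd) auto
      also have "\<dots> = cube_sum (\<lambda>C. ?h (insert l C)) B \<ominus> cube_sum ?h B" using fB hc by (intro cube_sum_insert) auto
      also have "cube_sum (\<lambda>C. ?h (insert l C)) B = cube_sum (\<lambda>C. g ((mix L C x y)(l := a1)) w) B"
      proof (rule cube_sum_cong)
        fix C assume "C \<subseteq> B"
        have "mix L (insert l C) x y = mix L C x y"
          using insert.hyps(2) by (auto simp: mix_def fun_eq_iff)
        then show "?h (insert l C) = g ((mix L C x y)(l := a1)) w" by (simp add: h)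
      qed (use gc[OF mc] x1(2) w in auto)
      also have "cube_sum ?h B = cube_sum (\<lambda>C. g ((mix L C x y)(l := a0)) w) B"
        using fB(2) gc[OF mc] a0(1) w by (intro cube_sum_cong) (auto simp: h)
      also have "cube_sum (\<lambda>C. g ((mix L C x y)(l := a1)) w) B \<ominus> cube_sum (\<lambda>C. g ((mix L C x y)(l := a0)) w) B
          = cube_sum (\<lambda>C. D (mix L C x y) w) B"
        unfolding D_def using gc[OF mc] x1(2) a0(1) w fB by (intro cube_sum_minus[symmetric]) auto
      finally show "cube_sum (\<lambda>C. D (mix L C x y) w) B = \<zero>" by simp
    qed
    have nP: "\<not> P (D x1)" using PD[OF x1(1)] x1(3) insert.prems(4) by simp
    show ?thesis
    proof (cases d)
      \<comment> \<open>The empty cube forces \<open>D x1\<close> to vanish, so it lies in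
        \<open>P\<close>; the case is contradictory.\<close>
      case 0
      have "D x1 w = \<zero>" if "w \<in> W" for w
      proof -
        have "cube_sum (\<lambda>C. D (mix L C x1 x1) w) {} = \<zero>"
          using Dfree[OF that] x1(1) 0 by (intro cube_freeD) auto
        moreover have "mix L {} x1 x1 = x1" using x1(1) by (auto simp: mix_def fun_eq_iff PiE_iff extensional_def)
        ultimately show ?thesis using Dc[OF x1(1) that] by (simp add: cube_sum_empty)
      qed
      then have "P (D x1)" by (intro ext[OF zero])
      then show ?thesis using nP by simp
    next
      case (Suc e)
      have "1 \<le> real (card S) ^ e * avg ?G (\<lambda>x. of_bool (\<not> P (D x)))"
        using Dc Dfree x1(1) nP unfolding Suc by (intro insert.IH[of D e x1]) auto
      also have "avg ?G (\<lambda>x. of_bool (\<not> P (D x))) = F a1"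
        unfolding F_def by (intro avg_cong) (simp add: PD)
      also have "F a1 \<le> real (card S) * avg S F"
      proof -
        have "F a1 \<le> (\<Sum>a\<in>S. F a)" using S x1(2) F0 by (intro member_le_sum) auto
        then show ?thesis using cS by (simp add: avg_def)
      qed
      finally show ?thesis unfolding avgF Suc using cS by (simp add: mult_left_mono mult.assoc mult.left_commute)
    qed
  qed
qed

end

context field
begin

text \<open>The colours in \<open>J1\<close> still carry permutations, those in \<open>J2\<close>
  plain variables. One colour at a time moves across by \<open>polyf_of_bijs\<close>, with all other
  variables as parameters.\<close>

lemma polyf_of_words_aux:
  fixes J1 J2 :: "'j set" and q :: "('j \<Rightarrow> 'a) \<Rightarrow> 'a"
  assumes "finite J1" and S: "finite S" "S \<subseteq> carrier R" and a0: "a0 \<in> S"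
    and "J1 \<inter> J2 = {}"
    and "polyf (split_coords (word_coords J1 S) (coords J2)) (words J1 S \<times> PiE J2 (\<lambda>_. S)) d
      (\<lambda>(w, z). q (\<lambda>j. if j \<in> J1 then w j a0 else z j))"
  shows "polyf (coords (J1 \<union> J2)) (PiE (J1 \<union> J2) (\<lambda>_. S)) d q"
  using assms(1,5,6)
proof (induction J1 arbitrary: J2)
  case empty
  have "polyf (coords J2) (PiE J2 (\<lambda>_. S)) d (\<lambda>z. (\<lambda>(w, z). q (\<lambda>j. if j \<in> {} then w j a0 else z j)) (\<lambda>_. undefined :: 'a \<Rightarrow> 'a, z))"
  proof (rule polyf_subst[OF empty.prems(2) _ _ coords_closed[OF S(2)]])
    fix h :: "_ \<Rightarrow> 'a" assume "h \<in> split_coords (word_coords {} S) (coords J2)"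
    then show "(\<exists>h'\<in>coords J2. \<forall>z\<in>PiE J2 (\<lambda>_. S). h (\<lambda>_. undefined, z) = h' z) \<or>
      (\<exists>a\<in>carrier R. \<forall>z\<in>PiE J2 (\<lambda>_. S). h (\<lambda>_. undefined, z) = a)"
      by (cases rule: split_coords_cases) (auto simp: word_coords_def)
  qed auto
  then show ?case by simp
next
  case (insert j J1)
  let ?D = "words J1 S \<times> PiE J2 (\<lambda>_. S)" and ?C = "split_coords (word_coords J1 S) (coords J2)"
  let ?D' = "words J1 S \<times> PiE (insert j J2) (\<lambda>_. S)" and ?C' = "split_coords (word_coords J1 S) (coords (insert j J2))"
  have wc: "word_coords J S \<subseteq> words J S \<rightarrow> carrier R" for J :: "'j set"
    using S(2) bijs_mem by (fastforce simp: word_coords_def)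
  have C: "?C \<subseteq> ?D \<rightarrow> carrier R" by (intro split_coords_closed wc coords_closed S)
  have sc: "split_coords (coords S) ?C \<subseteq> bijs S S \<times> ?D \<rightarrow> carrier R"
  proof (rule split_coords_closed[OF _ C])
    show "coords S \<subseteq> bijs S S \<rightarrow> carrier R"
    proof (intro subsetI Pi_I)
      fix h :: "_ \<Rightarrow> 'a" and p assume "h \<in> coords S" "p \<in> bijs S S"
      then show "h p \<in> carrier R"
        by (elim coords_cases) (simp add: bijs_mem subsetD[OF S(2)])
    qed
  qed
  define q' where "q' x p = q (\<lambda>i. if i = j then x else if i \<in> J1 then fst p i a0 else snd p i)"
    for x and p :: "('j \<Rightarrow> 'a \<Rightarrow> 'a) \<times> ('j \<Rightarrow> 'a)"
  define f where "f p = q (\<lambda>i. if i \<in> insert j J1 then fst p i a0 else snd p i)"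
    for p :: "('j \<Rightarrow> 'a \<Rightarrow> 'a) \<times> ('j \<Rightarrow> 'a)"
  define s where "s p = ((fst (snd p))(j := fst p), snd (snd p))"
    for p :: "('a \<Rightarrow> 'a) \<times> ('j \<Rightarrow> 'a \<Rightarrow> 'a) \<times> ('j \<Rightarrow> 'a)"
  have f: "polyf (split_coords (word_coords (insert j J1) S) (coords J2)) (words (insert j J1) S \<times> PiE J2 (\<lambda>_. S)) d f"
    using insert.prems(2) unfolding f_def[abs_def] case_prod_unfold .
  have "polyf (split_coords (coords S) ?C) (bijs S S \<times> ?D) d (\<lambda>p. f (s p))"
  proof (rule polyf_subst[OF f _ _ sc])
    show "s p \<in> words (insert j J1) S \<times> PiE J2 (\<lambda>_. S)" if "p \<in> bijs S S \<times> ?D" for p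
      using that PiE_upd[of "fst (snd p)" J1 "bijs S S" "fst p" j] by (auto simp: s_def mem_Times_iff)
    fix h :: "_ \<Rightarrow> 'a" assume "h \<in> split_coords (word_coords (insert j J1) S) (coords J2)"
    then have "\<exists>h'\<in>split_coords (coords S) ?C. \<forall>p\<in>bijs S S \<times> ?D. h (s p) = h' p"
    proof (cases rule: split_coords_cases)
      case (1 g)
      then obtain i c where ic: "i \<in> insert j J1" "c \<in> S" "h = (\<lambda>p. fst p i c)" by (auto elim!: word_coords_cases)
      show ?thesis
      proof (cases "i = j")
        case True
        have "(\<lambda>p. fst p c) \<in> split_coords (coords S) ?C" by (intro split_coordsI coordsI ic)
        then show ?thesis by (rule bexI[rotated]) (simp add: ic True s_def)
      next
        case False
        have "(\<lambda>p. (\<lambda>p. fst p i c) (snd p)) \<in> split_coords (coords S) ?C"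
          using ic False by (intro split_coordsI(2) split_coordsI(1)[of "\<lambda>w. w i c"] word_coordsI) auto
        then show ?thesis by (rule bexI[rotated]) (simp add: ic False s_def)
      qed
    next
      case (2 g)
      then have "(\<lambda>p. (\<lambda>p. g (snd p)) (snd p)) \<in> split_coords (coords S) ?C" by (intro split_coordsI)
      then show ?thesis by (rule bexI[rotated]) (simp add: 2 s_def)
    qed
    then show "(\<exists>h'\<in>split_coords (coords S) ?C. \<forall>p\<in>bijs S S \<times> ?D. h (s p) = h' p)
      \<or> (\<exists>a\<in>carrier R. \<forall>p\<in>bijs S S \<times> ?D. h (s p) = a)" ..
  qed
  then have "polyf (split_coords (coords S) ?C) (bijs S S \<times> ?D) d (\<lambda>(\<pi>, wz). q' (\<pi> a0) wz)"
  proof (rule polyf_ext)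
    fix p assume "p \<in> bijs S S \<times> ?D"
    have "(\<lambda>i. if i \<in> insert j J1 then fst (s p) i a0 else snd (s p) i)
      = (\<lambda>i. if i = j then fst p a0 else if i \<in> J1 then fst (snd p) i a0 else snd (snd p) i)"
      by (auto simp: s_def)
    then show "(\<lambda>(\<pi>, wz). q' (\<pi> a0) wz) p = f (s p)"
      by (simp add: q'_def f_def case_prod_unfold)
  qed
  then have "polyf (split_coords {\<lambda>x. x} ?C) (S \<times> ?D) d (\<lambda>(x, wz). q' x wz)"
    by (rule polyf_of_bijs[OF S(1) S(1) refl a0 S(2) C])
  then have "polyf ?C' ?D' d (\<lambda>p. (\<lambda>(x, wz). q' x wz) (snd p j, (fst p, restrict (snd p) J2)))"
  proof (rule polyf_subst)
    show "?C' \<subseteq> ?D' \<rightarrow> carrier R" by (intro split_coords_closed wc coords_closed S)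
    fix h :: "_ \<Rightarrow> 'a" assume "h \<in> split_coords {\<lambda>x. x} ?C"
    then have "\<exists>h'\<in>?C'. \<forall>p\<in>?D'. h (snd p j, fst p, restrict (snd p) J2) = h' p"
    proof (cases rule: split_coords_cases)
      case (1 g)
      have "(\<lambda>p. snd p j) \<in> ?C'" by (intro split_coordsI coordsI) auto
      then show ?thesis using 1 by (intro bexI) auto
    next
      case (2 g)
      from 2(1) show ?thesis
      proof (cases rule: split_coords_cases)
        case (1 g')
        then have "(\<lambda>p. g' (fst p)) \<in> ?C'" by (intro split_coordsI)
        then show ?thesis using 1 2 by (intro bexI) auto
      next
        case (2 g')
        then obtain i where i: "i \<in> J2" "g' = (\<lambda>z. z i)" by (auto elim: coords_cases)
        then have "(\<lambda>p. snd p i) \<in> ?C'" by (intro split_coordsI coordsI) auto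
        then show ?thesis using i 2 \<open>h = (\<lambda>p. g (snd p))\<close> by (intro bexI) auto
      qed
    qed
    then show "(\<exists>h'\<in>?C'. \<forall>p\<in>?D'. h (snd p j, fst p, restrict (snd p) J2) = h' p) \<or>
      (\<exists>a\<in>carrier R. \<forall>p\<in>?D'. h (snd p j, fst p, restrict (snd p) J2) = a)" ..
  qed auto
  then have "polyf ?C' ?D' d (\<lambda>(w, z). q (\<lambda>i. if i \<in> J1 then w i a0 else z i))"
  proof (rule polyf_ext)
    fix p assume "p \<in> ?D'"
    then have "(\<lambda>i. if i \<in> J1 then fst p i a0 else snd p i)
      = (\<lambda>i. if i = j then snd p j else if i \<in> J1 then fst p i a0 else restrict (snd p) J2 i)"
      using insert.hyps(2) by (auto simp: fun_eq_iff PiE_iff extensional_def)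
    then show "(\<lambda>(w, z). q (\<lambda>i. if i \<in> J1 then w i a0 else z i)) p = (\<lambda>(x, wz). q' x wz) (snd p j, (fst p, restrict (snd p) J2))"
      by (simp add: q'_def case_prod_unfold cong: if_cong)
  qed
  from insert.IH[OF _ this] show ?case using insert.prems(1) insert.hyps(2) by simp
qed

lemma polyf_of_words:
  assumes "finite J" and S: "finite S" "S \<subseteq> carrier R" and a0: "a0 \<in> S"
    and q: "polyf (word_coords J S) (words J S) d (\<lambda>w. q (\<lambda>j\<in>J. w j a0))"
  shows "polyf (coords J) (PiE J (\<lambda>_. S)) d q"
proof -
  let ?D = "words J S \<times> PiE {} (\<lambda>_. S)" and ?C = "split_coords (word_coords J S) (coords {})"
  have C: "?C \<subseteq> ?D \<rightarrow> carrier R"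
    using S(2) bijs_mem by (intro split_coords_closed coords_closed S) (fastforce simp: word_coords_def)
  have "polyf ?C ?D d (\<lambda>p. q (\<lambda>j\<in>J. fst p j a0))"
  proof (rule polyf_subst[OF q _ _ C])
    fix h :: "_ \<Rightarrow> 'a" assume "h \<in> word_coords J S"
    from split_coordsI(1)[OF this]
    show "(\<exists>h'\<in>?C. \<forall>p\<in>?D. h (fst p) = h' p) \<or> (\<exists>a\<in>carrier R. \<forall>p\<in>?D. h (fst p) = a)"
      by (intro disjI1) (rule bexI, auto)
  qed auto
  then have "polyf ?C ?D d (\<lambda>(w, z). q (\<lambda>j. if j \<in> J then w j a0 else z j))"
    by (rule polyf_ext) (auto simp: restrict_def cong: if_cong)
  from polyf_of_words_aux[OF assms(1-4) _ this] show ?thesis by simp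
qed

text \<open>Moebius inversion around a constant point \<open>y0\<close> writes \<open>g\<close> as a
  combination of its restrictions to at most \<open>k\<close> free coordinates. Each restriction is
  seen by a colouring that gives the free coordinates distinct colours.\<close>

lemma polyf_of_word_points:
  assumes L: "finite L" and S: "finite S" "S \<subseteq> carrier R" "S \<noteq> {}" and g: "g \<in> PiE L (\<lambda>_. S) \<rightarrow> carrier R"
    and c: "cube_free (Suc k) L S g"
    and w: "\<And>om. om \<in> PiE L (\<lambda>_. S \<times> {0..k}) \<Longrightarrow> polyf (word_coords {1..k} S) (words {1..k} S) d (\<lambda>w. g (word_point L w om))"
  shows "polyf (coords L) (PiE L (\<lambda>_. S)) d g"
proof -
  let ?G = "PiE L (\<lambda>_. S)" and ?J = "{1..k}"
  obtain a0 where a0: "a0 \<in> S" using S by blast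
  define y0 where "y0 = (\<lambda>l\<in>L. a0)"
  have y0: "y0 \<in> ?G" using a0 by (auto simp: y0_def)
  have gc: "g (mix L C x y0) \<in> carrier R" if "x \<in> ?G" for C x using g mix_closed[OF that y0] by blast
  have small: "polyf (coords L) ?G d (\<lambda>x. g (mix L C x y0))" if C: "C \<subseteq> L" "card C \<le> k" for C
  proof -
    have "finite C" using C(1) L by (rule finite_subset)
    moreover have "card C \<le> card ?J" using C by simp
    ultimately obtain e where e: "inj_on e C" "e ` C \<subseteq> ?J"
      using inj_on_iff_card_le[of C ?J] by auto
    \<comment> \<open>Colour 0 with letter \<open>a0\<close> freezes every coordinate outside
      \<open>C\<close> at its value in \<open>y0\<close>.\<close>
    define om where "om = (\<lambda>l\<in>L. (a0, if l \<in> C then e l else 0))"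
    define q where "q z = g (\<lambda>l\<in>L. if l \<in> C then z (e l) else a0)" for z
    have om: "om \<in> PiE L (\<lambda>_. S \<times> {0..k})" using a0 e by (fastforce simp: om_def)
    have "polyf (coords ?J) (PiE ?J (\<lambda>_. S)) d q"
    proof (rule polyf_of_words[OF _ S(1,2) a0])
      have pw: "word_point L w om = (\<lambda>l\<in>L. if l \<in> C then (\<lambda>j\<in>?J. w j a0) (e l) else a0)" for w
        using e by (fastforce simp: word_point_def pmap_def om_def fun_eq_iff)
      show "polyf (word_coords ?J S) (words ?J S) d (\<lambda>w. q (\<lambda>j\<in>?J. w j a0))"
        using w[OF om] unfolding q_def pw .
    qed simp
    then have "polyf (coords L) ?G d (\<lambda>x. q (\<lambda>j\<in>?J. if j \<in> e ` C then x (the_inv_into C e j) else a0))"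
    proof (rule polyf_subst[OF _ _ _ coords_closed[OF S(2)]])
      show "(\<lambda>j\<in>?J. if j \<in> e ` C then x (the_inv_into C e j) else a0) \<in> PiE ?J (\<lambda>_. S)" if "x \<in> ?G" for x
        using that a0 C(1) e(1) by (auto simp: PiE_iff the_inv_into_f_f)
      fix h :: "_ \<Rightarrow> 'a" assume "h \<in> coords ?J"
      then obtain j where j: "j \<in> ?J" "h = (\<lambda>z. z j)" by (rule coords_cases)
      show "(\<exists>h'\<in>coords L. \<forall>x\<in>?G. h (\<lambda>j\<in>?J. if j \<in> e ` C then x (the_inv_into C e j) else a0) = h' x)
        \<or> (\<exists>a\<in>carrier R. \<forall>x\<in>?G. h (\<lambda>j\<in>?J. if j \<in> e ` C then x (the_inv_into C e j) else a0) = a)"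
      proof (cases "j \<in> e ` C")
        case True
        then have "the_inv_into C e j \<in> L" using C(1) e(1) by (auto simp: the_inv_into_f_f)
        from coordsI[OF this] show ?thesis using j True by (intro disjI1) (rule bexI, auto)
      next
        case False
        then show ?thesis using j a0 S(2) by auto
      qed
    qed
    then show ?thesis
    proof (rule polyf_ext)
      fix x assume "x \<in> ?G"
      have "mix L C x y0 = (\<lambda>l\<in>L. if l \<in> C then (\<lambda>j\<in>?J. if j \<in> e ` C then x (the_inv_into C e j) else a0) (e l) else a0)"
        using e by (auto simp: mix_def y0_def fun_eq_iff the_inv_into_f_f image_subset_iff)
      then show "g (mix L C x y0) = q (\<lambda>j\<in>?J. if j \<in> e ` C then x (the_inv_into C e j) else a0)"
        by (simp only: q_def)
    qed
  qed
  have "polyf (coords L) ?G d (\<lambda>x. \<Oplus>B\<in>{B\<in>Pow L. card B \<le> k}. cube_sum (\<lambda>C. g (mix L C x y0)) B)"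
  proof (rule polyf_finsum[OF _ _ coords_closed[OF S(2)]])
    show "finite {B \<in> Pow L. card B \<le> k}" using L by simp
    fix B assume B: "B \<in> {B \<in> Pow L. card B \<le> k}"
    then have fB: "finite B" using finite_subset[OF _ L] by simp
    show "polyf (coords L) ?G d (\<lambda>x. cube_sum (\<lambda>C. g (mix L C x y0)) B)"
      unfolding cube_sum_def
    proof (rule polyf_finsum[OF _ _ coords_closed[OF S(2)]])
      fix C assume "C \<in> Pow B"
      then have "C \<subseteq> L" "card C \<le> k" using B card_mono[OF fB, of C] by auto
      from polyf_cmult[OF small[OF this] coords_closed[OF S(2)] sgn_pow_closed]
      show "polyf (coords L) ?G d (\<lambda>x. sgn_pow (card (B - C)) \<otimes> g (mix L C x y0))" .
    qed (use fB in simp)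
  qed
  then show ?thesis
  proof (rule polyf_ext)
    fix x assume x: "x \<in> ?G"
    have "g x = g (mix L L x y0)"
    proof -
      have "mix L L x y0 = x" using x by (auto simp: mix_def fun_eq_iff PiE_iff extensional_def)
      then show ?thesis by simp
    qed
    also have "\<dots> = (\<Oplus>B\<in>Pow L. cube_sum (\<lambda>C. g (mix L C x y0)) B)"
      using gc[OF x] by (intro cube_sum_Moebius[OF L, symmetric]) auto
    also have "\<dots> = (\<Oplus>B\<in>{B\<in>Pow L. card B \<le> k}. cube_sum (\<lambda>C. g (mix L C x y0)) B)"
    proof (rule add.finprod_mono_neutral_cong_right)
      show "cube_sum (\<lambda>C. g (mix L C x y0)) B = \<zero>" if "B \<in> Pow L - {B \<in> Pow L. card B \<le> k}" for B
        using that by (intro cube_freeD[OF cube_free_mono[OF L g c, of "card B"] x y0]) auto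
    qed (use L gc[OF x] in auto)
    finally show "g x = (\<Oplus>B\<in>{B\<in>Pow L. card B \<le> k}. cube_sum (\<lambda>C. g (mix L C x y0)) B)" .
  qed
qed

end

section \<open>Testers\<close>

context field
begin

section \<open>Indexed polynomials as polynomial functions on the grid\<close>

definition mon :: "('c \<Rightarrow> 'a) \<Rightarrow> 'c multiset \<Rightarrow> 'a"
  where "mon x m = (\<Otimes>i\<in>set_mset m. x i [^] count m i)"

lemma mon_closed: "(\<And>i. i \<in># m \<Longrightarrow> x i \<in> carrier R) \<Longrightarrow> mon x m \<in> carrier R"
  unfolding mon_def by (intro finprod_closed) auto

lemma mon_add_mset:
  assumes "\<And>j. j \<in># add_mset i m \<Longrightarrow> x j \<in> carrier R"
  shows "mon x (add_mset i m) = x i \<otimes> mon x m"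
proof -
  let ?A = "set_mset m - {i}"
  have xi: "x i \<in> carrier R" using assms by simp
  have P: "(\<Otimes>j\<in>?A. x j [^] count m j) \<in> carrier R" using assms by (intro finprod_closed) auto
  have "mon x (add_mset i m) = (\<Otimes>j\<in>insert i ?A. x j [^] count (add_mset i m) j)"
    by (simp add: mon_def)
  also have "\<dots> = x i [^] Suc (count m i) \<otimes> (\<Otimes>j\<in>?A. x j [^] count (add_mset i m) j)"
    using assms by (subst finprod_insert) auto
  also have "(\<Otimes>j\<in>?A. x j [^] count (add_mset i m) j) = (\<Otimes>j\<in>?A. x j [^] count m j)"
    using assms by (intro finprod_cong') auto
  finally have 1: "mon x (add_mset i m) = x i [^] Suc (count m i) \<otimes> (\<Otimes>j\<in>?A. x j [^] count m j)" .
  have 2: "mon x m = x i [^] count m i \<otimes> (\<Otimes>j\<in>?A. x j [^] count m j)"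
  proof (cases "i \<in># m")
    case True
    then have "mon x m = (\<Otimes>j\<in>insert i ?A. x j [^] count m j)" by (simp add: mon_def insert_absorb)
    also have "\<dots> = x i [^] count m i \<otimes> (\<Otimes>j\<in>?A. x j [^] count m j)"
      using assms by (subst finprod_insert) auto
    finally show ?thesis .
  next
    case False
    then have "?A = set_mset m" "count m i = 0" by (auto simp: not_in_iff)
    then show ?thesis using P by (simp add: mon_def)
  qed
  show ?thesis unfolding 1 2 using xi P by (simp add: m_ac)
qed

lemma grid_carrier: "x \<in> PiE L (\<lambda>_. S) \<Longrightarrow> S \<subseteq> carrier R \<Longrightarrow> i \<in> L \<Longrightarrow> x i \<in> carrier R"
  by (auto simp: PiE_iff)

lemma indexed_pset_support:
  assumes "P \<in> indexed_pset L (carrier R)"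
  shows "finite {m. P m \<noteq> \<zero>} \<and> (\<forall>m. P m \<in> carrier R) \<and> (\<forall>m. P m \<noteq> \<zero> \<longrightarrow> set_mset m \<subseteq> L)"
  using assms
proof (induction rule: indexed_pset.induct)
  case (indexed_const a)
  have "{m. ring.indexed_const R a m \<noteq> \<zero>} \<subseteq> {{#}}" by (auto simp: indexed_const_def)
  then show ?case using indexed_const by (auto simp: indexed_const_def intro: finite_subset)
next
  case (indexed_padd P Q)
  have "{m. indexed_padd P Q m \<noteq> \<zero>} \<subseteq> {m. P m \<noteq> \<zero>} \<union> {m. Q m \<noteq> \<zero>}" by (auto simp: indexed_padd_def)
  then have "finite {m. indexed_padd P Q m \<noteq> \<zero>}" using indexed_padd.IH by (auto intro: finite_subset)
  moreover have "set_mset m \<subseteq> L" if "indexed_padd P Q m \<noteq> \<zero>" for m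
    using that indexed_padd.IH by (cases "P m = \<zero>") (auto simp: indexed_padd_def)
  ultimately show ?case using indexed_padd.IH by (auto simp: indexed_padd_def)
next
  case (indexed_pmult P i)
  have "{m. indexed_pmult P i m \<noteq> \<zero>} \<subseteq> add_mset i ` {m. P m \<noteq> \<zero>}"
    by (auto simp: indexed_pmult_def image_iff split: if_splits) (metis insert_DiffM)
  then have "finite {m. indexed_pmult P i m \<noteq> \<zero>}" using indexed_pmult.IH by (auto intro: finite_subset)
  moreover have "set_mset m \<subseteq> L" if "indexed_pmult P i m \<noteq> \<zero>" for m
  proof -
    have m: "i \<in># m" "P (m - {#i#}) \<noteq> \<zero>" using that by (auto simp: indexed_pmult_def split: if_splits)
    then have "set_mset (m - {#i#}) \<subseteq> L" using indexed_pmult.IH by blast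
    then have "set_mset (add_mset i (m - {#i#})) \<subseteq> L" using indexed_pmult.hyps by simp
    then show ?thesis using insert_DiffM[OF m(1)] by metis
  qed
  ultimately show ?case using indexed_pmult.IH by (auto simp: indexed_pmult_def)
qed

text \<open>Evaluation over a larger set of monomials, so that polynomials with different supports
  can be summed over a common one.\<close>

lemma peval_eq:
  assumes "finite M" "{m. P m \<noteq> \<zero>} \<subseteq> M" "\<And>m. P m \<in> carrier R" "\<And>m. m \<in> M \<Longrightarrow> mon x m \<in> carrier R"
  shows "peval R P x = (\<Oplus>m\<in>M. P m \<otimes> mon x m)"
  unfolding peval_def mon_def[symmetric]
  by (rule add.finprod_mono_neutral_cong_left) (use assms in auto)

lemma polyf_mon:
  assumes "set_mset m \<subseteq> L" "S \<subseteq> carrier R"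
  shows "polyf (coords L) (PiE L (\<lambda>_. S)) (size m) (\<lambda>x. mon x m)"
  using assms(1)
proof (induction m)
  case empty
  then show ?case by (simp add: mon_def polyf_const)
next
  case (add i m)
  have "(\<lambda>x. x i) \<in> coords L" using add.prems by (intro coordsI) auto
  then have "polyf (coords L) (PiE L (\<lambda>_. S)) (Suc (size m)) (\<lambda>x. x i \<otimes> mon x m)"
    using add by (intro polyf_mult[where h = "\<lambda>x. x i"]) auto
  then show ?case unfolding size_add_mset
  proof (rule polyf_ext)
    fix x assume x: "x \<in> PiE L (\<lambda>_. S)"
    show "mon x (add_mset i m) = x i \<otimes> mon x m"
      by (rule mon_add_mset, rule grid_carrier[OF x assms(2)]) (use add.prems in auto)
  qed
qed

lemma polyf_peval:
  assumes P: "P \<in> indexed_pset L (carrier R)" and d: "total_degree_le R P d" and S: "S \<subseteq> carrier R"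
  shows "polyf (coords L) (PiE L (\<lambda>_. S)) d (peval R P)"
proof -
  let ?M = "{m. P m \<noteq> \<zero>}"
  note supp = indexed_pset_support[OF P]
  have "polyf (coords L) (PiE L (\<lambda>_. S)) d (\<lambda>x. \<Oplus>m\<in>?M. P m \<otimes> mon x m)"
  proof (rule polyf_finsum[OF _ _ coords_closed[OF S]])
    fix m assume m: "m \<in> ?M"
    have "polyf (coords L) (PiE L (\<lambda>_. S)) d (\<lambda>x. mon x m)"
      by (rule polyf_mono[OF polyf_mon[OF _ S]]) (use m supp d in \<open>auto simp: total_degree_le_def\<close>)
    then show "polyf (coords L) (PiE L (\<lambda>_. S)) d (\<lambda>x. P m \<otimes> mon x m)"
      by (rule polyf_cmult[OF _ coords_closed[OF S]]) (use supp in auto)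
  qed (use supp in auto)
  then show ?thesis by (rule polyf_ext) (simp add: peval_def mon_def)
qed

lemma exists_indexed_poly:
  assumes "polyf (coords L) (PiE L (\<lambda>_. S)) d f" and S: "S \<subseteq> carrier R"
  shows "\<exists>P\<in>indexed_pset L (carrier R). total_degree_le R P d \<and> (\<forall>x\<in>PiE L (\<lambda>_. S). peval R P x = f x)"
  using assms(1)
proof (induction rule: polyf.induct)
  case (polyf_const a d)
  have "peval R (indexed_const a) x = a" for x :: "_ \<Rightarrow> 'a"
    using polyf_const
    by (subst peval_eq[where M = "{{#}}"]) (auto simp: indexed_const_def mon_def)
  moreover have "total_degree_le R (indexed_const a) d" by (simp add: total_degree_le_def indexed_const_def)
  ultimately show ?case using indexed_pset.indexed_const[OF polyf_const] by blast
next
  case (polyf_add d f g)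
  then obtain P Q where P: "P \<in> indexed_pset L (carrier R)" "total_degree_le R P d" "\<forall>x\<in>PiE L (\<lambda>_. S). peval R P x = f x"
    and Q: "Q \<in> indexed_pset L (carrier R)" "total_degree_le R Q d" "\<forall>x\<in>PiE L (\<lambda>_. S). peval R Q x = g x" by blast
  note sP = indexed_pset_support[OF P(1)] and sQ = indexed_pset_support[OF Q(1)]
  let ?M = "{m. P m \<noteq> \<zero>} \<union> {m. Q m \<noteq> \<zero>}"
  have "peval R (indexed_padd P Q) x = f x \<oplus> g x" if x: "x \<in> PiE L (\<lambda>_. S)" for x
  proof -
    have mc: "mon x m \<in> carrier R" if "m \<in> ?M" for m
    proof (rule mon_closed)
      fix i assume "i \<in># m"
      then have "i \<in> L" using that sP sQ by blast
      then show "x i \<in> carrier R" using x S by auto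
    qed
    have "peval R (indexed_padd P Q) x = (\<Oplus>m\<in>?M. indexed_padd P Q m \<otimes> mon x m)"
      using sP sQ mc by (intro peval_eq) (auto simp: indexed_padd_def)
    also have "\<dots> = (\<Oplus>m\<in>?M. P m \<otimes> mon x m \<oplus> Q m \<otimes> mon x m)"
      using sP sQ mc by (intro finsum_cong') (auto simp: indexed_padd_def l_distr)
    also have "\<dots> = (\<Oplus>m\<in>?M. P m \<otimes> mon x m) \<oplus> (\<Oplus>m\<in>?M. Q m \<otimes> mon x m)"
      using sP sQ mc by (intro finsum_addf) auto
    also have "(\<Oplus>m\<in>?M. P m \<otimes> mon x m) = peval R P x" using sP sQ mc by (intro peval_eq[symmetric]) auto
    also have "(\<Oplus>m\<in>?M. Q m \<otimes> mon x m) = peval R Q x" using sP sQ mc by (intro peval_eq[symmetric]) auto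
    finally show ?thesis using P(3) Q(3) x by simp
  qed
  moreover have "total_degree_le R (indexed_padd P Q) d"
    unfolding total_degree_le_def
  proof (intro allI impI)
    fix m assume "indexed_padd P Q m \<noteq> \<zero>"
    then show "size m \<le> d"
      using P(2) Q(2) sQ unfolding total_degree_le_def by (cases "P m = \<zero>") (auto simp: indexed_padd_def)
  qed
  ultimately show ?case using indexed_pset.indexed_padd[OF P(1) Q(1)] by blast
next
  case (polyf_mult h d f)
  then obtain P where P: "P \<in> indexed_pset L (carrier R)" "total_degree_le R P d" "\<forall>x\<in>PiE L (\<lambda>_. S). peval R P x = f x" by blast
  obtain i where i: "i \<in> L" "h = (\<lambda>x. x i)" using polyf_mult.hyps(1) by (rule coords_cases)
  note sP = indexed_pset_support[OF P(1)]
  let ?M = "{m. P m \<noteq> \<zero>}"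
  have supp: "{m. indexed_pmult P i m \<noteq> \<zero>} \<subseteq> add_mset i ` ?M"
    by (auto simp: indexed_pmult_def image_iff split: if_splits) (metis insert_DiffM)
  have "peval R (indexed_pmult P i) x = x i \<otimes> f x" if x: "x \<in> PiE L (\<lambda>_. S)" for x
  proof -
    have xc: "x j \<in> carrier R" if "j \<in> L" for j using x S that by auto
    have mc: "mon x m \<in> carrier R" if "m \<in> ?M" for m
      using that sP xc by (intro mon_closed) blast
    have ma: "mon x (add_mset i m) = x i \<otimes> mon x m" if "m \<in> ?M" for m
      using that sP xc i(1) by (intro mon_add_mset) auto
    have "peval R (indexed_pmult P i) x = (\<Oplus>m\<in>add_mset i ` ?M. indexed_pmult P i m \<otimes> mon x m)"
      using sP mc xc i(1) supp by (intro peval_eq) (auto simp: indexed_pmult_def ma)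
    also have "\<dots> = (\<Oplus>m\<in>?M. indexed_pmult P i (add_mset i m) \<otimes> mon x (add_mset i m))"
      using sP mc xc i(1) by (intro finsum_reindex) (auto simp: indexed_pmult_def ma inj_on_def)
    also have "\<dots> = (\<Oplus>m\<in>?M. x i \<otimes> (P m \<otimes> mon x m))"
      using sP mc xc i(1) by (intro finsum_cong') (auto simp: indexed_pmult_def ma m_lcomm)
    also have "\<dots> = x i \<otimes> (\<Oplus>m\<in>?M. P m \<otimes> mon x m)"
      using sP mc xc i(1) by (intro finsum_rdistr[symmetric]) auto
    also have "(\<Oplus>m\<in>?M. P m \<otimes> mon x m) = peval R P x" using sP mc by (intro peval_eq[symmetric]) auto
    finally show ?thesis using P(3) x by simp
  qed
  moreover have "total_degree_le R (indexed_pmult P i) (Suc d)"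
    using P(2) supp unfolding total_degree_le_def by fastforce
  ultimately show ?case using indexed_pset.indexed_pmult[OF P(1) i(1)] unfolding i(2) by blast
next
  case (polyf_ext d f g)
  then show ?case by metis
qed

lemma low_degree_functions_eq:
  assumes "S \<subseteq> carrier R"
  shows "low_degree_functions R S n d = {f \<in> PiE (PiE {..<n} (\<lambda>_. S)) (\<lambda>_. carrier R).
    polyf (coords {..<n}) (PiE {..<n} (\<lambda>_. S)) d f}"
proof (intro equalityI subsetI)
  fix f assume "f \<in> low_degree_functions R S n d"
  then obtain P where f: "f \<in> PiE (PiE {..<n} (\<lambda>_. S)) (\<lambda>_. carrier R)"
    and P: "P \<in> indexed_pset {..<n} (carrier R)" "total_degree_le R P d"
    and eq: "\<And>x. x \<in> PiE {..<n} (\<lambda>_. S) \<Longrightarrow> f x = peval R P x"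
    by (auto simp: low_degree_functions_def grid_def)
  then show "f \<in> {f \<in> PiE (PiE {..<n} (\<lambda>_. S)) (\<lambda>_. carrier R).
      polyf (coords {..<n}) (PiE {..<n} (\<lambda>_. S)) d f}"
    using polyf_ext[OF polyf_peval[OF P assms] eq] by simp
next
  fix f assume "f \<in> {f \<in> PiE (PiE {..<n} (\<lambda>_. S)) (\<lambda>_. carrier R).
      polyf (coords {..<n}) (PiE {..<n} (\<lambda>_. S)) d f}"
  then show "f \<in> low_degree_functions R S n d"
    unfolding low_degree_functions_def grid_def using exists_indexed_poly[OF _ assms, of "{..<n}" d f] by simp
qed

end

section \<open>Independent repetition of one round\<close>

lemma avg_PiE_prod:
  assumes "finite L"
  shows "avg (PiE L (\<lambda>_. A)) (\<lambda>w. \<Prod>l\<in>L. h (w l)) = avg A h ^ card L"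
  using assms
proof (induction L)
  case empty
  show ?case by simp
next
  case (insert l L)
  have "(\<Prod>i\<in>L. h ((w(l := a)) i)) = (\<Prod>i\<in>L. h (w i))" for w a
    using insert.hyps by (intro prod.cong) auto
  then have "avg (PiE (insert l L) (\<lambda>_. A)) (\<lambda>w. \<Prod>l\<in>insert l L. h (w l)) = avg A (\<lambda>a. avg A h ^ card L * h a)"
    using insert by (simp add: avg_PiE_insert avg_cmult mult.commute)
  also have "\<dots> = avg A h ^ card L * avg A h" by (rule avg_cmult)
  finally show ?case using insert.hyps by (simp add: mult.commute)
qed

lemma prob_pmf_of_set:
  assumes "finite A" "A \<noteq> {}"
  shows "measure_pmf.prob (map_pmf h (pmf_of_set A)) {x. P x} = avg A (\<lambda>a. of_bool (P (h a)))"
proof -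
  have "A \<inter> h -` {x. P x} = {a \<in> A. P (h a)}" by auto
  then show ?thesis using assms by (simp add: measure_pmf_of_set avg_of_bool)
qed

text \<open>By Bernoulli, \<open>(1 - r) ^ M * (1 + M * r)\<close> is at most
  \<open>(1 - r\<^sup>2) ^ M\<close>, hence at most 1. So \<open>(1 - r) ^ M\<close> is at most
  \<open>1 / (1 + \<delta>)\<close>, which is at most \<open>1 - \<delta> / 2\<close> because
  \<open>\<delta> \<le> 1\<close>.\<close>

lemma repetition_bound:
  fixes r \<delta> :: real
  assumes r: "0 \<le> r" "r \<le> 1" and d: "0 \<le> \<delta>" "\<delta> \<le> 1" "\<delta> \<le> real M * r"
  shows "\<delta> / 2 \<le> 1 - (1 - r) ^ M"
proof -
  have "(1 - r) ^ M * (1 + \<delta>) \<le> (1 - r) ^ M * (1 + real M * r)"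
    using r d by (intro mult_left_mono) auto
  also have "\<dots> \<le> (1 - r) ^ M * (1 + r) ^ M"
    using r Bernoulli_inequality[of r M] by (intro mult_left_mono) auto
  also have "\<dots> = (1 - r\<^sup>2) ^ M" by (simp add: power_mult_distrib[symmetric] power2_eq_square algebra_simps)
  also have "\<dots> \<le> 1" using r by (intro power_le_one) (auto simp: power_le_one)
  finally have 1: "(1 - r) ^ M * (1 + \<delta>) \<le> 1" .
  have "\<delta> * \<delta> \<le> \<delta> * 1" using d by (intro mult_left_mono) auto
  then have "1 \<le> (1 - \<delta> / 2) * (1 + \<delta>)" by (simp add: algebra_simps)
  with 1 have "(1 - r) ^ M * (1 + \<delta>) \<le> (1 - \<delta> / 2) * (1 + \<delta>)" by linarith
  then have "(1 - r) ^ M \<le> 1 - \<delta> / 2" using d by (simp add: mult_le_cancel_right)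
  then show ?thesis by simp
qed

lemma testable_mono:
  "nonadaptive_one_sided_testable q D Y \<F> \<Longrightarrow> q \<le> q' \<Longrightarrow> nonadaptive_one_sided_testable q' D Y \<F>"
  unfolding nonadaptive_one_sided_testable_def by (elim exE, intro exI) (auto intro: order_trans)

lemma rel_dist_bounds: "finite D \<Longrightarrow> 0 \<le> rel_dist D f g \<and> rel_dist D f g \<le> 1"
  unfolding rel_dist_def by (auto intro!: divide_le_eq_1[THEN iffD2] card_mono simp: card_gt_0_iff)

lemma family_dist_le: "finite D \<Longrightarrow> g \<in> \<F> \<Longrightarrow> family_dist D \<F> f \<le> rel_dist D f g"
  unfolding family_dist_def by (intro Min_le finite_rel_dist_image) auto

lemma family_dist_nonneg: "finite D \<Longrightarrow> \<F> \<noteq> {} \<Longrightarrow> 0 \<le> family_dist D \<F> f"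
  unfolding family_dist_def using rel_dist_bounds by (intro Min.boundedI finite_rel_dist_image) auto

text \<open>The tester accepts when some member of the family is consistent with all answers, so
  one-sidedness is automatic. Consistency with all rounds jointly implies consistency in each, so a
  single bad round suffices for rejection.\<close>

lemma testable_by_repetition:
  fixes Q :: "'w \<Rightarrow> 'x list" and \<F> :: "('x \<Rightarrow> 'y) set"
  assumes D: "finite D" and W: "finite W" "W \<noteq> {}" and F: "\<F> \<noteq> {}"
    and Q: "\<And>w. w \<in> W \<Longrightarrow> set (Q w) \<subseteq> D \<and> length (Q w) \<le> q"
    and sound: "\<And>f. f \<in> D \<rightarrow>\<^sub>E Y \<Longrightarrow> f \<notin> \<F> \<Longrightarrow>
      family_dist D \<F> f \<le> real M * avg W (\<lambda>w. of_bool (\<forall>g\<in>\<F>. \<exists>x\<in>set (Q w). g x \<noteq> f x))"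
  shows "nonadaptive_one_sided_testable (M * q) D Y \<F>"
proof -
  let ?W = "PiE {..<M} (\<lambda>_. W)"
  define QM where "QM w = concat (map (\<lambda>i. Q (w i)) [0..<M])" for w
  define acc where "acc xs ys \<longleftrightarrow> (\<exists>g\<in>\<F>. map g xs = ys)" for xs and ys :: "'y list"
  have fW: "finite ?W" "?W \<noteq> {}" using W by (auto intro!: finite_PiE simp: PiE_eq_empty_iff)
  have len: "length (QM w) \<le> M * q" if "w \<in> ?W" for w
  proof -
    have "length (QM w) = (\<Sum>i<M. length (Q (w i)))"
      by (simp add: QM_def length_concat comp_def interv_sum_list_conv_sum_set_nat atLeast0LessThan)
    also have "\<dots> \<le> (\<Sum>i<M. q)" using that Q by (intro sum_mono) (auto simp: PiE_iff)
    finally show ?thesis by simp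
  qed
  have setQ: "set (QM w) = (\<Union>i<M. set (Q (w i)))" for w by (auto simp: QM_def)
  have rejects: "family_dist D \<F> f / 2 \<le> measure_pmf.prob (map_pmf QM (pmf_of_set ?W)) {xs. \<not> acc xs (map f xs)}"
    if f: "f \<in> D \<rightarrow>\<^sub>E Y" "f \<notin> \<F>" for f
  proof -
    let ?bad = "\<lambda>w. \<forall>g\<in>\<F>. \<exists>x\<in>set (Q w). g x \<noteq> f x"
    define r where "r = avg W (\<lambda>w. of_bool (?bad w))"
    have r: "0 \<le> r" "r \<le> 1" unfolding r_def using W by (auto intro: avg_nonneg avg_le_const)
    obtain g where "g \<in> \<F>" using F by blast
    then have d1: "family_dist D \<F> f \<le> 1"
      using family_dist_le[OF D, of g \<F> f] rel_dist_bounds[OF D, of f g] by linarith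
    have "family_dist D \<F> f / 2 \<le> 1 - (1 - r) ^ M"
      using r d1 family_dist_nonneg[OF D F] sound[OF f] by (intro repetition_bound) (auto simp: r_def)
    also have "1 - r = avg W (\<lambda>w. of_bool (\<not> ?bad w))"
    proof -
      have "avg W (\<lambda>w. of_bool (\<not> ?bad w) + of_bool (?bad w)) = avg W (\<lambda>_. 1)" by (intro avg_cong) auto
      then show ?thesis using W by (simp add: avg_add avg_const r_def)
    qed
    also have "1 - \<dots> ^ M = avg ?W (\<lambda>w. 1) - avg ?W (\<lambda>w. \<Prod>i<M. of_bool (\<not> ?bad (w i)))"
      using avg_PiE_prod[of "{..<M}" W "\<lambda>w. of_bool (\<not> ?bad w)"] by (simp only: avg_const[OF fW] card_lessThan finite_lessThan simp_thms)
    also have "\<dots> = avg ?W (\<lambda>w. 1 + (-1) * (\<Prod>i<M. of_bool (\<not> ?bad (w i))))"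
      unfolding avg_add avg_cmult by simp
    also have "\<dots> \<le> avg ?W (\<lambda>w. of_bool (\<not> acc (QM w) (map f (QM w))))"
    proof (rule avg_mono)
      fix w
      show "1 + (-1) * (\<Prod>i<M. of_bool (\<not> ?bad (w i))) \<le> (of_bool (\<not> acc (QM w) (map f (QM w))) :: real)"
      proof (cases "acc (QM w) (map f (QM w))")
        case True
        then obtain g where g: "g \<in> \<F>" "\<forall>x\<in>set (QM w). g x = f x" by (auto simp: acc_def)
        then have nb: "\<not> ?bad (w i)" if "i < M" for i using that unfolding setQ by blast
        have "(\<Prod>i<M. of_bool (\<not> ?bad (w i)) :: real) = (\<Prod>i<M. 1)"
          by (intro prod.cong refl) (simp only: nb lessThan_iff of_bool_eq simp_thms)
        then show ?thesis by simp
      next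
        case False
        have "0 \<le> (\<Prod>i<M. of_bool (\<not> ?bad (w i)) :: real)" by (intro prod_nonneg) simp
        then show ?thesis using False by simp
      qed
    qed
    also have "\<dots> = measure_pmf.prob (map_pmf QM (pmf_of_set ?W)) {xs. \<not> acc xs (map f xs)}"
      by (rule prob_pmf_of_set[OF fW, symmetric])
    finally show ?thesis .
  qed
  show ?thesis unfolding nonadaptive_one_sided_testable_def
  proof (intro exI[of _ "map_pmf QM (pmf_of_set ?W)"] exI[of _ acc] conjI ballI impI)
    fix xs assume "xs \<in> set_pmf (map_pmf QM (pmf_of_set ?W))"
    then obtain w where w: "w \<in> ?W" "xs = QM w" using fW by auto
    show "length xs \<le> M * q" using len w by simp
    show "set xs \<subseteq> D" using w Q by (fastforce simp: setQ PiE_iff)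
  next
    fix f assume "f \<in> D \<rightarrow>\<^sub>E Y" "f \<in> \<F>"
    then have "acc xs (map f xs)" for xs by (auto simp: acc_def)
    then show "measure_pmf.prob (map_pmf QM (pmf_of_set ?W)) {xs. acc xs (map f xs)} = 1" by simp
  qed (use rejects in auto)
qed

lemma testable_trivial:
  assumes "D \<rightarrow>\<^sub>E Y \<subseteq> \<F>"
  shows "nonadaptive_one_sided_testable q D Y \<F>"
  unfolding nonadaptive_one_sided_testable_def
  by (intro exI[of _ "return_pmf []"] exI[of _ "\<lambda>_ _. True"]) (use assms in auto)

lemma (in abelian_monoid) finsum_Sigma:
  assumes "finite A" "\<And>a. a \<in> A \<Longrightarrow> finite (B a)" "\<And>a b. a \<in> A \<Longrightarrow> b \<in> B a \<Longrightarrow> f (a, b) \<in> carrier G"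
  shows "(\<Oplus>p\<in>Sigma A B. f p) = (\<Oplus>a\<in>A. \<Oplus>b\<in>B a. f (a, b))"
  using assms
proof (induction A)
  case empty
  then show ?case by simp
next
  case (insert a A)
  have S: "Sigma (insert a A) B = Pair a ` B a \<union> Sigma A B" by auto
  have "(\<Oplus>p\<in>Sigma (insert a A) B. f p) = (\<Oplus>p\<in>Pair a ` B a. f p) \<oplus> (\<Oplus>p\<in>Sigma A B. f p)"
    unfolding S using insert by (intro add.finprod_Un_disjoint) auto
  also have "(\<Oplus>p\<in>Pair a ` B a. f p) = (\<Oplus>b\<in>B a. f (a, b))"
    using insert.prems by (intro add.finprod_reindex) (auto simp: inj_on_def)
  finally show ?case using insert by (auto intro!: finsum_insert[symmetric] finsum_closed)
qed

lemma sum_power_le: "(\<Sum>j\<le>d. k ^ j) \<le> (k + 1) ^ d" for k d :: nat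
proof (induction d)
  case (Suc d)
  have "k * k ^ d \<le> k * (k + 1) ^ d" by (intro mult_le_mono2 power_mono) auto
  from add_mono[OF Suc this] show ?case by simp
qed simp

lemma card_small_subsets_le:
  assumes "finite K"
  shows "card {B \<in> Pow K. card B \<le> d} \<le> (card K + 1) ^ d"
proof -
  have "{B \<in> Pow K. card B \<le> d} = (\<Union>j\<le>d. {B. B \<subseteq> K \<and> card B = j})" by auto
  then have "card {B \<in> Pow K. card B \<le> d} \<le> (\<Sum>j\<le>d. card {B. B \<subseteq> K \<and> card B = j})"
    by (simp add: card_UN_le)
  also have "\<dots> = (\<Sum>j\<le>d. card K choose j)" using assms by (simp add: n_subsets)
  also have "\<dots> \<le> (\<Sum>j\<le>d. card K ^ j)"
  proof (rule sum_mono)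
    fix j show "card K choose j \<le> card K ^ j"
      by (cases "j \<le> card K") (auto intro: binomial_le_pow simp: binomial_eq_0)
  qed
  finally show ?thesis using sum_power_le[of "card K" d] by linarith
qed

section \<open>The block test for a given alphabet and degree\<close>

locale grid_test = field F for F (structure) +
  fixes L :: "'l set" and S :: "'a set" and d :: nat
  assumes finL: "finite L" and finS: "finite S" and S_ne: "S \<noteq> {}" and S_carrier: "S \<subseteq> carrier F" and d_pos: "1 \<le> d"
begin

text \<open>A test keeps at most a fraction \<open>d / card K\<close> of the base point; the square of this must be small against the inverse root of the alphabet size \<open>(card S)\<^sup>2 * card K\<close>.\<close>

definition K :: "nat set"
  where "K = {..<4 * (card S * d)\<^sup>2}"

definition small_sets :: "nat set set"
  where "small_sets = {B \<in> Pow K. card B \<le> d}"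

definition I :: "(nat set \<times> nat set) set"
  where "I = Sigma small_sets Pow"

text \<open>The index \<open>(B, C)\<close> stands for the term \<open>C\<close> of the cube sum over \<open>B\<close>; the index \<open>(K, K)\<close>, with coefficient \<open>- 1\<close>, stands for the base point itself.\<close>

definition eps :: "nat set \<times> nat set \<Rightarrow> 'a"
  where "eps = (\<lambda>(B, C). if (B, C) = (K, K) then \<ominus> \<one> else sgn_pow (card (B - C)))"

lemma cardS: "1 \<le> card S"
  using finS S_ne by (auto simp: Suc_le_eq card_gt_0_iff)

lemma cardK: "card K = 4 * (card S * d)\<^sup>2"
  by (simp add: K_def)

lemma d_less_K: "d < card K"
proof -
  have "d * 1 \<le> d * (card S * card S * d)" using cardS d_pos by (intro mult_le_mono2) simp
  then have "d \<le> (card S * d)\<^sup>2" by (simp add: power2_eq_square ac_simps)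
  then show ?thesis using d_pos by (simp add: cardK)
qed

lemma fin_small: "finite small_sets" "B \<in> small_sets \<Longrightarrow> finite B"
  by (auto simp: small_sets_def K_def intro: finite_subset)

lemma finI: "finite I"
  using fin_small by (auto simp: I_def)

lemma base_notin: "(K, K) \<notin> I"
  using d_less_K by (auto simp: I_def small_sets_def)

text \<open>With s letters, the kept fraction is at most \<open>1 / (4 * s ^ 2 * d)\<close>, and the
  choice of \<open>K\<close> makes the root of the alphabet size exactly
  \<open>2 * s ^ 2 * d\<close>. The left side is then at most
  \<open>6 / (16 * s ^ 2 * d)\<close>.\<close>

lemma keep_small:
  assumes "i \<in> I"
  shows "(real (card (snd i \<inter> K)) / real (card K))\<^sup>2 * (2 * (1 + sqrt (real ((card S)\<^sup>2 * card K)))) \<le> 1"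
proof -
  define s x where "s = real (card S)" and "x = real d"
  have s: "1 \<le> s" and x: "1 \<le> x" using cardS d_pos by (simp_all add: s_def x_def)
  obtain B C where i: "i = (B, C)" "B \<in> small_sets" "C \<subseteq> B" using assms by (auto simp: I_def)
  have "card (C \<inter> K) \<le> card B" using i fin_small by (intro card_mono) auto
  then have c: "real (card (snd i \<inter> K)) \<le> x" using i by (simp add: small_sets_def x_def)
  have k: "real (card K) = 4 * (s * x)\<^sup>2" by (simp add: cardK s_def x_def)
  have "sqrt (real ((card S)\<^sup>2 * card K)) = sqrt ((2 * (s * s * x))\<^sup>2)"
    by (simp add: cardK s_def x_def power2_eq_square ac_simps)
  also have "\<dots> = 2 * (s * s * x)" using s x by (subst real_sqrt_abs) simp
  finally have r: "sqrt (real ((card S)\<^sup>2 * card K)) = 2 * (s * s * x)" .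
  have six: "2 * (1 + 2 * y) \<le> 6 * y" if "1 \<le> y" for y :: real using that by simp
  have sx: "1 \<le> s * s * x" using s x by (meson mult_ge1_I)
  have "(real (card (snd i \<inter> K)) / real (card K))\<^sup>2 * (2 * (1 + 2 * (s * s * x))) \<le> (x / (4 * (s * x)\<^sup>2))\<^sup>2 * (6 * (s * s * x))"
  proof (rule mult_mono)
    show "(real (card (snd i \<inter> K)) / real (card K))\<^sup>2 \<le> (x / (4 * (s * x)\<^sup>2))\<^sup>2"
      unfolding k using c s x by (intro power_mono divide_right_mono) auto
    show "2 * (1 + 2 * (s * s * x)) \<le> 6 * (s * s * x)"
      using six[OF sx] .
  qed (use sx in auto)
  also have "\<dots> = 6 / (16 * (s * s * x))"
    using s x by (simp add: power2_eq_square field_simps)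
  also have "\<dots> \<le> 1" using sx by (simp add: field_simps)
  finally show ?thesis unfolding r .
qed

sublocale block_test F L S K I "(K, K)" snd eps
proof unfold_locales
  show "finite K" by (simp add: K_def)
  show "K \<noteq> {}" using d_less_K by auto
  show "eps i \<in> carrier F" for i by (simp add: eps_def split: prod.splits)
  show "eps (K, K) = \<ominus> \<one>" by (simp add: eps_def)
qed (use finL finS finI S_ne base_notin keep_small in auto)

definition base :: "('l \<Rightarrow> 'a \<times> 'a \<times> nat) \<Rightarrow> 'l \<Rightarrow> 'a"
  where "base = pmap L fst"

definition other :: "('l \<Rightarrow> 'a \<times> 'a \<times> nat) \<Rightarrow> 'l \<Rightarrow> 'a"
  where "other = pmap L (\<lambda>(x, y, b). y)"

definition block_mix :: "('l \<Rightarrow> 'a \<times> 'a \<times> nat) \<Rightarrow> nat set \<Rightarrow> 'l \<Rightarrow> 'a"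
  where "block_mix t C = mix L {l. snd (snd (t l)) \<in> C} (base t) (other t)"

lemma pt_eq: "pt (B, C) t = block_mix t C"
  by (auto simp: pt_def pmap_def sel_def block_mix_def mix_def base_def other_def fun_eq_iff split: prod.splits)

lemma base_other_closed: "t \<in> Tn \<Longrightarrow> base t \<in> pts" "t \<in> Tn \<Longrightarrow> other t \<in> pts"
  by (fastforce simp: base_def other_def pmap_def PiE_iff split: prod.splits)+

text \<open>Passing a test is Moebius inversion over the blocks, truncated at sets of size
  \<open>d\<close>; it is exact when all larger cube sums vanish.\<close>

lemma fails_iff_cube_sum:
  assumes f: "f \<in> pts \<rightarrow> carrier F" and t: "t \<in> Tn"
  shows "fails f t \<longleftrightarrow> f (block_mix t K) \<noteq> (\<Oplus>B\<in>small_sets. cube_sum (\<lambda>C. f (block_mix t C)) B)"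
proof -
  have c: "f (block_mix t C) \<in> carrier F" for C
    using f_pt_closed[OF f t, of "(C, C)"] by (simp add: pt_eq)
  have "(\<Oplus>i\<in>I. eps i \<otimes> f (pt i t)) = (\<Oplus>B\<in>small_sets. \<Oplus>C\<in>Pow B. eps (B, C) \<otimes> f (block_mix t C))"
    unfolding I_def using fin_small c eps by (subst finsum_Sigma) (auto simp: pt_eq I_def)
  also have "\<dots> = (\<Oplus>B\<in>small_sets. cube_sum (\<lambda>C. f (block_mix t C)) B)"
  proof (rule finsum_cong')
    show "(\<lambda>B. cube_sum (\<lambda>C. f (block_mix t C)) B) \<in> small_sets \<rightarrow> carrier F" using c by auto
    fix B assume B: "B \<in> small_sets"
    then have "B \<noteq> K" using d_less_K by (auto simp: small_sets_def)
    then show "(\<Oplus>C\<in>Pow B. eps (B, C) \<otimes> f (block_mix t C)) = cube_sum (\<lambda>C. f (block_mix t C)) B"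
      unfolding cube_sum_def using c by (intro finsum_cong') (auto simp: eps_def)
  qed simp
  finally show ?thesis by (simp add: fails_iff[OF f t] pt_eq)
qed

lemma small_sets_sum:
  assumes "\<And>C. h C \<in> carrier F" "\<And>B. B \<subseteq> K \<Longrightarrow> d < card B \<Longrightarrow> cube_sum h B = \<zero>"
  shows "(\<Oplus>B\<in>small_sets. cube_sum h B) = h K"
proof -
  have "(\<Oplus>B\<in>small_sets. cube_sum h B) = (\<Oplus>B\<in>Pow K. cube_sum h B)"
    by (rule add.finprod_mono_neutral_cong_left) (use assms in \<open>auto simp: small_sets_def K_def\<close>)
  then show ?thesis using assms(1) by (simp add: cube_sum_Moebius K_def)
qed

lemma polyf_passes:
  assumes p: "polyf (coords L) pts e f" "e \<le> d" and t: "t \<in> Tn"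
  shows "\<not> fails f t"
proof -
  have f: "f \<in> pts \<rightarrow> carrier F" using polyf_closed[OF p(1) coords_closed[OF S_carrier]] by blast
  have c: "f (block_mix t C) \<in> carrier F" for C
    using f_pt_closed[OF f t, of "(C, C)"] by (simp add: pt_eq)
  have "cube_sum (\<lambda>C. f (block_mix t C)) B = \<zero>" if "B \<subseteq> K" "d < card B" for B
    unfolding block_mix_def
    using that p(2) by (intro cube_sum_polyf[OF p(1) S_carrier base_other_closed[OF t]]) (auto simp: K_def intro: finite_subset)
  then show ?thesis using small_sets_sum[OF c] by (simp add: fails_iff_cube_sum[OF f t])
qed

text \<open>
  The test with \<open>x = y\<close> outside \<open>B\<close> and the coordinates of \<open>B\<close> in separate blocks reduces to the
  single cube spanned by \<open>B\<close>.
\<close>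

lemma passes_cube_free:
  assumes f: "f \<in> pts \<rightarrow> carrier F" and pass: "\<And>t. t \<in> Tn \<Longrightarrow> \<not> fails f t"
  shows "cube_free (Suc d) L S f"
  unfolding cube_free_def
proof (intro ballI allI impI)
  fix x y B assume xy: "x \<in> pts" "y \<in> pts" and B: "B \<subseteq> L" "card B = Suc d"
  have finB: "finite B" using B(1) finL by (rule finite_subset)
  have "card B \<le> card K" using B d_less_K by simp
  then obtain e where e: "inj_on e B" "e ` B \<subseteq> K" using inj_on_iff_card_le[OF finB fin(3)] by blast
  obtain k0 where k0: "k0 \<in> K" using ne(2) by blast
  define t where "t = (\<lambda>l\<in>L. (if l \<in> B then x l else y l, y l, if l \<in> B then e l else k0))"
  have t: "t \<in> Tn" using xy e k0 by (auto simp: t_def PiE_iff)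
  let ?h = "\<lambda>C. f (block_mix t C)"
  have c: "?h C \<in> carrier F" for C
    using f_pt_closed[OF f t, of "(C, C)"] by (simp add: pt_eq)
  have bm: "block_mix t C = mix L {l \<in> B. e l \<in> C} x y" for C
    using B(1) by (auto simp: block_mix_def mix_def base_def other_def pmap_def t_def fun_eq_iff)
  let ?K0 = "e ` B"
  have K0: "?h K = ?h ?K0" using e by (auto simp: bm intro!: arg_cong[of _ _ f] arg_cong[of _ _ "\<lambda>C. mix L C x y"])
  have outside: "cube_sum ?h A = \<zero>" if A: "A \<subseteq> K" "\<not> A \<subseteq> ?K0" for A
  proof -
    obtain a where a: "a \<in> A" "a \<notin> ?K0" using A by blast
    have "{l \<in> B. e l \<in> insert a C} = {l \<in> B. e l \<in> C}" for C using a by auto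
    then show ?thesis using a A c fin(3) by (intro cube_sum_eq_zero[of _ a]) (auto simp: bm intro: finite_subset)
  qed
  have cardK0: "card ?K0 = Suc d" using e B by (simp add: card_image)
  have "?h ?K0 = (\<Oplus>A\<in>small_sets. cube_sum ?h A)"
    using pass[OF t] by (simp add: fails_iff_cube_sum[OF f t] K0)
  \<comment> \<open>Sets with a block outside \<open>?K0\<close> contribute nothing, as no
    coordinate that changes lies in that block. Every proper subset of \<open>?K0\<close> has at
    most \<open>d\<close> elements and thus occurs in the test.\<close>
  also have "\<dots> = (\<Oplus>A\<in>Pow ?K0 - {?K0}. cube_sum ?h A)"
  proof (rule add.finprod_mono_neutral_cong)
    show "cube_sum ?h A = \<zero>" if "A \<in> small_sets - (Pow ?K0 - {?K0})" for A
    proof (rule outside)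
      show "A \<subseteq> K" using that by (auto simp: small_sets_def)
      show "\<not> A \<subseteq> ?K0" using that cardK0 by (auto simp: small_sets_def)
    qed
    show "cube_sum ?h A = \<zero>" if "A \<in> Pow ?K0 - {?K0} - small_sets" for A
    proof -
      have "A \<subset> ?K0" using that by auto
      then have "card A < Suc d" using cardK0 psubset_card_mono[of ?K0 A] finB by simp
      then have "A \<in> small_sets" using that e by (auto simp: small_sets_def)
      then show ?thesis using that by simp
    qed
  qed (use c finB fin_small in auto)
  finally have 1: "?h ?K0 = (\<Oplus>A\<in>Pow ?K0 - {?K0}. cube_sum ?h A)" .
  \<comment> \<open>The full inversion over \<open>?K0\<close> has exactly one term more than the
    test, and that term must vanish.\<close>
  have "?h ?K0 = (\<Oplus>A\<in>insert ?K0 (Pow ?K0 - {?K0}). cube_sum ?h A)"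
    using cube_sum_Moebius[of ?K0 ?h] finB c by (simp add: insert_absorb)
  also have "\<dots> = cube_sum ?h ?K0 \<oplus> (\<Oplus>A\<in>Pow ?K0 - {?K0}. cube_sum ?h A)"
    using finB c by (intro finsum_insert) auto
  finally have "?h ?K0 = cube_sum ?h ?K0 \<oplus> ?h ?K0" unfolding 1[symmetric] .
  then have "cube_sum ?h ?K0 = \<zero>"
    using add.r_cancel_one'[OF c[of ?K0] cube_sum_closed[of ?K0 ?h, OF c]] by blast
  also have "cube_sum ?h ?K0 = cube_sum (\<lambda>C. ?h (e ` C)) B"
    using e c by (intro cube_sum_image) auto
  also have "\<dots> = cube_sum (\<lambda>C. f (mix L C x y)) B"
  proof (rule cube_sum_cong)
    fix C assume C: "C \<subseteq> B"
    then have "{l \<in> B. e l \<in> e ` C} = C" using e(1) by (auto simp: inj_on_def)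
    then show "?h (e ` C) = f (mix L C x y)" by (simp add: bm)
  qed (use f mix_closed[OF xy] in blast)
  finally show "cube_sum (\<lambda>C. f (mix L C x y)) B = \<zero>" by simp
qed

section \<open>The permutation test and the soundness of one round\<close>

abbreviation "J \<equiv> {1..d}"
abbreviation "On \<equiv> PiE L (\<lambda>_. S \<times> {0..d})"

lemma fin_words: "finite (words J S)"
  using finS by (auto intro!: finite_PiE simp: bijs_def)

lemma fin_On: "finite On" "On \<noteq> {}"
  using finL finS S_ne by (auto intro!: finite_PiE simp: PiE_eq_empty_iff)

lemma word_point_closed: "w \<in> words J S \<Longrightarrow> om \<in> On \<Longrightarrow> word_point L w om \<in> pts"
  by (fastforce simp: word_point_def pmap_def PiE_iff bijs_def split: prod.splits)

lemma avg_word_point: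
  assumes w: "w \<in> words J S"
  shows "avg On (\<lambda>om. u (word_point L w om)) = avg pts u"
proof -
  have bij: "avg S (\<lambda>a. v (if j = 0 then a else w j a)) = avg S v" if "j \<in> {0..d}" for j and v :: "_ \<Rightarrow> real"
  proof (cases "j = 0")
    case False
    then have "bij_betw (w j) S S" using w that by (auto simp: PiE_iff bijs_def)
    from sum.reindex_bij_betw[OF this, of v] show ?thesis using False by (simp add: avg_def)
  qed simp
  have "avg (S \<times> {0..d}) (\<lambda>p. v ((\<lambda>(a, j). if j = 0 then a else w j a) p)) = avg S v" for v :: "_ \<Rightarrow> real"
  proof -
    have "avg (S \<times> {0..d}) (\<lambda>p. v ((\<lambda>(a, j). if j = 0 then a else w j a) p))
      = avg {0..d} (\<lambda>j. avg S (\<lambda>a. v (if j = 0 then a else w j a)))"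
      by (simp add: avg_Times avg_swap[of S])
    also have "\<dots> = avg {0..d} (\<lambda>j. avg S v)" by (rule avg_cong) (rule bij)
    finally show ?thesis by (simp add: avg_const)
  qed
  then have "avg_preserving (S \<times> {0..d}) S (\<lambda>(a, j). if j = 0 then a else w j a)"
    unfolding avg_preserving_def by blast
  from avg_preserving_pmap[OF finL this] show ?thesis
    unfolding avg_preserving_def word_point_def by (rule spec)
qed

lemma word_point_polyf:
  assumes p: "polyf (coords L) pts e f" and om: "om \<in> On"
  shows "polyf (word_coords J S) (words J S) e (\<lambda>w. f (word_point L w om))"
proof (rule polyf_subst[OF p word_point_closed[OF _ om]])
  show "word_coords J S \<subseteq> words J S \<rightarrow> carrier F"
    using S_carrier bijs_mem by (fastforce simp: word_coords_def)
  fix h :: "('l \<Rightarrow> 'a) \<Rightarrow> 'a" assume "h \<in> coords L"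
  then obtain l where l: "l \<in> L" "h = (\<lambda>x. x l)" by (rule coords_cases)
  obtain u j where uj: "om l = (u, j)" "u \<in> S" "j \<le> d" using om l by (cases "om l") (auto simp: PiE_iff dest!: bspec)
  show "(\<exists>h'\<in>word_coords J S. \<forall>w\<in>words J S. h (word_point L w om) = h' w)
    \<or> (\<exists>a\<in>carrier F. \<forall>w\<in>words J S. h (word_point L w om) = a)"
  proof (cases "j = 0")
    case True
    then show ?thesis using uj l S_carrier by (intro disjI2 bexI[of _ u]) (auto simp: word_point_def pmap_def)
  next
    case False
    then have "(\<lambda>w. w j u) \<in> word_coords J S" using uj by (intro word_coordsI) auto
    then show ?thesis using uj l False by (intro disjI1) (rule bexI, auto simp: word_point_def pmap_def)
  qed
qed

text \<open>One round asks the queries of a block test and all points of a permutation test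
  together, so that its rejection probability bounds that of either part.\<close>

definition queries :: "('l \<Rightarrow> 'a \<times> 'a \<times> nat) \<times> ('l \<Rightarrow> 'a \<times> nat) \<Rightarrow> ('l \<Rightarrow> 'a) set"
  where "queries = (\<lambda>(t, om). (\<lambda>i. pt i t) ` insert (K, K) I \<union> (\<lambda>w. word_point L w om) ` words J S)"

abbreviation "q \<equiv> card I + 1"
abbreviation "nw \<equiv> card (words J S)"

lemma queries_bounds:
  assumes "p \<in> Tn \<times> On"
  shows "queries p \<subseteq> pts" "finite (queries p)" "card (queries p) \<le> q + nw"
proof -
  define t om where "t = fst p" and "om = snd p"
  have p: "p = (t, om)" "t \<in> Tn" "om \<in> On"
    using assms unfolding mem_Times_iff t_def om_def by (simp, blast, blast)
  show "queries p \<subseteq> pts"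
    unfolding queries_def p(1) prod.case
    by (intro Un_least image_subsetI pt_closed[OF p(2)] word_point_closed[OF _ p(3)])
  show "finite (queries p)" using p finI fin_words by (simp add: queries_def)
  have "card (queries p) \<le> card ((\<lambda>i. pt i t) ` insert (K, K) I) + card ((\<lambda>w. word_point L w om) ` words J S)"
    unfolding queries_def p prod.case by (rule card_Un_le)
  also have "\<dots> \<le> card (insert (K, K) I) + nw"
    using finI fin_words by (intro add_mono card_image_le) auto
  finally show "card (queries p) \<le> q + nw" using finI base_notin by simp
qed

text \<open>A bound for distance over rejection probability. The factors are the threshold of
  \<open>block_test_sound\<close>, the Schwartz-Zippel loss over the alphabet
  \<open>S \<times> {0..d}\<close>, and the union bound over the \<open>nw\<close> permutation
  points.\<close>

definition rounds :: nat
  where "rounds = 2 ^ 15 * q ^ 12 * (card S * (d + 1)) ^ d * (1 + 4 * nw)"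

text \<open>The tested degree is \<open>e\<close>, while \<open>d\<close> fixes the blocks and
  colours. If \<open>rej f\<close> is above the threshold, so is \<open>r\<close>. Otherwise
  \<open>f\<close> is \<open>4 * r\<close>-close to some \<open>g\<close> of junta-degree at most
  \<open>d\<close>: either \<open>g\<close> has degree \<open>e\<close>, which bounds the distance,
  or Schwartz-Zippel bounds \<open>r\<close> below by a constant.\<close>

lemma round_sound:
  assumes e: "e \<le> d" and f: "f \<in> PiE pts (\<lambda>_. carrier F)"
    and Fam: "Fam = {f \<in> PiE pts (\<lambda>_. carrier F). polyf (coords L) pts e f}"
  shows "family_dist pts Fam f \<le> real rounds * avg (Tn \<times> On) (\<lambda>p. of_bool (\<forall>g\<in>Fam. \<exists>x\<in>queries p. g x \<noteq> f x))"
proof -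
  let ?bad = "\<lambda>p. \<forall>g\<in>Fam. \<exists>x\<in>queries p. g x \<noteq> f x"
  define r where "r = avg (Tn \<times> On) (\<lambda>p. of_bool (?bad p))"
  let ?pol = "\<lambda>h. polyf (word_coords J S) (words J S) e h" and ?wp = "\<lambda>w om. word_point L w om"
  have f': "f \<in> pts \<rightarrow> carrier F" using f by (auto simp: PiE_def)
  have r0: "0 \<le> r" unfolding r_def by (intro avg_nonneg) simp
  have zeroF: "restrict (\<lambda>_. \<zero>) pts \<in> Fam"
    unfolding Fam by (auto intro: polyf_ext[OF polyf_const[OF zero_closed]])
  have d1: "family_dist pts Fam f \<le> 1"
    using family_dist_le[OF fin_sets(1) zeroF, of f] rel_dist_bounds[OF fin_sets(1), of f "restrict (\<lambda>_. \<zero>) pts"] by linarith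
  have rej_le: "rej f \<le> r"
  proof -
    have "rej f = avg Tn (\<lambda>t. avg On (\<lambda>om. of_bool (fails f t)))" using fin_On by (simp add: rej_def avg_const)
    also have "\<dots> \<le> avg Tn (\<lambda>t. avg On (\<lambda>om. of_bool (?bad (t, om))))"
    proof (intro avg_mono)
      fix t om assume t: "t \<in> Tn"
      have "?bad (t, om)" if "fails f t"
      proof (rule ccontr)
        assume "\<not> ?bad (t, om)"
        then obtain g where g: "g \<in> Fam" "\<And>i. i \<in> insert (K, K) I \<Longrightarrow> g (pt i t) = f (pt i t)" by (auto simp: queries_def)
        have "polyf (coords L) pts e g" using g(1) unfolding Fam by simp
        then have "\<not> fails g t" using e t by (rule polyf_passes)
        moreover have "(\<Oplus>i\<in>insert (K, K) I. eps i \<otimes> g (pt i t)) = (\<Oplus>i\<in>insert (K, K) I. eps i \<otimes> f (pt i t))"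
          by (rule finsum_cong') (use g(2) eps' f_pt_closed[OF f' t] in auto)
        ultimately show False using that by (simp only: fails_def)
      qed
      then show "of_bool (fails f t) \<le> (of_bool (?bad (t, om)) :: real)" by simp
    qed
    finally show ?thesis by (simp add: r_def avg_Times)
  qed
  have r2: "avg On (\<lambda>om. of_bool (\<not> ?pol (\<lambda>w. f (?wp w om)))) \<le> r"
  proof -
    have "avg On (\<lambda>om. of_bool (\<not> ?pol (\<lambda>w. f (?wp w om))) :: real)
      = avg Tn (\<lambda>t. avg On (\<lambda>om. of_bool (\<not> ?pol (\<lambda>w. f (?wp w om)))))" using fin_sets ne_sets by (simp add: avg_const)
    also have "\<dots> \<le> avg Tn (\<lambda>t. avg On (\<lambda>om. of_bool (?bad (t, om))))"
    proof (intro avg_mono)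
      fix t om assume om: "om \<in> On"
      have "?bad (t, om)" if "\<not> ?pol (\<lambda>w. f (?wp w om))"
      proof (rule ccontr)
        assume "\<not> ?bad (t, om)"
        then obtain g where g: "g \<in> Fam" "\<And>w. w \<in> words J S \<Longrightarrow> g (word_point L w om) = f (word_point L w om)"
          by (auto simp: queries_def)
        have "polyf (coords L) pts e g" using g(1) unfolding Fam by simp
        then have "?pol (\<lambda>w. g (?wp w om))" using om by (rule word_point_polyf)
        then have "?pol (\<lambda>w. f (?wp w om))" by (rule polyf_ext) (simp add: g(2))
        then show False using that by simp
      qed
      then show "of_bool (\<not> ?pol (\<lambda>w. f (?wp w om))) \<le> (of_bool (?bad (t, om)) :: real)" by simp
    qed
    finally show ?thesis by (simp add: r_def avg_Times)
  qed
  have posq: "1 \<le> 2 ^ 15 * q ^ 12" and posk: "1 \<le> (card S * (d + 1)) ^ d" using cardS by (simp_all add: Suc_le_eq)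
  have le_rounds: "real c * r \<le> real rounds * r" if "c \<le> rounds" for c using that r0 by (intro mult_right_mono) auto
  have "family_dist pts Fam f \<le> real rounds * r"
  proof (cases "rej f * (2 ^ 15 * real (card I + 1) ^ 12) \<le> 1")
    case False
    have c: "2 ^ 15 * q ^ 12 \<le> rounds"
    proof -
      have "2 ^ 15 * q ^ 12 * 1 * 1 \<le> rounds" unfolding rounds_def using posk by (intro mult_le_mono) auto
      then show ?thesis by simp
    qed
    have "1 \<le> rej f * (2 ^ 15 * real q ^ 12)" using False by (rule less_imp_le[OF not_le_imp_less])
    also have "\<dots> \<le> r * (2 ^ 15 * real q ^ 12)" using rej_le by (intro mult_right_mono) auto
    also have "\<dots> = real (2 ^ 15 * q ^ 12) * r" by simp
    also have "\<dots> \<le> real rounds * r" using c by (rule le_rounds)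
    finally show ?thesis by (rule order_trans[OF d1])
  next
    case True
    obtain g where g: "g \<in> pts \<rightarrow> carrier F" "\<forall>t\<in>Tn. \<not> fails g t"
      "avg pts (\<lambda>x. of_bool (f x \<noteq> g x)) \<le> 4 * rej f"
      using block_test_sound[OF f' True] by blast
    have cf: "cube_free (Suc d) L S g" using g by (intro passes_cube_free) auto
    show ?thesis
    proof (cases "polyf (coords L) pts e g")
      case True
      have "restrict g pts \<in> Fam" unfolding Fam using g(1) by (auto intro: polyf_ext[OF True])
      from family_dist_le[OF fin_sets(1) this, of f]
      have "family_dist pts Fam f \<le> rel_dist pts f (restrict g pts)" .
      also have "\<dots> = avg pts (\<lambda>x. of_bool (f x \<noteq> g x))"
        unfolding avg_of_bool[OF fin_sets(1)] rel_dist_def by (metis (mono_tags, lifting) restrict_apply')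
      also have "\<dots> \<le> real 4 * r" using g(3) rej_le by simp
      also have "\<dots> \<le> real rounds * r"
      proof (rule le_rounds)
        have "4 * 1 * 1 \<le> 2 ^ 15 * q ^ 12 * (card S * (d + 1)) ^ d" using posk posq by (intro mult_le_mono) auto
        then have "4 * 1 * 1 * 1 \<le> rounds" unfolding rounds_def by (intro mult_le_mono) auto
        then show "4 \<le> rounds" by simp
      qed
      finally show ?thesis .
    next
      case False
      have fg: "g (word_point L w om) \<in> carrier F" if "w \<in> words J S" "om \<in> On" for w om
        using g(1) word_point_closed[OF that] by blast
      have wc: "word_coords J S \<subseteq> words J S \<rightarrow> carrier F"
        using S_carrier bijs_mem by (fastforce simp: word_coords_def)
      obtain om where om: "om \<in> On" "\<not> ?pol (\<lambda>w. g (?wp w om))"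
        using polyf_of_word_points[OF finL finS S_carrier S_ne g(1) cf, of e] False by blast
      have "1 \<le> real (card (S \<times> {0..d})) ^ d * avg On (\<lambda>om. of_bool (\<not> ?pol (\<lambda>w. g (?wp w om))))"
      proof (rule junta_Schwartz_Zippel[where W = "words J S" and P = ?pol and ?x0.0 = om])
        fix w assume w: "w \<in> words J S"
        show "cube_free (Suc d) L (S \<times> {0..d}) (\<lambda>om. g (word_point L w om))"
          unfolding word_point_def
          by (rule cube_free_pmap[OF cf]) (use w in \<open>auto simp: PiE_iff bijs_def\<close>)
      qed (use finL finS S_ne fg om wc in \<open>auto intro: polyf_add polyf_minus polyf_const polyf_ext\<close>)
      also have "avg On (\<lambda>om. of_bool (\<not> ?pol (\<lambda>w. g (?wp w om)))) \<le> (1 + 4 * real nw) * r"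
      proof -
        \<comment> \<open>Where \<open>f\<close> and \<open>g\<close> agree at all \<open>nw\<close>
          points, they are the same function of \<open>w\<close>. Each point is uniform, so each
          possible disagreement has probability at most \<open>4 * r\<close>.\<close>
        have "avg On (\<lambda>om. of_bool (\<not> ?pol (\<lambda>w. g (?wp w om))))
          \<le> avg On (\<lambda>om. of_bool (\<not> ?pol (\<lambda>w. f (?wp w om))) + (\<Sum>w\<in>words J S. of_bool (f (?wp w om) \<noteq> g (?wp w om))))"
        proof (rule avg_mono)
          fix om assume "om \<in> On"
          have nn: "0 \<le> (\<Sum>w\<in>words J S. of_bool (f (?wp w om) \<noteq> g (?wp w om)) :: real)"
            by (intro sum_nonneg) simp
          show "of_bool (\<not> ?pol (\<lambda>w. g (?wp w om))) \<le> of_bool (\<not> ?pol (\<lambda>w. f (?wp w om)))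
            + (\<Sum>w\<in>words J S. of_bool (f (?wp w om) \<noteq> g (?wp w om)) :: real)"
          proof (cases "\<exists>w\<in>words J S. f (?wp w om) \<noteq> g (?wp w om)")
            case True
            then obtain w where w: "w \<in> words J S" "f (?wp w om) \<noteq> g (?wp w om)" by blast
            have "1 \<le> (\<Sum>w\<in>words J S. of_bool (f (?wp w om) \<noteq> g (?wp w om)) :: real)"
              using member_le_sum[OF w(1), of "\<lambda>w. of_bool (f (?wp w om) \<noteq> g (?wp w om)) :: real"] w(2) fin_words by simp
            then show ?thesis by (auto simp: of_bool_def)
          next
            case False
            then have eq: "g (word_point L w om) = f (word_point L w om)" if "w \<in> words J S" for w
              using that by metis
            have "?pol (\<lambda>w. g (?wp w om))" if "?pol (\<lambda>w. f (?wp w om))"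
              by (rule polyf_ext[OF that eq])
            then show ?thesis using nn by (auto simp: of_bool_def)
          qed
        qed
        also have "\<dots> = avg On (\<lambda>om. of_bool (\<not> ?pol (\<lambda>w. f (?wp w om))))
          + (\<Sum>w\<in>words J S. avg On (\<lambda>om. of_bool (f (?wp w om) \<noteq> g (?wp w om))))"
          by (simp only: avg_add avg_sum)
        also have "\<dots> \<le> r + (\<Sum>w\<in>words J S. 4 * r)"
        proof (intro add_mono r2 sum_mono)
          fix w assume "w \<in> words J S"
          from avg_word_point[OF this, of "\<lambda>x. of_bool (f x \<noteq> g x)"]
          show "avg On (\<lambda>om. of_bool (f (?wp w om) \<noteq> g (?wp w om))) \<le> 4 * r"
            using g(3) rej_le by simp
        qed
        also have "\<dots> = (1 + 4 * real nw) * r" by (simp add: algebra_simps)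
        finally show ?thesis .
      qed
      finally have "1 \<le> real (card (S \<times> {0..d})) ^ d * ((1 + 4 * real nw) * r)" by (simp add: mult_left_mono)
      also have "\<dots> = real ((card S * (d + 1)) ^ d * (1 + 4 * nw)) * r"
        by (simp add: card_cartesian_product algebra_simps)
      also have "\<dots> \<le> real rounds * r"
      proof (rule le_rounds)
        have "1 * ((card S * (d + 1)) ^ d * (1 + 4 * nw)) \<le> (2 ^ 15 * q ^ 12) * ((card S * (d + 1)) ^ d * (1 + 4 * nw))"
          using posq by (intro mult_le_mono1)
        then show "(card S * (d + 1)) ^ d * (1 + 4 * nw) \<le> rounds"
          unfolding rounds_def by (simp only: mult_1 mult.assoc)
      qed
      finally show ?thesis using d1 by linarith
    qed
  qed
  then show ?thesis by (simp add: r_def)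
qed

section \<open>Number of queries\<close>

lemma card_I_le: "card I \<le> 2 ^ d * (card K + 1) ^ d"
proof -
  have "card I = (\<Sum>B\<in>small_sets. 2 ^ card B)"
    unfolding I_def using fin_small by (simp add: card_SigmaI card_Pow)
  also have "\<dots> \<le> (\<Sum>B\<in>small_sets. 2 ^ d)"
    by (intro sum_mono power_increasing) (auto simp: small_sets_def)
  also have "\<dots> \<le> 2 ^ d * (card K + 1) ^ d"
    using card_small_subsets_le[OF fin(3), of d] by (simp add: small_sets_def)
  finally show ?thesis .
qed

lemma nw_le: "nw \<le> card S ^ (card S * d)"
proof -
  have "card (bijs S S) \<le> card (PiE S (\<lambda>_. S))"
    using finS by (intro card_mono finite_PiE) (auto simp: bijs_def)
  then have "card (bijs S S) \<le> card S ^ card S" using finS by (simp add: card_PiE)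
  then have "card (bijs S S) ^ d \<le> (card S ^ card S) ^ d" by (rule power_mono) simp
  then show ?thesis by (simp add: card_PiE power_mult)
qed

text \<open>All factors are expressed as powers of \<open>x = card S * d\<close>. Two letters ensure
  \<open>2 \<le> x\<close>, so that numerical constants can be absorbed into powers of
  \<open>x\<close>.\<close>

lemma total_queries_le:
  assumes s: "2 \<le> card S"
  shows "rounds * (q + nw) \<le> (card S * d) ^ (114 * card S ^ 3 * d)"
proof -
  define x where "x = card S * d"
  have x: "2 \<le> x" using mult_le_mono[OF s d_pos] by (simp add: x_def)
  have x1: "1 \<le> x ^ n" for n using x by (simp add: Suc_le_eq)
  have two: "2 ^ n \<le> x ^ n" for n using x by (rule power_mono) simp
  have K1: "card K + 1 \<le> x ^ 5"
  proof -
    have "card K + 1 \<le> 8 * x\<^sup>2" using x1[of 2] by (simp add: cardK x_def)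
    also have "\<dots> \<le> x ^ 3 * x\<^sup>2" using two[of 3] by (intro mult_le_mono1) simp
    finally show ?thesis by (simp add: power_add[symmetric])
  qed
  have "card I \<le> x ^ d * (x ^ 5) ^ d"
    using card_I_le mult_le_mono[OF two[of d] power_mono[OF K1, of d]] by (meson le0 order_trans)
  also have "\<dots> = x ^ (6 * d)" by (simp add: power_mult[symmetric] power_add[symmetric])
  finally have "q \<le> 2 * x ^ (6 * d)" using x1[of "6 * d"] by simp
  also have "\<dots> \<le> x ^ d * x ^ (6 * d)"
    using two[of 1] power_increasing[of 1 d x] x d_pos by (intro mult_le_mono1) simp
  finally have q: "q \<le> x ^ (7 * d)" by (simp add: power_add[symmetric])
  have k2: "(card S * (d + 1)) ^ d \<le> x ^ (2 * d)"
  proof -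
    have "card S * (d + 1) \<le> 2 * x" using d_pos by (simp add: x_def)
    also have "\<dots> \<le> x\<^sup>2" using x by (simp add: power2_eq_square)
    finally show ?thesis unfolding power_mult by (rule power_mono) simp
  qed
  have "card S \<le> x" using d_pos by (simp add: x_def)
  then have "card S ^ x \<le> x ^ x" by (rule power_mono) simp
  then have w: "nw \<le> x ^ x" using nw_le unfolding x_def by linarith
  have w4: "1 + 4 * nw \<le> x ^ (3 + x)"
  proof -
    have "1 + 4 * nw \<le> 2 ^ 3 * x ^ x" using w x1[of x] by simp
    also have "\<dots> \<le> x ^ 3 * x ^ x" using two[of 3] by (rule mult_le_mono1)
    finally show ?thesis by (simp add: power_add)
  qed
  have qw: "q + nw \<le> x ^ (1 + 7 * d + x)"
  proof -
    have "q + nw \<le> x ^ (7 * d + x) + x ^ (7 * d + x)"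
      using q w x by (intro add_mono order_trans[OF q] order_trans[OF w] power_increasing) auto
    also have "\<dots> \<le> x * x ^ (7 * d + x)" using x by (simp flip: mult_2)
    finally show ?thesis by simp
  qed
  have "rounds * (q + nw) \<le> (x ^ 15 * (x ^ (7 * d)) ^ 12 * x ^ (2 * d) * x ^ (3 + x)) * x ^ (1 + 7 * d + x)"
    unfolding rounds_def using two[of 15] power_mono[OF q, of 12] k2 w4 qw by (intro mult_le_mono) auto
  also have "\<dots> = x ^ (15 + 7 * d * 12 + 2 * d + (3 + x) + (1 + 7 * d + x))"
    by (simp only: power_mult[symmetric] power_add[symmetric])
  also have "\<dots> = x ^ (19 + 93 * d + 2 * x)" by (rule arg_cong[of _ _ "\<lambda>n. x ^ n"]) simp
  \<comment> \<open>Since \<open>1 \<le> d\<close>, and both \<open>d\<close> and \<open>x\<close>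
    are at most \<open>card S ^ 3 * d\<close>, the exponent is bounded with the constant 19 + 93 + 2
    = 114.\<close>
  also have "\<dots> \<le> x ^ (114 * card S ^ 3 * d)"
  proof (rule power_increasing)
    have s3: "card S \<le> card S ^ 3" "1 \<le> card S ^ 3" using s by (auto intro: self_le_power simp: Suc_le_eq)
    have "x \<le> card S ^ 3 * d" unfolding x_def using s3 by (intro mult_le_mono1)
    moreover have "d \<le> card S ^ 3 * d" using s3(2) mult_le_mono1[of 1 "card S ^ 3" d] by simp
    ultimately show "19 + 93 * d + 2 * x \<le> 114 * card S ^ 3 * d" using d_pos by linarith
  qed (use x in simp)
  finally show ?thesis unfolding x_def .
qed

lemma low_degree_testable:
  assumes e: "e \<le> d" and s: "2 \<le> card S"
  shows "nonadaptive_one_sided_testable ((card S * d) ^ (114 * card S ^ 3 * d)) pts (carrier F)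
    {f \<in> PiE pts (\<lambda>_. carrier F). polyf (coords L) pts e f}"
    (is "nonadaptive_one_sided_testable _ _ _ ?Fam")
proof -
  define Q where "Q p = (SOME xs. set xs = queries p \<and> distinct xs)" for p
  have Q: "set (Q p) = queries p" "distinct (Q p)" if "p \<in> Tn \<times> On" for p
    unfolding Q_def using someI_ex[OF finite_distinct_list[OF queries_bounds(2)[OF that]]] by auto
  have "nonadaptive_one_sided_testable (rounds * (q + nw)) pts (carrier F) ?Fam"
  proof (rule testable_by_repetition[of _ "Tn \<times> On"])
    show "set (Q p) \<subseteq> pts \<and> length (Q p) \<le> q + nw" if "p \<in> Tn \<times> On" for p
      using Q[OF that] queries_bounds[OF that] distinct_card[of "Q p"] by simp
    have "restrict (\<lambda>_. \<zero>) pts \<in> ?Fam" by (auto intro: polyf_ext[OF polyf_const[OF zero_closed]])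
    then show "?Fam \<noteq> {}" by blast
    fix f assume "f \<in> PiE pts (\<lambda>_. carrier F)"
    from round_sound[OF e this refl]
    show "family_dist pts ?Fam f \<le> real rounds * avg (Tn \<times> On) (\<lambda>p. of_bool (\<forall>g\<in>?Fam. \<exists>x\<in>set (Q p). g x \<noteq> f x))"
      using Q by (simp cong: avg_cong)
  qed (use fin_sets ne_sets fin_On in auto)
  then show ?thesis using total_queries_le[OF s] by (rule testable_mono)
qed

end

theorem theorem1p3:
  shows "\<exists>C :: nat. \<forall>(F :: 'a ring) (S :: 'a set) (s :: nat) (d :: nat) (n :: nat).
    field F \<longrightarrow> S \<subseteq> carrier F \<longrightarrow> finite S \<longrightarrow> card S = s \<longrightarrow>
      nonadaptive_one_sided_testable (query_bound C s d)
        (grid S n) (carrier F) (low_degree_functions F S n d)"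
proof (intro exI[of _ 114] allI impI)
  fix F :: "'a ring" and S :: "'a set" and s d n :: nat
  assume F: "field F" and S: "S \<subseteq> carrier F" "finite S" and s: "card S = s"
  interpret F: field F by (rule F)
  let ?G = "PiE {..<n} (\<lambda>_. S)"
  have fam: "low_degree_functions F S n d = {f \<in> PiE ?G (\<lambda>_. carrier F). F.polyf (coords {..<n}) ?G d f}"
    by (rule F.low_degree_functions_eq[OF S(1)])
  show "nonadaptive_one_sided_testable (query_bound 114 s d) (grid S n) (carrier F) (low_degree_functions F S n d)"
  proof (cases "2 \<le> s")
    case True
    \<comment> \<open>Degree 0 uses the blocks and colours of degree 1: constants pass that block
      test, and the permutation test still checks degree \<open>d\<close>.\<close>
    interpret grid_test F "{..<n}" S "max 1 d"
      using S s True by unfold_locales auto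
    show ?thesis
      using low_degree_testable[of d] True s by (simp add: fam grid_def query_bound_def)
  next
    case False
    \<comment> \<open>With fewer than two letters the grid has at most one point. Every function on
      it is constant, so the tester without queries is sound.\<close>
    then have "card ?G \<le> 1" using power_le_one[of s n] by (simp add: card_PiE s)
    moreover have "finite ?G" using S(2) by (intro finite_PiE) auto
    ultimately have single: "x = y" if "x \<in> ?G" "y \<in> ?G" for x y
      using that by (auto simp: card_le_Suc0_iff_eq)
    have "f \<in> low_degree_functions F S n d" if f: "f \<in> PiE ?G (\<lambda>_. carrier F)" for f
    proof -
      have "F.polyf (coords {..<n}) ?G d f"
      proof (cases "?G = {}")
        case True
        then show ?thesis by (intro F.polyf_ext[OF F.polyf_const[OF F.zero_closed]]) auto
      next
        case False
        then obtain x where x: "x \<in> ?G" by blast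
        then have "f x \<in> carrier F" using f by auto
        then show ?thesis by (rule F.polyf_ext[OF F.polyf_const]) (use single[OF _ x] in auto)
      qed
      then show ?thesis using f by (simp add: fam)
    qed
    then show ?thesis by (intro testable_trivial) (auto simp: grid_def)
  qed
qed

end
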